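(* Let $\Omega\subset\mathbb{R}^n$ be open and bounded, $m>n$, $1<p<\infty$, $Y^m=[0,1)^m$, and let $\mathbf{R}\in\mathbb{R}^{m\times n}$ satisfy $\mathbf{R}^*k\neq0$ for all $k\in\mathbb{Z}^m\setminus\{0\}$. Then a function $v\in L^p(\Omega\times Y^m;\mathbb{R}^n)$ is the $\mathbf{R}$-two-scale limit of a sequence $\{\nabla v_\varepsilon\}_\varepsilon$ with $\{v_\varepsilon\}_\varepsilon$ bounded in $W^{1,p}(\Omega)$ if and only if there exist $v_0\in W^{1,p}(\Omega)$ and $v_1\in L^p(\Omega;\mathcal{G}^p_{\mathbf{R}})$ such that $v=\nabla v_0+v_1$, where $$\mathcal{G}^p_{\mathbf{R}}:=\{w\in L^p_\#(Y^m;\mathbb{R}^n):\ \hat w_k=\lambda_k\mathbf{R}^*k\ \text{for all } k\in\mathbb{Z}^m, \text{ for some } \{\lambda_k\}_{k\in\mathbb{Z}^m}\subset\mathbb{C} \text{ with } \lambda_0=0\},$$ with $\hat w_k:=\int_{Y^m}w(y)e^{-2\pi i k\cdot y}\,dy$.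
   Context: $\varepsilon$ ranges over a sequence of positive numbers converging to $0$. $L^p_\#(Y^m;\mathbb{R}^n)$ denotes the $Y^m$-periodic functions in $L^p_{\rm loc}(\mathbb{R}^m;\mathbb{R}^n)$; $C_\#(Y^m;\mathbb{R}^n)$ the continuous $Y^m$-periodic ones. A sequence $\{u_\varepsilon\}\subset L^p(\Omega;\mathbb{R}^n)$ $\mathbf{R}$-two-scale converges to $u\in L^p(\Omega\times Y^m;\mathbb{R}^n)$ if for all $\varphi\in L^{p'}(\Omega;C_\#(Y^m;\mathbb{R}^n))$ ($p'=p/(p-1)$), $\lim_{\varepsilon\to0^+}\int_\Omega u_\varepsilon(x)\cdot\varphi(x,\mathbf{R}x/\varepsilon)\,dx=\int_\Omega\int_{Y^m}u(x,y)\cdot\varphi(x,y)\,dy\,dx$ (here $\mathcal{L}^m(Y^m)=1$). *)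

theory Defs
  imports "HOL-Analysis.Analysis"
begin

definition int_vec :: "real^'m \<Rightarrow> bool" where
  "int_vec k \<longleftrightarrow> (\<forall>i. k $ i \<in> \<int>)"

definition unit_cell :: "(real^'m) set" where
  "unit_cell = {y. \<forall>i. 0 \<le> y $ i \<and> y $ i < 1}"

definition periodic_cell :: "(real^'m \<Rightarrow> 'b) \<Rightarrow> bool" where
  "periodic_cell w \<longleftrightarrow> (\<forall>y k. int_vec k \<longrightarrow> w (y + k) = w y)"

definition Lp_fun :: "'a measure \<Rightarrow> real \<Rightarrow> ('a \<Rightarrow> 'b::real_normed_vector) \<Rightarrow> bool" where
  "Lp_fun M p f \<longleftrightarrow> f \<in> borel_measurable M \<and> integrable M (\<lambda>x. norm (f x) powr p)"

definition partial_deriv :: "'n \<Rightarrow> (real^'n \<Rightarrow> real) \<Rightarrow> real^'n \<Rightarrow> real" where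
  "partial_deriv i f x = frechet_derivative f (at x) (axis i 1)"

fun iter_partial :: "'n list \<Rightarrow> (real^'n \<Rightarrow> real) \<Rightarrow> real^'n \<Rightarrow> real" where
  "iter_partial [] f = f"
| "iter_partial (i # is) f = partial_deriv i (iter_partial is f)"

definition smooth_fun :: "(real^'n \<Rightarrow> real) \<Rightarrow> bool" where
  "smooth_fun f \<longleftrightarrow> (\<forall>is x. iter_partial is f differentiable (at x))"

definition test_fun :: "(real^'n) set \<Rightarrow> (real^'n \<Rightarrow> real) \<Rightarrow> bool" where
  "test_fun \<Omega> \<phi> \<longleftrightarrow> smooth_fun \<phi> \<and> compact (closure {x. \<phi> x \<noteq> 0})
      \<and> closure {x. \<phi> x \<noteq> 0} \<subseteq> \<Omega>"

definition locally_integrable_on :: "(real^'n) set \<Rightarrow> (real^'n \<Rightarrow> 'b::{banach,second_countable_topology}) \<Rightarrow> bool" where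
  "locally_integrable_on \<Omega> f \<longleftrightarrow> (\<forall>K. compact K \<and> K \<subseteq> \<Omega> \<longrightarrow> integrable (lebesgue_on K) f)"

definition weak_gradient :: "(real^'n) set \<Rightarrow> (real^'n \<Rightarrow> real) \<Rightarrow> (real^'n \<Rightarrow> real^'n) \<Rightarrow> bool" where
  "weak_gradient \<Omega> u g \<longleftrightarrow> locally_integrable_on \<Omega> u \<and> locally_integrable_on \<Omega> g \<and>
     (\<forall>i \<phi>. test_fun \<Omega> \<phi> \<longrightarrow>
        (LINT x|lebesgue_on \<Omega>. u x * partial_deriv i \<phi> x) = - (LINT x|lebesgue_on \<Omega>. g x $ i * \<phi> x))"

definition W1p :: "(real^'n) set \<Rightarrow> real \<Rightarrow> (real^'n \<Rightarrow> real) \<Rightarrow> (real^'n \<Rightarrow> real^'n) \<Rightarrow> bool" where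
  "W1p \<Omega> p u g \<longleftrightarrow> Lp_fun (lebesgue_on \<Omega>) p u \<and> Lp_fun (lebesgue_on \<Omega>) p g \<and> weak_gradient \<Omega> u g"

definition W1p_norm_pow :: "(real^'n) set \<Rightarrow> real \<Rightarrow> (real^'n \<Rightarrow> real) \<Rightarrow> (real^'n \<Rightarrow> real^'n) \<Rightarrow> real" where
  "W1p_norm_pow \<Omega> p u g = (LINT x|lebesgue_on \<Omega>. \<bar>u x\<bar> powr p) + (LINT x|lebesgue_on \<Omega>. norm (g x) powr p)"

text \<open>Admissible test functions: L^{p'}(Omega; C_#(Y^m;R^n)), with C_# realised inside the
  Banach space of bounded continuous functions (sup norm).\<close>
definition two_scale_test :: "(real^'n) set \<Rightarrow> real \<Rightarrow> (real^'n \<Rightarrow> ((real^'m) \<Rightarrow>\<^sub>C (real^'n))) \<Rightarrow> bool" where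
  "two_scale_test \<Omega> q \<phi> \<longleftrightarrow> (\<forall>x. periodic_cell (apply_bcontfun (\<phi> x))) \<and> Lp_fun (lebesgue_on \<Omega>) q \<phi>"

definition R_two_scale_conv ::
  "(real^'n) set \<Rightarrow> real \<Rightarrow> real^'n^'m \<Rightarrow> (nat \<Rightarrow> real) \<Rightarrow> (nat \<Rightarrow> real^'n \<Rightarrow> real^'n)
     \<Rightarrow> (real^'n \<Rightarrow> real^'m \<Rightarrow> real^'n) \<Rightarrow> bool" where
  "R_two_scale_conv \<Omega> p R eps u v \<longleftrightarrow>
     (\<forall>\<phi>. two_scale_test \<Omega> (p / (p - 1)) \<phi> \<longrightarrow>
        (\<lambda>j. LINT x|lebesgue_on \<Omega>. u j x \<bullet> apply_bcontfun (\<phi> x) ((1 / eps j) *\<^sub>R (R *v x)))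
        \<longlonglongrightarrow> (LINT x|lebesgue_on \<Omega>. (LINT y|lebesgue_on unit_cell. v x y \<bullet> apply_bcontfun (\<phi> x) y)))"

definition fourier_coeff :: "(real^'m \<Rightarrow> real^'n) \<Rightarrow> real^'m \<Rightarrow> complex^'n" where
  "fourier_coeff w k = (\<chi> i. LINT y|lebesgue_on unit_cell.
      complex_of_real (w y $ i) * exp (- (2 * pi * \<i>) * complex_of_real (k \<bullet> y)))"

definition G_R :: "real \<Rightarrow> real^'n^'m \<Rightarrow> (real^'m \<Rightarrow> real^'n) set" where
  "G_R p R = {w. periodic_cell w \<and> w \<in> borel_measurable lebesgue \<and>
                 Lp_fun (lebesgue_on unit_cell) p w \<and>
                 (\<exists>lam::real^'m \<Rightarrow> complex. lam 0 = 0 \<and>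
                    (\<forall>k. int_vec k \<longrightarrow>
                       fourier_coeff w k = (\<chi> i. lam k * complex_of_real ((transpose R *v k) $ i))))}"

end

theory Submission
  imports Defs
begin

text \<open>
Necessity. Let \<open>w\<close> be the two-scale limit of the gradients and \<open>g\<^sub>0\<close> its mean over the cell. The
potentials have convex combinations that converge in \<open>L\<^sup>1\<close>, so \<open>g\<^sub>0\<close> is the weak gradient of some
\<open>v\<^sub>0\<close>. For an integer vector \<open>k \<noteq> 0\<close> and a direction \<open>\<xi>\<close> orthogonal to \<open>R\<^sup>* k\<close>, testing with
\<open>\<psi>(x) e\<^sup>i\<^sup>\<theta> \<xi>\<close>, \<open>\<theta> = 2\<pi> k \<cdot> R x / \<epsilon>\<close>, and integrating by parts never differentiates
the phase; since the potentials themselves have no oscillating part in the limit (\<open>R\<^sup>* k \<noteq> 0\<close>),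
the \<open>k\<close>-th Fourier coefficient of \<open>w(x, \<cdot>)\<close> is orthogonal to \<open>\<xi>\<close>, hence parallel to \<open>R\<^sup>* k\<close>.

Sufficiency. Convolving \<open>v\<^sub>1(x, \<cdot>)\<close> with a trigonometric approximate identity and replacing the
coefficients by test functions of \<open>x\<close> approximates \<open>v\<^sub>1\<close> by finite sums of modes
\<open>\<lambda>\<^sub>k(x) R\<^sup>* k e\<^sup>i\<^sup>\<theta>\<close>. Each is, up to \<open>O(\<epsilon>)\<close>, the gradient of the potential
\<open>\<epsilon> \<lambda>\<^sub>k(x) e\<^sup>i\<^sup>\<theta> / (2\<pi>i)\<close>. As \<open>R\<^sup>* k \<noteq> 0\<close> for integer \<open>k \<noteq> 0\<close>, the Riemann-Lebesgue lemma
yields the mean value property for quasi-periodic oscillations, which identifies the two-scale limit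
of these gradients and bounds their \<open>L\<^sup>p\<close> norms; a diagonal choice of the approximation concludes.
\<close>

subsection \<open>Smooth functions\<close>

lemma smooth_fun_partial_deriv:
  assumes "smooth_fun f"
  shows "smooth_fun (partial_deriv i f)"
proof -
  have "iter_partial is (partial_deriv i f) = iter_partial (is @ [i]) f" for "is"
    by (induction "is") auto
  then show ?thesis using assms unfolding smooth_fun_def by metis
qed

lemma smooth_fun_differentiable: "smooth_fun f \<Longrightarrow> f differentiable (at x)"
  unfolding smooth_fun_def by (metis iter_partial.simps(1))

lemma smooth_fun_coinduct:
  assumes "P f"
    and "\<And>g x. P g \<Longrightarrow> g differentiable (at x)"
    and "\<And>g i. P g \<Longrightarrow> P (partial_deriv i g)"
  shows "smooth_fun f"
proof -
  have "P (iter_partial is f)" for "is"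
    by (induction "is") (auto simp: assms)
  then show ?thesis unfolding smooth_fun_def using assms(2) by blast
qed

lemma partial_derivI:
  assumes "(f has_derivative f') (at x)"
  shows "partial_deriv i f x = f' (axis i 1)"
  unfolding partial_deriv_def using frechet_derivative_at[OF assms] by simp

lemma partial_deriv_const: "partial_deriv i (\<lambda>x. c) x = 0"
  by (subst partial_derivI[of _ "\<lambda>h. 0"]) auto

lemma partial_deriv_add:
  assumes "f differentiable (at x)" "g differentiable (at x)"
  shows "partial_deriv i (\<lambda>x. f x + g x) x = partial_deriv i f x + partial_deriv i g x"
proof -
  obtain f' g' where "(f has_derivative f') (at x)" "(g has_derivative g') (at x)"
    using assms unfolding differentiable_def by metis
  then show ?thesis by (auto simp: partial_derivI partial_derivI[OF has_derivative_add])
qed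

lemma partial_deriv_mult:
  assumes "f differentiable (at x)" "g differentiable (at x)"
  shows "partial_deriv i (\<lambda>x. f x * g x) x = f x * partial_deriv i g x + partial_deriv i f x * g x"
proof -
  obtain f' g' where "(f has_derivative f') (at x)" "(g has_derivative g') (at x)"
    using assms unfolding differentiable_def by metis
  then show ?thesis by (auto simp: partial_derivI partial_derivI[OF has_derivative_mult])
qed

lemma partial_deriv_cmult:
  "f differentiable (at x) \<Longrightarrow> partial_deriv i (\<lambda>x. c * f x) x = c * partial_deriv i f x"
  by (simp add: partial_deriv_mult partial_deriv_const)

lemma smooth_fun_const: "smooth_fun (\<lambda>x. c)"
  by (rule smooth_fun_coinduct[where P = "\<lambda>f. \<exists>c. f = (\<lambda>x. c)"])
     (auto simp: partial_deriv_const[abs_def])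

text \<open>The phase \<open>a\<close> makes the family of plane waves closed under differentiation:
  a quarter period turns the cosine into the negative sine.\<close>

definition wave :: "'a::real_inner \<Rightarrow> real \<Rightarrow> 'a \<Rightarrow> real" where
  "wave r a x = cos (r \<bullet> x + a)"

lemma abs_wave_le_1: "\<bar>wave r a x\<bar> \<le> 1"
  by (simp add: wave_def)

lemma continuous_on_wave: "continuous_on S (wave r a)"
  unfolding wave_def by (intro continuous_intros)

lemma borel_measurable_wave [measurable]: "wave r a \<in> borel_measurable borel"
  by (intro borel_measurable_continuous_onI continuous_on_wave)

lemma wave_shift: "wave r a (x + c) = wave r (a + r \<bullet> c) x"
  by (simp add: wave_def inner_add_right algebra_simps)

lemma wave_antiphase: "wave r (a + pi) x = - wave r a x" "wave r (a - pi) x = - wave r a x"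
proof -
  have "r \<bullet> x + (a - pi) = (r \<bullet> x + a) - pi" by simp
  then show "wave r (a - pi) x = - wave r a x" by (simp only: wave_def cos_minus_pi)
  have "r \<bullet> x + (a + pi) = (r \<bullet> x + a) + pi" by simp
  then show "wave r (a + pi) x = - wave r a x" by (simp only: wave_def cos_periodic_pi)
qed

lemma wave_quarter_phase:
  "wave r (a + pi / 2) x = - sin (r \<bullet> x + a)" "wave r (a - pi / 2) x = sin (r \<bullet> x + a)"
proof -
  have "r \<bullet> x + (a + pi / 2) = (r \<bullet> x + a) + pi / 2" "r \<bullet> x + (a - pi / 2) = (r \<bullet> x + a) - pi / 2"
    by simp_all
  then show "wave r (a + pi / 2) x = - sin (r \<bullet> x + a)" "wave r (a - pi / 2) x = sin (r \<bullet> x + a)"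
    unfolding wave_def by (simp_all only: cos_add cos_diff) simp_all
qed

lemma has_derivative_wave:
  "(wave r a has_derivative (\<lambda>h. (r \<bullet> h) * wave r (a + pi / 2) x)) (at x)"
  unfolding wave_def[abs_def] wave_quarter_phase(1)[unfolded wave_def]
  by (auto intro!: derivative_eq_intros)

lemma partial_deriv_wave: "partial_deriv i (wave r a) x = r $ i * wave r (a + pi / 2) x"
  using partial_derivI[OF has_derivative_wave, of i r a x] by (simp add: inner_axis)

lemma smooth_fun_wave: "smooth_fun (wave r a)"
proof (rule smooth_fun_coinduct[where P = "\<lambda>f. \<exists>c a. f = (\<lambda>x. c * wave r a x)"])
  have diff: "wave r a differentiable (at x)" for a x
    using has_derivative_wave differentiableI by blast
  show "\<exists>c b. wave r a = (\<lambda>x. c * wave r b x)" by (rule exI[of _ 1]) auto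
  show "g differentiable (at x)" if "\<exists>c a. g = (\<lambda>x. c * wave r a x)" for g x
    using that diff by (auto intro!: differentiable_mult)
  show "\<exists>c a. partial_deriv i g = (\<lambda>x. c * wave r a x)" if g: "\<exists>c a. g = (\<lambda>x. c * wave r a x)" for g i
  proof -
    obtain c b where "g = (\<lambda>x. c * wave r b x)" using g by blast
    then have "partial_deriv i g = (\<lambda>x. (c * r $ i) * wave r (b + pi / 2) x)"
      by (auto simp: partial_deriv_cmult[OF diff] partial_deriv_wave)
    then show ?thesis by blast
  qed
qed

text \<open>The functions \<open>exp_tail k\<close> for varying \<open>k\<close> span a space closed under differentiation,
  which makes \<open>exp_tail 0\<close> smooth.\<close>

definition exp_tail :: "nat \<Rightarrow> real \<Rightarrow> real" where
  "exp_tail k t = (if t > 0 then exp (- 1 / t) / t ^ k else 0)"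

lemma exp_tail_0_bounds: "0 \<le> exp_tail 0 t" "exp_tail 0 t \<le> 1"
  by (auto simp: exp_tail_def)

lemma exp_tail_tendsto_0: "(exp_tail k \<longlongrightarrow> 0) (at 0)"
proof -
  have "((\<lambda>t. (inverse t) ^ k / exp (inverse t)) \<longlongrightarrow> (0::real)) (at_right 0)"
    by (rule filterlim_compose[OF tendsto_power_div_exp_0 filterlim_inverse_at_top_right])
  then have "(exp_tail k \<longlongrightarrow> 0) (at_right 0)"
    by (rule Lim_transform_eventually)
       (auto simp: eventually_at_filter exp_tail_def field_simps exp_minus power_inverse)
  moreover have "(exp_tail k \<longlongrightarrow> 0) (at_left 0)"
    by (rule tendsto_eventually) (auto simp: eventually_at_filter exp_tail_def)
  ultimately show ?thesis by (simp add: filterlim_split_at)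
qed

lemma exp_tail_0_tendsto_1:
  assumes "filterlim f at_top F"
  shows "((\<lambda>x. exp_tail 0 (f x)) \<longlongrightarrow> 1) F"
proof -
  have "((\<lambda>x. exp (- inverse (f x))) \<longlongrightarrow> exp (- 0)) F"
    by (intro tendsto_exp tendsto_minus filterlim_compose[OF tendsto_inverse_0_at_top[OF filterlim_ident]] assms)
  moreover have "\<forall>\<^sub>F x in F. exp (- inverse (f x)) = exp_tail 0 (f x)"
    using filterlim_at_top_dense[THEN iffD1, OF assms, rule_format, of 0]
    by eventually_elim (auto simp: exp_tail_def inverse_eq_divide)
  ultimately show ?thesis using Lim_transform_eventually by fastforce
qed

lemma exp_tail_has_real_derivative:
  "(exp_tail k has_real_derivative (exp_tail (k + 2) t - real k * exp_tail (Suc k) t)) (at t)"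
proof -
  consider (pos) "t > 0" | (neg) "t < 0" | (zero) "t = 0" by linarith
  then show ?thesis
  proof cases
    case pos
    have "((\<lambda>t. exp (- 1 / t) / t ^ k) has_real_derivative
        (exp_tail (k + 2) t - real k * exp_tail (Suc k) t)) (at t)"
      using pos
      by (auto intro!: derivative_eq_intros simp: exp_tail_def field_simps power2_eq_square)
         (cases k; simp add: field_simps)
    then show ?thesis
      by (rule has_field_derivative_transform_within_open[where S = "{0<..}"])
         (use pos in \<open>auto simp: exp_tail_def\<close>)
  next
    case neg
    have "((\<lambda>t. 0) has_real_derivative 0) (at t)" by simp
    then have "(exp_tail k has_real_derivative 0) (at t)"
      by (rule has_field_derivative_transform_within_open[where S = "{..<0}"])
         (use neg in \<open>auto simp: exp_tail_def\<close>)
    then show ?thesis using neg by (simp add: exp_tail_def)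
  next
    case zero
    have "((\<lambda>h. (exp_tail k (0 + h) - exp_tail k 0) / h) \<longlongrightarrow> 0) (at 0)"
      by (rule Lim_transform_eventually[OF exp_tail_tendsto_0[of "Suc k"]])
         (auto simp: eventually_at_filter exp_tail_def)
    then show ?thesis using zero by (simp add: DERIV_def exp_tail_def)
  qed
qed

lemma exp_tail_coord_has_derivative:
  fixes x :: "real^'n"
  shows "((\<lambda>x. exp_tail k (c * x $ i + d)) has_derivative
     (\<lambda>h. (exp_tail (k + 2) (c * x $ i + d) - real k * exp_tail (Suc k) (c * x $ i + d)) * (c * h $ i))) (at x)"
proof -
  have "((\<lambda>x. c * x $ i + d) has_derivative (\<lambda>h. c * h $ i)) (at x)"
    by (auto intro!: derivative_eq_intros bounded_linear.has_derivative[OF bounded_linear_vec_nth])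
  then show ?thesis
    using exp_tail_has_real_derivative[of k "c * x $ i + d", unfolded has_field_derivative_def]
    using has_derivative_compose by fastforce
qed

inductive smooth_alg :: "(real^'n \<Rightarrow> real) \<Rightarrow> bool" where
  smooth: "smooth_fun f \<Longrightarrow> smooth_alg f"
| exp_tail: "smooth_alg (\<lambda>x. exp_tail k (c * x $ i + d))"
| add: "smooth_alg f \<Longrightarrow> smooth_alg g \<Longrightarrow> smooth_alg (\<lambda>x. f x + g x)"
| mult: "smooth_alg f \<Longrightarrow> smooth_alg g \<Longrightarrow> smooth_alg (\<lambda>x. f x * g x)"

lemma smooth_alg_const: "smooth_alg (\<lambda>x. c)"
  by (intro smooth_alg.smooth smooth_fun_const)

lemma smooth_alg_differentiable: "smooth_alg f \<Longrightarrow> f differentiable (at x)"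
proof (induction rule: smooth_alg.induct)
  case exp_tail
  then show ?case using exp_tail_coord_has_derivative differentiableI by blast
qed (auto intro: smooth_fun_differentiable differentiable_add differentiable_mult)

lemma smooth_alg_partial_deriv: "smooth_alg f \<Longrightarrow> smooth_alg (partial_deriv i f)"
proof (induction rule: smooth_alg.induct)
  case (smooth f)
  then show ?case by (intro smooth_alg.smooth smooth_fun_partial_deriv)
next
  case (exp_tail k c j d)
  have "partial_deriv i (\<lambda>x::real^'a. exp_tail k (c * x $ j + d)) =
      (\<lambda>x. (exp_tail (k + 2) (c * x $ j + d) +
          (- real k) * exp_tail (Suc k) (c * x $ j + d)) * (c * axis i 1 $ j))"
    by (rule ext, subst partial_derivI[OF exp_tail_coord_has_derivative]) simp
  then show ?case by (simp only:) (intro smooth_alg.intros smooth_alg_const)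
next
  case (add f g)
  have "partial_deriv i (\<lambda>x. f x + g x) = (\<lambda>x. partial_deriv i f x + partial_deriv i g x)"
    by (intro ext partial_deriv_add smooth_alg_differentiable add.hyps)
  then show ?case by (simp only:) (intro smooth_alg.add add.IH)
next
  case (mult f g)
  have "partial_deriv i (\<lambda>x. f x * g x) = (\<lambda>x. f x * partial_deriv i g x + partial_deriv i f x * g x)"
    by (intro ext partial_deriv_mult smooth_alg_differentiable mult.hyps)
  then show ?case by (simp only:) (intro smooth_alg.add smooth_alg.mult mult.hyps mult.IH)
qed

lemma smooth_alg_imp_smooth_fun: "smooth_alg f \<Longrightarrow> smooth_fun f"
  by (erule smooth_fun_coinduct[where P = smooth_alg])
     (auto intro: smooth_alg_differentiable smooth_alg_partial_deriv)

lemma smooth_fun_exp_tail: "smooth_fun (\<lambda>x. exp_tail k (c * x $ i + d))"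
  by (intro smooth_alg_imp_smooth_fun smooth_alg.exp_tail)

lemma smooth_fun_add: "smooth_fun f \<Longrightarrow> smooth_fun g \<Longrightarrow> smooth_fun (\<lambda>x. f x + g x)"
  by (simp add: smooth_alg_imp_smooth_fun smooth_alg.add smooth_alg.smooth)

lemma smooth_fun_mult: "smooth_fun f \<Longrightarrow> smooth_fun g \<Longrightarrow> smooth_fun (\<lambda>x. f x * g x)"
  by (simp add: smooth_alg_imp_smooth_fun smooth_alg.mult smooth_alg.smooth)

lemma smooth_fun_diff: "smooth_fun f \<Longrightarrow> smooth_fun g \<Longrightarrow> smooth_fun (\<lambda>x. f x - g x)"
  using smooth_fun_add[OF _ smooth_fun_mult[OF smooth_fun_const[of "-1"]], of f g] by simp

lemma smooth_fun_prod: "(\<And>i. i \<in> A \<Longrightarrow> smooth_fun (f i)) \<Longrightarrow> smooth_fun (\<lambda>x. \<Prod>i\<in>A. f i x)"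
  by (induction A rule: infinite_finite_induct) (auto intro: smooth_fun_const smooth_fun_mult)

lemma smooth_fun_continuous_on: "smooth_fun f \<Longrightarrow> continuous_on S f"
  by (meson differentiable_imp_continuous_within continuous_at_imp_continuous_on smooth_fun_differentiable)

lemma smooth_fun_borel_measurable: "smooth_fun f \<Longrightarrow> f \<in> borel_measurable borel"
  by (intro borel_measurable_continuous_onI smooth_fun_continuous_on)

subsection \<open>Test functions\<close>

lemma partial_deriv_eq_0_outside_support:
  assumes "x \<notin> closure {x. \<phi> x \<noteq> 0}"
  shows "partial_deriv i \<phi> x = 0"
proof -
  have "\<forall>\<^sub>F y in nhds x. y \<in> - closure {x. \<phi> x \<noteq> 0}"
    using assms by (intro eventually_nhds_in_open) auto
  then have "\<forall>\<^sub>F y in nhds x. 0 = \<phi> y"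
    by (rule eventually_mono) (use subsetD[OF closure_subset, of _ "{x. \<phi> x \<noteq> 0}"] in auto)
  then have "(\<phi> has_derivative (\<lambda>h. 0)) (at x)"
    by (intro has_derivative_transform_eventually[of "\<lambda>x. 0" "\<lambda>h. 0" x UNIV \<phi>])
       (auto simp: eventually_nhds_conv_at)
  from partial_derivI[OF this] show ?thesis .
qed

lemma test_fun_smooth: "test_fun \<Omega> \<phi> \<Longrightarrow> smooth_fun \<phi>"
  by (simp add: test_fun_def)

lemma test_fun_differentiable: "test_fun \<Omega> \<phi> \<Longrightarrow> \<phi> differentiable (at x)"
  by (intro smooth_fun_differentiable test_fun_smooth)

lemma test_fun_borel_measurable: "test_fun \<Omega> \<phi> \<Longrightarrow> \<phi> \<in> borel_measurable borel"
  by (intro smooth_fun_borel_measurable test_fun_smooth)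

lemma test_fun_mono: "test_fun \<Omega> \<phi> \<Longrightarrow> \<Omega> \<subseteq> \<Omega>' \<Longrightarrow> test_fun \<Omega>' \<phi>"
  by (auto simp: test_fun_def)

lemma test_funI_compact:
  assumes "smooth_fun \<phi>" "compact K" "K \<subseteq> \<Omega>" "\<And>x. x \<notin> K \<Longrightarrow> \<phi> x = 0"
  shows "test_fun \<Omega> \<phi>"
proof -
  have "closure {x. \<phi> x \<noteq> 0} \<subseteq> K"
    using assms by (intro closure_minimal) (auto intro: compact_imp_closed)
  moreover have "compact (K \<inter> closure {x. \<phi> x \<noteq> 0})"
    using assms by (intro compact_Int_closed) auto
  ultimately show ?thesis using assms unfolding test_fun_def by (simp add: inf.absorb2)
qed

lemma test_funE_compact:
  assumes "test_fun \<Omega> \<phi>"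
  obtains K where "compact K" "K \<subseteq> \<Omega>" "\<And>x. x \<notin> K \<Longrightarrow> \<phi> x = 0"
proof (rule that[of "closure {x. \<phi> x \<noteq> 0}"])
  show "\<phi> x = 0" if "x \<notin> closure {x. \<phi> x \<noteq> 0}" for x
    using that subsetD[OF closure_subset, of x "{x. \<phi> x \<noteq> 0}"] by auto
qed (use assms in \<open>auto simp: test_fun_def\<close>)

lemma test_fun_eq_0: "test_fun \<Omega> \<phi> \<Longrightarrow> x \<notin> \<Omega> \<Longrightarrow> \<phi> x = 0"
  by (meson subsetD test_funE_compact)

lemma test_fun_smooth_mult:
  assumes "smooth_fun f" "test_fun \<Omega> \<phi>"
  shows "test_fun \<Omega> (\<lambda>x. f x * \<phi> x)"
proof -
  obtain K where "compact K" "K \<subseteq> \<Omega>" "\<And>x. x \<notin> K \<Longrightarrow> \<phi> x = 0"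
    using test_funE_compact[OF assms(2)] by metis
  then show ?thesis
    using smooth_fun_mult[OF assms(1) test_fun_smooth[OF assms(2)]]
    by (intro test_funI_compact[of _ K]) auto
qed

lemma test_fun_cmult: "test_fun \<Omega> \<phi> \<Longrightarrow> test_fun \<Omega> (\<lambda>x. c * \<phi> x)"
  by (intro test_fun_smooth_mult smooth_fun_const)

lemma test_fun_add:
  assumes "test_fun \<Omega> \<phi>" "test_fun \<Omega> \<psi>"
  shows "test_fun \<Omega> (\<lambda>x. \<phi> x + \<psi> x)"
proof -
  obtain K L where "compact K" "K \<subseteq> \<Omega>" "\<And>x. x \<notin> K \<Longrightarrow> \<phi> x = 0"
    "compact L" "L \<subseteq> \<Omega>" "\<And>x. x \<notin> L \<Longrightarrow> \<psi> x = 0"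
    using test_funE_compact assms by metis
  then show ?thesis
    using smooth_fun_add[OF assms[THEN test_fun_smooth]]
    by (intro test_funI_compact[of _ "K \<union> L"]) auto
qed

lemma test_fun_0: "test_fun \<Omega> (\<lambda>x. 0)"
  by (intro test_funI_compact[of _ "{}"] smooth_fun_const) auto

lemma test_fun_partial_deriv:
  assumes "test_fun \<Omega> \<phi>"
  shows "test_fun \<Omega> (partial_deriv i \<phi>)"
  using assms
  by (intro test_funI_compact[of _ "closure {x. \<phi> x \<noteq> 0}"] smooth_fun_partial_deriv)
     (auto simp: test_fun_def partial_deriv_eq_0_outside_support)

lemma test_fun_bounded:
  assumes "test_fun \<Omega> \<phi>"
  obtains B where "B > 0" "\<And>x. \<bar>\<phi> x\<bar> \<le> B"
proof -
  obtain K where K: "compact K" "K \<subseteq> \<Omega>" "\<And>x. x \<notin> K \<Longrightarrow> \<phi> x = 0"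
    using test_funE_compact assms by metis
  have "compact (\<phi> ` K)"
    using K assms by (intro compact_continuous_image smooth_fun_continuous_on test_fun_smooth)
  then obtain B where B: "B > 0" "\<And>x. x \<in> K \<Longrightarrow> \<bar>\<phi> x\<bar> \<le> B"
    using compact_imp_bounded bounded_pos by (metis imageI real_norm_def)
  show thesis by (rule that[of B]) (use B K in \<open>metis abs_zero less_imp_le\<close>)+
qed

lemma test_fun_integrable:
  assumes "test_fun \<Omega> \<phi>"
  shows "integrable lborel \<phi>"
proof -
  obtain K where K: "compact K" "K \<subseteq> \<Omega>" "\<And>x. x \<notin> K \<Longrightarrow> \<phi> x = 0"
    using test_funE_compact assms by metis
  have "integrable lborel (\<lambda>x. indicator K x *\<^sub>R \<phi> x)"
    using borel_integrable_compact[OF K(1) smooth_fun_continuous_on[OF test_fun_smooth[OF assms]]]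
    by (simp add: set_integrable_def)
  moreover have "(\<lambda>x. indicator K x *\<^sub>R \<phi> x) = \<phi>" using K(3) by (fastforce simp: indicator_def)
  ultimately show ?thesis by simp
qed

lemma
  fixes g :: "'a::euclidean_space \<Rightarrow> 'b::{banach, second_countable_topology}"
  assumes "g \<in> borel_measurable borel"
  shows integrable_lborel_shift: "integrable lborel (\<lambda>x. g (x + c)) \<longleftrightarrow> integrable lborel g"
    and integral_lborel_shift: "(LINT x|lborel. g (x + c)) = (LINT x|lborel. g x)"
proof -
  have distr: "distr lborel borel ((+) c) = lborel" by (rule lborel_distr_plus)
  show "integrable lborel (\<lambda>x. g (x + c)) \<longleftrightarrow> integrable lborel g"
    using integrable_distr_eq[of "(+) c" lborel borel g] assms by (simp add: distr add.commute)
  show "(LINT x|lborel. g (x + c)) = (LINT x|lborel. g x)"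
    using integral_distr[of "(+) c" lborel borel g] assms by (simp add: distr add.commute)
qed

lemma has_real_derivative_along_axis:
  assumes "f differentiable (at (x + t *\<^sub>R axis i 1))"
  shows "((\<lambda>t. f (x + t *\<^sub>R axis i 1)) has_real_derivative partial_deriv i f (x + t *\<^sub>R axis i 1)) (at t)"
proof -
  obtain f' where f': "(f has_derivative f') (at (x + t *\<^sub>R axis i 1))"
    using assms unfolding differentiable_def by blast
  have "((\<lambda>t. x + t *\<^sub>R axis i 1) has_derivative (\<lambda>s. s *\<^sub>R axis i 1)) (at t)"
    by (auto intro!: derivative_eq_intros)
  from has_derivative_compose[OF this f']
  have "((\<lambda>t. f (x + t *\<^sub>R axis i 1)) has_derivative (\<lambda>s. f' (s *\<^sub>R axis i 1))) (at t)" .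
  moreover have "(\<lambda>s. f' (s *\<^sub>R axis i 1)) = (\<lambda>s. f' (axis i 1) * s)"
    using has_derivative_linear[OF f'] by (auto simp: linear_scale)
  ultimately show ?thesis by (simp add: has_field_derivative_def partial_derivI[OF f'])
qed

definition diff_quotient :: "'n \<Rightarrow> (real^'n \<Rightarrow> real) \<Rightarrow> real \<Rightarrow> real^'n \<Rightarrow> real" where
  "diff_quotient i f h x = (f (x + h *\<^sub>R axis i 1) - f x) / h"

lemma diff_quotient_tendsto:
  assumes "f differentiable (at x)"
  shows "((\<lambda>h. diff_quotient i f h x) \<longlongrightarrow> partial_deriv i f x) (at 0)"
  using has_real_derivative_along_axis[of f x 0 i] assms by (simp add: DERIV_def diff_quotient_def)

lemma diff_quotient_eq_partial_deriv:
  assumes "\<And>x. f differentiable (at x)" "h > 0"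
  obtains y where "diff_quotient i f h x = partial_deriv i f y"
proof -
  obtain z where "f (x + h *\<^sub>R axis i 1) - f (x + 0 *\<^sub>R axis i 1) =
      (h - 0) * partial_deriv i f (x + z *\<^sub>R axis i 1)"
    using MVT2[of 0 h "\<lambda>t. f (x + t *\<^sub>R axis i 1)" "\<lambda>t. partial_deriv i f (x + t *\<^sub>R axis i 1)"]
      has_real_derivative_along_axis[OF assms(1)] assms(2) by blast
  then show thesis using assms(2) by (intro that) (auto simp: diff_quotient_def)
qed

lemma test_fun_diff_quotient_dominated:
  assumes "test_fun \<Omega> \<phi>"
  obtains B r where "\<And>h x. 0 < h \<Longrightarrow> h \<le> 1 \<Longrightarrow> \<bar>diff_quotient i \<phi> h x\<bar> \<le> indicator (cball 0 r) x * B"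
proof -
  obtain K where K: "compact K" "K \<subseteq> \<Omega>" "\<And>x. x \<notin> K \<Longrightarrow> \<phi> x = 0"
    using test_funE_compact assms by metis
  obtain B where B: "B > 0" "\<And>x. \<bar>partial_deriv i \<phi> x\<bar> \<le> B"
    using test_fun_bounded[OF test_fun_partial_deriv[OF assms]] by metis
  obtain r where r: "K \<subseteq> cball 0 r"
    using compact_imp_bounded[OF K(1)] bounded_subset_ballD[of K 0] ball_subset_cball by blast
  show thesis
  proof (rule that[of "r + 1" B])
    fix h :: real and x assume h: "0 < h" "h \<le> 1"
    show "\<bar>diff_quotient i \<phi> h x\<bar> \<le> indicator (cball 0 (r + 1)) x * B"
    proof (cases "x \<in> cball 0 (r + 1)")
      case True
      obtain y where "diff_quotient i \<phi> h x = partial_deriv i \<phi> y"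
        using diff_quotient_eq_partial_deriv test_fun_differentiable assms h by metis
      then show ?thesis using B(2) True by simp
    next
      case False
      have "norm (h *\<^sub>R axis i (1::real)) \<le> 1" using h by simp
      then have "r < norm (x + h *\<^sub>R axis i 1)" "r < norm x"
        using False norm_diff_ineq[of x "h *\<^sub>R axis i 1"] by (auto simp: dist_norm)
      then have "\<phi> (x + h *\<^sub>R axis i 1) = 0" "\<phi> x = 0"
        using r by (auto intro!: K(3))
      then show ?thesis using False by (simp add: diff_quotient_def)
    qed
  qed
qed

lemma integral_partial_deriv_eq_0:
  fixes \<phi> :: "real^'n \<Rightarrow> real"
  assumes "test_fun \<Omega> \<phi>"
  shows "(LINT x|lborel. partial_deriv i \<phi> x) = 0"
proof -
  obtain B r where dominated: "\<And>h x. 0 < h \<Longrightarrow> h \<le> 1 \<Longrightarrow> \<bar>diff_quotient i \<phi> h x\<bar> \<le> indicator (cball 0 r) x * B"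
    using test_fun_diff_quotient_dominated[OF assms] by metis
  note \<phi>_meas [measurable] = test_fun_borel_measurable[OF assms]
  have h: "filterlim (\<lambda>n. 1 / real (Suc n)) (at 0) sequentially"
    using LIMSEQ_inverse_real_of_nat by (auto simp: filterlim_at inverse_eq_divide)
  have "(\<lambda>n. LINT x|lborel. diff_quotient i \<phi> (1 / real (Suc n)) x) \<longlonglongrightarrow> (LINT x|lborel. partial_deriv i \<phi> x)"
  proof (rule integral_dominated_convergence[where w = "\<lambda>x. indicator (cball 0 r) x * B"])
    show "partial_deriv i \<phi> \<in> borel_measurable lborel"
      using test_fun_borel_measurable[OF test_fun_partial_deriv[OF assms]] by simp
    show "diff_quotient i \<phi> (1 / real (Suc n)) \<in> borel_measurable lborel" for n
      unfolding diff_quotient_def by measurable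
    show "integrable lborel (\<lambda>x. indicator (cball (0::real^'n) r) x * B)"
      using borel_integrable_compact[of "cball (0::real^'n) r" "\<lambda>x. B"] by (simp add: set_integrable_def)
    show "AE x in lborel. (\<lambda>n. diff_quotient i \<phi> (1 / real (Suc n)) x) \<longlonglongrightarrow> partial_deriv i \<phi> x"
      by (intro AE_I2 filterlim_compose[OF diff_quotient_tendsto[OF test_fun_differentiable[OF assms]] h])
    show "AE x in lborel. norm (diff_quotient i \<phi> (1 / real (Suc n)) x) \<le> indicator (cball 0 r) x * B" for n
      using dominated[of "1 / real (Suc n)"] by simp
  qed
  moreover have "(LINT x|lborel. diff_quotient i \<phi> h x) = 0" for h
    unfolding diff_quotient_def
    using integrable_lborel_shift[OF \<phi>_meas] integral_lborel_shift[OF \<phi>_meas] test_fun_integrable[OF assms] by simp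
  ultimately show ?thesis by (simp add: LIMSEQ_unique)
qed

lemma integral_by_parts_test_fun:
  assumes "smooth_fun f" "test_fun \<Omega> \<phi>"
  shows "(LINT x|lborel. f x * partial_deriv i \<phi> x) = - (LINT x|lborel. partial_deriv i f x * \<phi> x)"
proof -
  have "0 = (LINT x|lborel. partial_deriv i (\<lambda>x. f x * \<phi> x) x)"
    using integral_partial_deriv_eq_0[OF test_fun_smooth_mult[OF assms]] by simp
  also have "\<dots> = (LINT x|lborel. f x * partial_deriv i \<phi> x + partial_deriv i f x * \<phi> x)"
    by (simp add: partial_deriv_mult[OF smooth_fun_differentiable[OF assms(1)]
      test_fun_differentiable[OF assms(2)]])
  also have "\<dots> = (LINT x|lborel. f x * partial_deriv i \<phi> x) + (LINT x|lborel. partial_deriv i f x * \<phi> x)"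
    using assms
    by (intro Bochner_Integration.integral_add test_fun_integrable[of \<Omega>] test_fun_smooth_mult
        smooth_fun_partial_deriv test_fun_partial_deriv)
  finally show ?thesis by simp
qed

text \<open>Integrating by parts along a coordinate in which the phase varies gains the factor \<open>1 / s\<close>.\<close>

lemma test_fun_wave_integral_bound:
  fixes \<psi> :: "real^'n \<Rightarrow> real"
  assumes \<psi>: "test_fun U \<psi>" and r: "r \<noteq> 0"
  obtains C where "\<And>s a. s > 0 \<Longrightarrow> \<bar>LINT x|lborel. wave (s *\<^sub>R r) a x * \<psi> x\<bar> \<le> C / s"
proof -
  obtain i where i: "r $ i \<noteq> 0" using r by (metis vec_eq_iff zero_index)
  define I where "I = (LINT x|lborel. \<bar>partial_deriv i \<psi> x\<bar>)"
  note \<psi>' = test_fun_partial_deriv[OF \<psi>, of i]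
  have bound: "\<bar>LINT x|lborel. wave q a x * partial_deriv i \<psi> x\<bar> \<le> I" for q a
  proof -
    have "\<bar>LINT x|lborel. wave q a x * partial_deriv i \<psi> x\<bar> \<le> (LINT x|lborel. \<bar>wave q a x * partial_deriv i \<psi> x\<bar>)"
      by (rule integral_abs_bound)
    also have "\<dots> \<le> I"
      unfolding I_def using test_fun_integrable[OF test_fun_smooth_mult[OF smooth_fun_wave \<psi>']]
        test_fun_integrable[OF \<psi>']
      by (intro integral_mono integrable_abs) (auto simp: abs_mult abs_wave_le_1 mult_left_le_one_le)
    finally show ?thesis .
  qed
  show thesis
  proof (rule that[of "I / \<bar>r $ i\<bar>"])
    fix s a :: real assume s: "s > 0"
    have "(LINT x|lborel. wave (s *\<^sub>R r) (a - pi / 2) x * partial_deriv i \<psi> x) =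
        - (s * r $ i * (LINT x|lborel. wave (s *\<^sub>R r) a x * \<psi> x))"
      unfolding integral_by_parts_test_fun[OF smooth_fun_wave \<psi>] by (simp add: partial_deriv_wave mult.assoc)
    then have "\<bar>s * r $ i * (LINT x|lborel. wave (s *\<^sub>R r) a x * \<psi> x)\<bar> \<le> I"
      using bound[of "s *\<^sub>R r" "a - pi / 2"] by simp
    then show "\<bar>LINT x|lborel. wave (s *\<^sub>R r) a x * \<psi> x\<bar> \<le> I / \<bar>r $ i\<bar> / s"
      using s i by (simp add: abs_mult field_simps)
  qed
qed

subsection \<open>Test functions increasing to the indicator of an open set\<close>

definition box_bump :: "real^'n \<Rightarrow> real^'n \<Rightarrow> real \<Rightarrow> real^'n \<Rightarrow> real" where
  "box_bump a b k x =
    (\<Prod>i\<in>UNIV. exp_tail 0 (k * x $ i + (- k * a $ i - 1)) * exp_tail 0 (- k * x $ i + (k * b $ i - 1)))"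

lemma box_bump_bounds: "0 \<le> box_bump a b k x" "box_bump a b k x \<le> 1"
  unfolding box_bump_def
  by (auto intro!: prod_nonneg prod_le_1 mult_nonneg_nonneg mult_le_one exp_tail_0_bounds)

lemma smooth_fun_box_bump: "smooth_fun (box_bump a b k)"
  unfolding box_bump_def
  by (intro smooth_fun_prod smooth_fun_mult smooth_fun_exp_tail)

lemma box_bump_support:
  fixes a b :: "real^'n"
  assumes "k > 0" "box_bump a b k x \<noteq> 0"
  shows "x \<in> cbox (\<chi> i. a $ i + 1 / k) (\<chi> i. b $ i - 1 / k)"
proof -
  have "exp_tail 0 (k * x $ i + (- k * a $ i - 1)) \<noteq> 0" "exp_tail 0 (- k * x $ i + (k * b $ i - 1)) \<noteq> 0" for i
    using assms(2) unfolding box_bump_def by auto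
  then have "k * x $ i + (- k * a $ i - 1) > 0" "- k * x $ i + (k * b $ i - 1) > 0" for i
    unfolding exp_tail_def by metis+
  then show ?thesis using assms(1)
    by (auto simp: mem_box_cart field_simps less_imp_le)
qed

lemma cbox_shrink_subset_box:
  fixes a b :: "real^'n"
  assumes "k > 0"
  shows "cbox (\<chi> i. a $ i + 1 / k) (\<chi> i. b $ i - 1 / k) \<subseteq> box a b"
proof
  fix x assume x: "x \<in> cbox (\<chi> i. a $ i + 1 / k) (\<chi> i. b $ i - 1 / k)"
  have "1 / k > 0" using assms by simp
  then have "a $ i < x $ i \<and> x $ i < b $ i" for i
    using x by (force simp: mem_box_cart simp del: zero_less_divide_iff divide_pos_pos zero_less_divide_1_iff
      dest!: spec[of _ i])
  then show "x \<in> box a b" by (auto simp: mem_box_cart)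
qed

lemma box_bump_tendsto_1:
  fixes a b x :: "real^'n"
  assumes "x \<in> box a b"
  shows "(\<lambda>k. box_bump a b (real (Suc k)) x) \<longlonglongrightarrow> 1"
proof -
  have at_top: "filterlim (\<lambda>k. real (Suc k) * c - 1) at_top sequentially" if "c > 0" for c
    using that by real_asymp
  have "(\<lambda>k. \<Prod>i\<in>UNIV. exp_tail 0 (real (Suc k) * x $ i + (- real (Suc k) * a $ i - 1)) *
        exp_tail 0 (- real (Suc k) * x $ i + (real (Suc k) * b $ i - 1))) \<longlonglongrightarrow> (\<Prod>i\<in>(UNIV::'n set). 1 * 1)"
  proof (intro tendsto_prod tendsto_mult exp_tail_0_tendsto_1)
    fix i
    have "a $ i < x $ i" "x $ i < b $ i" using assms by (auto simp: mem_box_cart)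
    then show "filterlim (\<lambda>k. real (Suc k) * x $ i + (- real (Suc k) * a $ i - 1)) at_top sequentially"
      and "filterlim (\<lambda>k. - real (Suc k) * x $ i + (real (Suc k) * b $ i - 1)) at_top sequentially"
      using at_top[of "x $ i - a $ i"] at_top[of "b $ i - x $ i"] by (auto simp: algebra_simps)
  qed
  then show ?thesis by (simp add: box_bump_def)
qed

definition union_bump :: "(nat \<Rightarrow> real^'n) \<Rightarrow> (nat \<Rightarrow> real^'n) \<Rightarrow> nat \<Rightarrow> real^'n \<Rightarrow> real" where
  "union_bump a b k x = 1 - (\<Prod>n<k. 1 - box_bump (a n) (b n) (real (Suc k)) x)"

lemma union_bump_bounds: "0 \<le> union_bump a b k x" "union_bump a b k x \<le> 1"
proof -
  have "0 \<le> (\<Prod>n<k. 1 - box_bump (a n) (b n) (real (Suc k)) x)"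
    "(\<Prod>n<k. 1 - box_bump (a n) (b n) (real (Suc k)) x) \<le> 1"
    by (auto intro!: prod_nonneg prod_le_1 simp: box_bump_bounds)
  then show "0 \<le> union_bump a b k x" "union_bump a b k x \<le> 1" by (auto simp: union_bump_def)
qed

lemma test_fun_union_bump: "test_fun (\<Union>n. box (a n) (b n)) (union_bump a b k)"
proof (rule test_funI_compact)
  show "smooth_fun (union_bump a b k)"
    unfolding union_bump_def
    by (intro smooth_fun_diff smooth_fun_prod smooth_fun_const smooth_fun_box_bump)
  let ?K = "\<Union>n<k. cbox (\<chi> i. a n $ i + 1 / real (Suc k)) (\<chi> i. b n $ i - 1 / real (Suc k))"
  show "compact ?K" by (intro compact_UN) auto
  show "?K \<subseteq> (\<Union>n. box (a n) (b n))"
    using cbox_shrink_subset_box[of "real (Suc k)"] by (force simp del: of_nat_Suc)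
  show "union_bump a b k x = 0" if "x \<notin> ?K" for x
  proof -
    have "box_bump (a n) (b n) (real (Suc k)) x = 0" if "n < k" for n
      using box_bump_support[of "real (Suc k)" "a n" "b n" x] \<open>x \<notin> ?K\<close> that by (auto simp del: of_nat_Suc)
    then show ?thesis by (simp add: union_bump_def)
  qed
qed

lemma box_bump_le_union_bump:
  assumes "n < k"
  shows "box_bump (a n) (b n) (real (Suc k)) x \<le> union_bump a b k x"
proof -
  have "(\<Prod>n<k. 1 - box_bump (a n) (b n) (real (Suc k)) x) = (1 - box_bump (a n) (b n) (real (Suc k)) x) *
      (\<Prod>n\<in>{..<k}-{n}. 1 - box_bump (a n) (b n) (real (Suc k)) x)"
    using assms by (intro prod.remove) auto
  also have "\<dots> \<le> (1 - box_bump (a n) (b n) (real (Suc k)) x) * 1"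
    by (intro mult_left_mono prod_le_1) (auto simp: box_bump_bounds)
  finally show ?thesis by (simp add: union_bump_def)
qed

lemma union_bump_tendsto_indicator:
  "(\<lambda>k. union_bump a b k x) \<longlonglongrightarrow> indicator (\<Union>n. box (a n) (b n)) x"
proof (cases "x \<in> (\<Union>n. box (a n) (b n))")
  case False
  then have "union_bump a b k x = 0" for k by (rule test_fun_eq_0[OF test_fun_union_bump])
  then show ?thesis using False by simp
next
  case True
  then obtain n where n: "x \<in> box (a n) (b n)" by blast
  have "(\<lambda>k. union_bump a b k x) \<longlonglongrightarrow> 1"
  proof (rule tendsto_sandwich[OF _ _ box_bump_tendsto_1[OF n] tendsto_const])
    show "\<forall>\<^sub>F k in sequentially. box_bump (a n) (b n) (real (Suc k)) x \<le> union_bump a b k x"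
      by (rule eventually_mono[OF eventually_gt_at_top[of n]]) (rule box_bump_le_union_bump)
  qed (simp add: union_bump_bounds)
  then show ?thesis using True by simp
qed

lemma open_eq_UN_box:
  fixes V :: "(real^'n) set"
  assumes "open V"
  obtains a b where "V = (\<Union>n::nat. box (a n) (b n))"
proof -
  obtain \<D> where \<D>: "countable \<D>" "\<And>X. X \<in> \<D> \<Longrightarrow> \<exists>a b. X = box a b" "\<Union>\<D> = V"
    using open_countable_Union_open_box[OF assms] by metis
  show thesis
  proof (cases "\<D> = {}")
    case True
    then have "V = (\<Union>n::nat. box ((\<lambda>n. 0) n) ((\<lambda>n. 0) n))" using \<D>(3) by auto
    then show ?thesis by (rule that)
  next
    case False
    have range: "range (from_nat_into \<D>) = \<D>" using False \<D>(1) by (rule range_from_nat_into)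
    then have "\<forall>n. \<exists>a b. from_nat_into \<D> n = box a b" using \<D>(2) by blast
    then obtain a b where "\<And>n. from_nat_into \<D> n = box (a n) (b n)" by metis
    then have "V = (\<Union>n. box (a n) (b n))" using \<D>(3) range by (metis (no_types, lifting) SUP_cong)
    then show ?thesis by (rule that)
  qed
qed

subsection \<open>Functions integrable to a power\<close>

lemma tendsto_approxI:
  fixes f :: "'a \<Rightarrow> 'b::metric_space"
  assumes "\<And>e. e > 0 \<Longrightarrow> \<exists>g m. (g \<longlongrightarrow> m) F \<and> (\<forall>\<^sub>F x in F. dist (f x) (g x) \<le> e) \<and> dist m l \<le> e"
  shows "(f \<longlongrightarrow> l) F"
proof (rule tendstoI)
  fix e :: real assume "e > 0"
  then obtain g m where g: "(g \<longlongrightarrow> m) F" "\<forall>\<^sub>F x in F. dist (f x) (g x) \<le> e / 4" "dist m l \<le> e / 4"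
    using assms[of "e / 4"] by auto
  have "\<forall>\<^sub>F x in F. dist (g x) m < e / 4" using g(1) \<open>e > 0\<close> by (intro tendstoD) auto
  then show "\<forall>\<^sub>F x in F. dist (f x) l < e"
    using g(2)
  proof eventually_elim
    case (elim x)
    have "dist (f x) l \<le> dist (f x) (g x) + (dist (g x) m + dist m l)"
      by (meson add_left_mono dist_triangle order.trans)
    then show ?case using elim g(3) \<open>e > 0\<close> by linarith
  qed
qed

definition Lp_norm_pow :: "'a measure \<Rightarrow> real \<Rightarrow> ('a \<Rightarrow> 'b::real_normed_vector) \<Rightarrow> real" where
  "Lp_norm_pow M p f = (LINT x|M. norm (f x) powr p)"

lemma Lp_fun_measurable: "Lp_fun M p f \<Longrightarrow> f \<in> borel_measurable M"
  by (simp add: Lp_fun_def)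

lemma Lp_fun_integrable_powr: "Lp_fun M p f \<Longrightarrow> integrable M (\<lambda>x. norm (f x) powr p)"
  by (simp add: Lp_fun_def)

lemma Lp_norm_pow_nonneg: "0 \<le> Lp_norm_pow M p f"
  unfolding Lp_norm_pow_def by (intro integral_nonneg_AE) auto

lemma Lp_norm_pow_tendsto_0I:
  assumes "\<And>e. e > 0 \<Longrightarrow> \<forall>\<^sub>F x in F. Lp_norm_pow M p (f x) < e"
  shows "((\<lambda>x. Lp_norm_pow M p (f x)) \<longlongrightarrow> 0) F"
  by (rule tendstoI) (use assms in \<open>auto simp: Lp_norm_pow_nonneg\<close>)

lemma Lp_norm_pow_minus_commute: "Lp_norm_pow M p (\<lambda>x. f x - g x) = Lp_norm_pow M p (\<lambda>x. g x - f x)"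
  by (simp add: Lp_norm_pow_def norm_minus_commute)

lemma borel_measurable_norm_of_measurable:
  fixes f :: "'a \<Rightarrow> 'b::real_normed_vector"
  shows "f \<in> borel_measurable M \<Longrightarrow> (\<lambda>x. norm (f x)) \<in> borel_measurable M"
  by (erule measurable_compose) (intro borel_measurable_continuous_onI continuous_intros)

lemma Lp_fun_norm: "Lp_fun M p f \<Longrightarrow> Lp_fun M p (\<lambda>x. norm (f x))"
  by (simp add: Lp_fun_def borel_measurable_norm_of_measurable)

lemma
  fixes f :: "'a \<Rightarrow> 'b::real_normed_vector" and g :: "'a \<Rightarrow> 'c::real_normed_vector"
  assumes f: "Lp_fun M p f" and g: "g \<in> borel_measurable M"
    and le: "AE x in M. norm (g x) \<le> norm (f x)" and p: "p \<ge> 0"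
  shows Lp_fun_mono: "Lp_fun M p g"
    and Lp_norm_pow_mono: "Lp_norm_pow M p g \<le> Lp_norm_pow M p f"
proof -
  have powr_le: "AE x in M. norm (g x) powr p \<le> norm (f x) powr p"
    using le by eventually_elim (use p in \<open>auto intro: powr_mono2\<close>)
  note [measurable] = borel_measurable_norm_of_measurable[OF g]
  have "integrable M (\<lambda>x. norm (g x) powr p)"
    by (rule Bochner_Integration.integrable_bound[OF Lp_fun_integrable_powr[OF f]]) (use powr_le in auto)
  then show "Lp_fun M p g" using g by (simp add: Lp_fun_def)
  then show "Lp_norm_pow M p g \<le> Lp_norm_pow M p f"
    unfolding Lp_norm_pow_def using f powr_le by (intro integral_mono_AE Lp_fun_integrable_powr)
qed

lemma
  assumes "g \<in> borel_measurable M" "AE x in M. f x = g x"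
  shows Lp_fun_cong_AE: "Lp_fun M p f \<Longrightarrow> Lp_fun M p g"
    and Lp_norm_pow_cong_AE: "f \<in> borel_measurable M \<Longrightarrow> Lp_norm_pow M p f = Lp_norm_pow M p g"
proof -
  have eq: "AE x in M. norm (f x) powr p = norm (g x) powr p" using assms(2) by eventually_elim simp
  show "Lp_fun M p f \<Longrightarrow> Lp_fun M p g"
    unfolding Lp_fun_def using assms(1) borel_measurable_norm_of_measurable[OF assms(1)] eq
    by (auto intro: integrable_cong_AE_imp[of M "\<lambda>x. norm (f x) powr p"])
  assume f: "f \<in> borel_measurable M"
  note [measurable] = borel_measurable_norm_of_measurable[OF f] borel_measurable_norm_of_measurable[OF assms(1)]
  show "Lp_norm_pow M p f = Lp_norm_pow M p g"
    unfolding Lp_norm_pow_def by (rule integral_cong_AE[OF _ _ eq]) measurable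
qed

lemma norm_add_powr_le:
  fixes a b :: "'a::real_normed_vector"
  assumes "p \<ge> 0"
  shows "norm (a + b) powr p \<le> 2 powr p * (norm a powr p + norm b powr p)"
proof -
  have "norm (a + b) \<le> 2 * max (norm a) (norm b)"
    using norm_triangle_ineq[of a b] by auto
  then have "norm (a + b) powr p \<le> (2 * max (norm a) (norm b)) powr p"
    using assms by (intro powr_mono2) auto
  also have "\<dots> = 2 powr p * max (norm a) (norm b) powr p"
    by (simp add: powr_mult)
  also have "\<dots> \<le> 2 powr p * (norm a powr p + norm b powr p)"
    by (intro mult_left_mono) (auto simp: max_def)
  finally show ?thesis .
qed

lemma
  fixes f g :: "'a \<Rightarrow> 'b::{real_normed_vector, second_countable_topology}"
  assumes f: "Lp_fun M p f" and g: "Lp_fun M p g" and p: "p \<ge> 0"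
  shows Lp_fun_add: "Lp_fun M p (\<lambda>x. f x + g x)"
    and Lp_norm_pow_add_le:
      "Lp_norm_pow M p (\<lambda>x. f x + g x) \<le> 2 powr p * (Lp_norm_pow M p f + Lp_norm_pow M p g)"
proof -
  note [measurable] = f[THEN Lp_fun_measurable] g[THEN Lp_fun_measurable]
  note int = f[THEN Lp_fun_integrable_powr] g[THEN Lp_fun_integrable_powr]
  have "integrable M (\<lambda>x. norm (f x + g x) powr p)"
    by (rule Bochner_Integration.integrable_bound[of M "\<lambda>x. 2 powr p * (norm (f x) powr p + norm (g x) powr p)"])
       (use int in \<open>auto intro!: order.trans[OF norm_add_powr_le[OF p]]\<close>)
  then show Lp: "Lp_fun M p (\<lambda>x. f x + g x)" by (simp add: Lp_fun_def)
  have "Lp_norm_pow M p (\<lambda>x. f x + g x) \<le> (LINT x|M. 2 powr p * (norm (f x) powr p + norm (g x) powr p))"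
    unfolding Lp_norm_pow_def
    by (rule integral_mono[OF Lp_fun_integrable_powr[OF Lp]]) (use int norm_add_powr_le[OF p] in auto)
  then show "Lp_norm_pow M p (\<lambda>x. f x + g x) \<le> 2 powr p * (Lp_norm_pow M p f + Lp_norm_pow M p g)"
    using int by (simp add: Lp_norm_pow_def)
qed

lemma
  fixes f :: "'a \<Rightarrow> 'b::{real_normed_vector, second_countable_topology}"
  shows Lp_fun_scaleR: "Lp_fun M p f \<Longrightarrow> Lp_fun M p (\<lambda>x. c *\<^sub>R f x)"
    and Lp_norm_pow_scaleR: "Lp_norm_pow M p (\<lambda>x. c *\<^sub>R f x) = \<bar>c\<bar> powr p * Lp_norm_pow M p f"
  unfolding Lp_fun_def Lp_norm_pow_def by (auto simp: powr_mult)

lemma Lp_fun_cmult: "Lp_fun M p f \<Longrightarrow> Lp_fun M p (\<lambda>x. c * f x)" for f :: "'a \<Rightarrow> real"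
  using Lp_fun_scaleR[of M p f c] by simp

lemma Lp_fun_diff:
  fixes f g :: "'a \<Rightarrow> 'b::{real_normed_vector, second_countable_topology}"
  assumes "Lp_fun M p f" "Lp_fun M p g" "p \<ge> 0"
  shows "Lp_fun M p (\<lambda>x. f x - g x)"
  using Lp_fun_add[OF assms(1) Lp_fun_scaleR[OF assms(2), of "-1"] assms(3)] by simp

lemma Lp_norm_pow_triangle:
  fixes f g h :: "'a \<Rightarrow> 'b::{real_normed_vector, second_countable_topology}"
  assumes "Lp_fun M p f" "Lp_fun M p g" "Lp_fun M p h" "p \<ge> 0"
  shows "Lp_norm_pow M p (\<lambda>x. f x - h x) \<le>
    2 powr p * (Lp_norm_pow M p (\<lambda>x. f x - g x) + Lp_norm_pow M p (\<lambda>x. g x - h x))"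
  using Lp_norm_pow_add_le[OF Lp_fun_diff[OF assms(1,2,4)] Lp_fun_diff[OF assms(2,3,4)] assms(4)] by simp

lemma Lp_fun_sum:
  fixes f :: "'i \<Rightarrow> 'a \<Rightarrow> 'b::{real_normed_vector, second_countable_topology}"
  assumes "finite I" "\<And>i. i \<in> I \<Longrightarrow> Lp_fun M p (f i)" "p \<ge> 0"
  shows "Lp_fun M p (\<lambda>x. \<Sum>i\<in>I. f i x)"
  using assms(1,2)
  by (induction I rule: finite_induct) (auto simp: Lp_fun_def[of M p "\<lambda>x. 0"] intro!: Lp_fun_add assms(3))

lemma
  fixes f :: "'a \<Rightarrow> 'b::real_normed_vector"
  assumes M: "finite_measure M" and f: "f \<in> borel_measurable M"
    and le: "\<And>x. x \<in> space M \<Longrightarrow> norm (f x) \<le> B" and p: "p \<ge> 0"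
  shows Lp_fun_bounded: "Lp_fun M p f"
    and Lp_norm_pow_bounded: "Lp_norm_pow M p f \<le> B powr p * measure M (space M)"
proof -
  interpret finite_measure M by fact
  note [measurable] = borel_measurable_norm_of_measurable[OF f]
  have "integrable M (\<lambda>x. norm (f x) powr p)"
    by (rule integrable_const_bound[of _ "B powr p"]) (use le p in \<open>auto intro!: powr_mono2\<close>)
  then show Lp: "Lp_fun M p f" using f by (simp add: Lp_fun_def)
  have "Lp_norm_pow M p f \<le> (LINT x|M. B powr p)"
    unfolding Lp_norm_pow_def
    by (rule integral_mono[OF Lp_fun_integrable_powr[OF Lp]]) (use le p in \<open>auto intro: powr_mono2\<close>)
  then show "Lp_norm_pow M p f \<le> B powr p * measure M (space M)" by (simp add: mult.commute)
qed

lemma le_one_plus_powr: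
  fixes t p :: real
  assumes "p \<ge> 1" "t \<ge> 0"
  shows "t \<le> 1 + t powr p"
proof (cases "t \<le> 1")
  case False
  then have "t powr 1 \<le> t powr p" using assms by (intro powr_mono) auto
  then show ?thesis using assms by simp
qed (auto intro: order.trans[where b = 1])

lemma
  fixes f :: "'a \<Rightarrow> 'b::{banach, second_countable_topology}"
  assumes M: "finite_measure M" and f: "Lp_fun M p f" and p: "p \<ge> 1"
  shows Lp_fun_imp_integrable: "integrable M f"
    and integral_norm_le_Lp_norm_pow: "(LINT x|M. norm (f x)) \<le> measure M (space M) + Lp_norm_pow M p f"
proof -
  interpret finite_measure M by fact
  note int = Lp_fun_integrable_powr[OF f]
  have le: "norm (f x) \<le> 1 + norm (f x) powr p" for x using p by (intro le_one_plus_powr) auto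
  have "integrable M (\<lambda>x. 1 + norm (f x) powr p)" using int by simp
  then show f_int: "integrable M f"
    by (rule Bochner_Integration.integrable_bound)
       (use Lp_fun_measurable[OF f] in \<open>auto intro!: AE_I2 order.trans[OF le]\<close>)
  have "(LINT x|M. norm (f x)) \<le> (LINT x|M. 1 + norm (f x) powr p)"
    using f_int int le by (intro integral_mono) auto
  then show "(LINT x|M. norm (f x)) \<le> measure M (space M) + Lp_norm_pow M p f"
    using int by (simp add: Lp_norm_pow_def)
qed

lemma Lp_norm_pow_dominated_tendsto:
  fixes f :: "nat \<Rightarrow> 'a \<Rightarrow> 'b::{real_normed_vector, second_countable_topology}"
  assumes f: "\<And>n. f n \<in> borel_measurable M" and g: "g \<in> borel_measurable M"
    and lim: "AE x in M. (\<lambda>n. f n x) \<longlonglongrightarrow> g x"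
    and le: "\<And>n. AE x in M. norm (f n x - g x) \<le> h x" and h: "Lp_fun M p h" and p: "p > 0"
  shows "(\<lambda>n. Lp_norm_pow M p (\<lambda>x. f n x - g x)) \<longlonglongrightarrow> 0"
proof -
  note [measurable] = f g
  have "(\<lambda>n. LINT x|M. norm (f n x - g x) powr p) \<longlonglongrightarrow> (LINT x|M. 0)"
  proof (rule integral_dominated_convergence[where w = "\<lambda>x. norm (h x) powr p"])
    show "AE x in M. (\<lambda>n. norm (f n x - g x) powr p) \<longlonglongrightarrow> 0"
      using lim
    proof eventually_elim
      case (elim x)
      have "(\<lambda>n. norm (f n x - g x) powr p) \<longlonglongrightarrow> norm (g x - g x) powr p"
        using p by (intro tendsto_powr' tendsto_intros elim) auto
      then show ?case using p by simp
    qed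
    show "AE x in M. norm (norm (f n x - g x) powr p) \<le> norm (h x) powr p" for n
      using le[of n] by eventually_elim (use p in \<open>auto intro!: powr_mono2\<close>)
  qed (use Lp_fun_integrable_powr[OF h] in auto)
  then show ?thesis by (simp add: Lp_norm_pow_def)
qed

lemma borel_measurable_vecI:
  fixes f :: "'a \<Rightarrow> real^'n"
  assumes "\<And>i. (\<lambda>x. f x $ i) \<in> borel_measurable M"
  shows "f \<in> borel_measurable M"
  using assms by (subst borel_measurable_euclidean_space) (auto simp: Basis_vec_def inner_axis)

lemma borel_measurable_vec_nth:
  fixes f :: "'a \<Rightarrow> real^'n"
  assumes "f \<in> borel_measurable M"
  shows "(\<lambda>x. f x $ i) \<in> borel_measurable M"
  using borel_measurable_inner[OF assms borel_measurable_const[of "axis i 1"]] by (simp add: inner_axis)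

lemma
  fixes f :: "'a \<Rightarrow> real^'n"
  assumes "Lp_fun M p f" "p \<ge> 0"
  shows Lp_fun_vec_nth: "Lp_fun M p (\<lambda>x. f x $ i)"
    and Lp_norm_pow_vec_nth_le: "Lp_norm_pow M p (\<lambda>x. f x $ i) \<le> Lp_norm_pow M p f"
proof -
  have "AE x in M. norm (f x $ i) \<le> norm (f x)" by (simp add: component_le_norm_cart)
  note mono = assms(1) borel_measurable_vec_nth[OF Lp_fun_measurable[OF assms(1)]] this assms(2)
  show "Lp_fun M p (\<lambda>x. f x $ i)" "Lp_norm_pow M p (\<lambda>x. f x $ i) \<le> Lp_norm_pow M p f"
    using Lp_fun_mono[OF mono] Lp_norm_pow_mono[OF mono] .
qed

lemma Lp_fun_vecI:
  fixes f :: "'a \<Rightarrow> real^'n"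
  assumes "\<And>i. Lp_fun M p (\<lambda>x. f x $ i)" "p \<ge> 0"
  shows "Lp_fun M p f"
proof (rule Lp_fun_mono[where f = "\<lambda>x. \<Sum>i\<in>UNIV. norm (f x $ i)"])
  show "Lp_fun M p (\<lambda>x. \<Sum>i\<in>UNIV. norm (f x $ i))"
    using assms by (intro Lp_fun_sum Lp_fun_norm) auto
  show "f \<in> borel_measurable M" by (intro borel_measurable_vecI Lp_fun_measurable[OF assms(1)])
  show "AE x in M. norm (f x) \<le> norm (\<Sum>i\<in>UNIV. norm (f x $ i))"
    using norm_le_l1_cart by (intro AE_I2) (auto simp: sum_nonneg)
qed (use assms in simp)

lemma norm_powr_le_sum_components:
  fixes v :: "real^'n"
  assumes "p \<ge> 0"
  shows "norm v powr p \<le> real CARD('n) powr p * (\<Sum>i\<in>UNIV. \<bar>v $ i\<bar> powr p)"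
proof -
  define m where "m = Max (range (\<lambda>i. \<bar>v $ i\<bar>))"
  have le: "\<bar>v $ i\<bar> \<le> m" for i unfolding m_def by (intro Max_ge) auto
  have "m \<in> range (\<lambda>i. \<bar>v $ i\<bar>)" unfolding m_def by (intro Max_in) auto
  then obtain i where i: "m = \<bar>v $ i\<bar>" by blast
  have "norm v \<le> (\<Sum>i\<in>UNIV. \<bar>v $ i\<bar>)" by (rule norm_le_l1_cart)
  also have "\<dots> \<le> (\<Sum>i\<in>(UNIV::'n set). m)" by (intro sum_mono le)
  finally have "norm v \<le> real CARD('n) * m" by simp
  then have "norm v powr p \<le> (real CARD('n) * m) powr p" using assms by (intro powr_mono2) auto
  also have "\<dots> = real CARD('n) powr p * m powr p" using i by (simp add: powr_mult)
  also have "\<dots> \<le> real CARD('n) powr p * (\<Sum>i\<in>UNIV. \<bar>v $ i\<bar> powr p)"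
    unfolding i by (intro mult_left_mono member_le_sum) auto
  finally show ?thesis .
qed

lemma Lp_norm_pow_le_sum_components:
  fixes f :: "'a \<Rightarrow> real^'n"
  assumes "Lp_fun M p f" "p \<ge> 0"
  shows "Lp_norm_pow M p f \<le> real CARD('n) powr p * (\<Sum>i\<in>UNIV. Lp_norm_pow M p (\<lambda>x. f x $ i))"
proof -
  note int = Lp_fun_integrable_powr[OF Lp_fun_vec_nth[OF assms], unfolded real_norm_def]
  have "Lp_norm_pow M p f \<le> (LINT x|M. real CARD('n) powr p * (\<Sum>i\<in>UNIV. \<bar>f x $ i\<bar> powr p))"
    unfolding Lp_norm_pow_def
    using int by (intro integral_mono Lp_fun_integrable_powr assms norm_powr_le_sum_components) auto
  then show ?thesis using int by (simp add: Lp_norm_pow_def Bochner_Integration.integral_sum)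
qed

lemma conjugate_exponent:
  fixes p :: real
  assumes "p > 1"
  shows "p / (p - 1) > 1" "1 / p + 1 / (p / (p - 1)) = 1"
  using assms by (auto simp: field_simps)

lemma Lp_fun_mult_integrable:
  fixes f :: "'a \<Rightarrow> 'b::real_normed_vector" and g :: "'a \<Rightarrow> 'c::real_normed_vector"
  assumes f: "Lp_fun M p f" and g: "Lp_fun M q g" and pq: "p > 1" "q > 1" "1 / p + 1 / q = 1"
  shows "integrable M (\<lambda>x. norm (f x) * norm (g x))"
proof (rule Bochner_Integration.integrable_bound)
  note int = f[THEN Lp_fun_integrable_powr] g[THEN Lp_fun_integrable_powr]
  show "integrable M (\<lambda>x. norm (f x) powr p / p + norm (g x) powr q / q)" using int by simp
  show "(\<lambda>x. norm (f x) * norm (g x)) \<in> borel_measurable M"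
    by (intro borel_measurable_times borel_measurable_norm_of_measurable Lp_fun_measurable[OF f]
      Lp_fun_measurable[OF g])
  show "AE x in M. norm (norm (f x) * norm (g x)) \<le> norm (norm (f x) powr p / p + norm (g x) powr q / q)"
    using Youngs_inequality[OF pq] by (intro AE_I2) (auto intro: order.trans[OF _ abs_ge_self])
qed

lemma Lp_norm_pow_eq_0_iff:
  assumes "Lp_fun M p f" "p > 0"
  shows "Lp_norm_pow M p f = 0 \<longleftrightarrow> (AE x in M. f x = 0)"
  using assms Lp_fun_integrable_powr[OF assms(1)]
  by (simp add: Lp_norm_pow_def integral_nonneg_eq_0_iff_AE)

lemma Holder_integral_mult_le:
  fixes f :: "'a \<Rightarrow> 'b::real_normed_vector" and g :: "'a \<Rightarrow> 'c::real_normed_vector"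
  assumes f: "Lp_fun M p f" and g: "Lp_fun M q g" and pq: "p > 1" "q > 1" "1 / p + 1 / q = 1"
  shows "(LINT x|M. norm (f x) * norm (g x)) \<le> Lp_norm_pow M p f powr (1 / p) * Lp_norm_pow M q g powr (1 / q)"
proof (cases "Lp_norm_pow M p f = 0 \<or> Lp_norm_pow M q g = 0")
  case True
  then have "AE x in M. norm (f x) * norm (g x) = 0"
    using Lp_norm_pow_eq_0_iff[OF f] Lp_norm_pow_eq_0_iff[OF g] pq by auto
  then have "(LINT x|M. norm (f x) * norm (g x)) = 0" by (rule integral_eq_zero_AE)
  then show ?thesis by simp
next
  case False
  define A B where "A = Lp_norm_pow M p f powr (1 / p)" and "B = Lp_norm_pow M q g powr (1 / q)"
  have pow: "A powr p = Lp_norm_pow M p f" "B powr q = Lp_norm_pow M q g" and pos: "A > 0" "B > 0"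
    using False pq by (simp_all add: A_def B_def powr_powr Lp_norm_pow_nonneg order_less_le)
  note int = f[THEN Lp_fun_integrable_powr] g[THEN Lp_fun_integrable_powr]
  have "norm (f x) * norm (g x) / (A * B) \<le>
      norm (f x) powr p / (A powr p) / p + norm (g x) powr q / (B powr q) / q" for x
    using Youngs_inequality[OF pq, of "norm (f x) / A" "norm (g x) / B"] pos by (simp add: powr_divide)
  then have "(LINT x|M. norm (f x) * norm (g x) / (A * B)) \<le>
      (LINT x|M. norm (f x) powr p / (A powr p) / p + norm (g x) powr q / (B powr q) / q)"
    using Lp_fun_mult_integrable[OF assms] int by (intro integral_mono) auto
  also have "\<dots> = Lp_norm_pow M p f / (A powr p) / p + Lp_norm_pow M q g / (B powr q) / q"
    using int by (simp add: Lp_norm_pow_def)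
  also have "\<dots> = 1" using pow pos False pq by simp
  finally have "(LINT x|M. norm (f x) * norm (g x)) / (A * B) \<le> 1" by simp
  then show ?thesis using pos by (simp add: A_def B_def field_simps)
qed

lemma
  fixes f g :: "'a \<Rightarrow> 'b::euclidean_space"
  assumes f: "Lp_fun M p f" and g: "Lp_fun M q g" and pq: "p > 1" "q > 1" "1 / p + 1 / q = 1"
  shows Lp_fun_inner_integrable: "integrable M (\<lambda>x. f x \<bullet> g x)"
    and Holder_integral_inner_le:
      "\<bar>LINT x|M. f x \<bullet> g x\<bar> \<le> Lp_norm_pow M p f powr (1 / p) * Lp_norm_pow M q g powr (1 / q)"
proof -
  note int = Lp_fun_mult_integrable[OF assms]
  show inner_int: "integrable M (\<lambda>x. f x \<bullet> g x)"
    by (rule Bochner_Integration.integrable_bound[OF int])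
       (use Lp_fun_measurable[OF f] Lp_fun_measurable[OF g] Cauchy_Schwarz_ineq2 in auto)
  have "\<bar>LINT x|M. f x \<bullet> g x\<bar> \<le> (LINT x|M. \<bar>f x \<bullet> g x\<bar>)" by (rule integral_abs_bound)
  also have "\<dots> \<le> (LINT x|M. norm (f x) * norm (g x))"
    by (rule integral_mono[OF integrable_abs[OF inner_int] int Cauchy_Schwarz_ineq2])
  also note Holder_integral_mult_le[OF assms]
  finally show "\<bar>LINT x|M. f x \<bullet> g x\<bar> \<le> Lp_norm_pow M p f powr (1 / p) * Lp_norm_pow M q g powr (1 / q)" .
qed

lemma weighted_Jensen_powr:
  fixes f :: "'a \<Rightarrow> real"
  assumes k: "integrable M k" "\<And>x. k x \<ge> 0" "(LINT x|M. k x) = 1"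
    and f: "f \<in> borel_measurable M" "integrable M (\<lambda>x. k x * \<bar>f x\<bar> powr p)" and p: "p > 1"
  shows "(LINT x|M. k x * \<bar>f x\<bar>) powr p \<le> (LINT x|M. k x * \<bar>f x\<bar> powr p)"
proof -
  define q where "q = p / (p - 1)"
  have pq: "p > 1" "q > 1" "1 / p + 1 / q = 1" using p conjugate_exponent[OF p] by (auto simp: q_def)
  have [measurable]: "k \<in> borel_measurable M" "f \<in> borel_measurable M" using k f by auto
  have split: "norm (k x powr (1 / p) * f x) powr p = k x * \<bar>f x\<bar> powr p" "norm (k x powr (1 / q)) powr q = k x"
    "norm (k x powr (1 / p) * f x) * norm (k x powr (1 / q)) = k x * \<bar>f x\<bar>" for x
  proof -
    show "norm (k x powr (1 / p) * f x) powr p = k x * \<bar>f x\<bar> powr p" "norm (k x powr (1 / q)) powr q = k x"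
      using k(2)[of x] pq by (auto simp: abs_mult powr_mult powr_powr)
    have "k x powr (1 / p) * k x powr (1 / q) = k x"
      using k(2)[of x] pq by (simp flip: powr_add)
    then show "norm (k x powr (1 / p) * f x) * norm (k x powr (1 / q)) = k x * \<bar>f x\<bar>"
      by (simp add: abs_mult algebra_simps)
  qed
  have Lp: "Lp_fun M p (\<lambda>x. k x powr (1 / p) * f x)" "Lp_fun M q (\<lambda>x. k x powr (1 / q))"
    unfolding Lp_fun_def split using k(1) f(2) by auto
  have "(LINT x|M. k x * \<bar>f x\<bar>) \<le> (LINT x|M. k x * \<bar>f x\<bar> powr p) powr (1 / p)"
    using Holder_integral_mult_le[OF Lp pq] unfolding Lp_norm_pow_def split k(3) by simp
  then have "(LINT x|M. k x * \<bar>f x\<bar>) powr p \<le> ((LINT x|M. k x * \<bar>f x\<bar> powr p) powr (1 / p)) powr p"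
    using p k(2) by (intro powr_mono2) auto
  also have "\<dots> = (LINT x|M. k x * \<bar>f x\<bar> powr p)"
    using p k(2) by (simp add: powr_powr)
  finally show "(LINT x|M. k x * \<bar>f x\<bar>) powr p \<le> (LINT x|M. k x * \<bar>f x\<bar> powr p)" .
qed

lemma
  fixes f b :: "'a \<Rightarrow> real"
  assumes f: "integrable M f" and b: "b \<in> borel_measurable M" "\<And>x. x \<in> space M \<Longrightarrow> \<bar>b x\<bar> \<le> B" and "B \<ge> 0"
  shows integrable_mult_bounded: "integrable M (\<lambda>x. f x * b x)"
    and integral_mult_bounded_le: "\<bar>LINT x|M. f x * b x\<bar> \<le> B * (LINT x|M. \<bar>f x\<bar>)"
proof -
  have le: "\<bar>f x * b x\<bar> \<le> B * \<bar>f x\<bar>" if "x \<in> space M" for x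
    using mult_left_mono[OF b(2)[OF that] abs_ge_zero[of "f x"]] by (simp add: abs_mult mult.commute)
  show int: "integrable M (\<lambda>x. f x * b x)"
    by (rule Bochner_Integration.integrable_bound[where f = "\<lambda>x. B * f x"])
       (use f b le \<open>B \<ge> 0\<close> in \<open>auto simp: abs_mult[of B]\<close>)
  have "\<bar>LINT x|M. f x * b x\<bar> \<le> (LINT x|M. \<bar>f x * b x\<bar>)" by (rule integral_abs_bound)
  also have "\<dots> \<le> (LINT x|M. B * \<bar>f x\<bar>)"
    by (rule integral_mono[OF integrable_abs[OF int]]) (use f le in auto)
  finally show "\<bar>LINT x|M. f x * b x\<bar> \<le> B * (LINT x|M. \<bar>f x\<bar>)" by simp
qed

subsection \<open>Closures with respect to the \<open>L\<^sup>p\<close> distance\<close>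

definition Lp_closure :: "'a measure \<Rightarrow> real \<Rightarrow> ('a \<Rightarrow> 'b::real_normed_vector) set \<Rightarrow> ('a \<Rightarrow> 'b) set" where
  "Lp_closure M p A = {f. Lp_fun M p f \<and>
     (\<forall>e>0. \<exists>g\<in>A. Lp_fun M p g \<and> Lp_norm_pow M p (\<lambda>x. f x - g x) < e)}"

lemma Lp_closure_Lp_fun: "f \<in> Lp_closure M p A \<Longrightarrow> Lp_fun M p f"
  by (simp add: Lp_closure_def)

lemma Lp_closureE:
  assumes "f \<in> Lp_closure M p A" "e > 0"
  obtains g where "g \<in> A" "Lp_fun M p g" "Lp_norm_pow M p (\<lambda>x. f x - g x) < e"
  using assms unfolding Lp_closure_def by blast

lemma Lp_closureE_LIMSEQ:
  assumes "f \<in> Lp_closure M p A"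
  obtains g where "\<And>n. g n \<in> A" "\<And>n. Lp_fun M p (g n)" "(\<lambda>n. Lp_norm_pow M p (\<lambda>x. f x - g n x)) \<longlonglongrightarrow> 0"
proof -
  have "\<exists>g. g \<in> A \<and> Lp_fun M p g \<and> Lp_norm_pow M p (\<lambda>x. f x - g x) < 1 / real (Suc n)" for n
    using Lp_closureE[OF assms, of "1 / real (Suc n)"]
    by (metis of_nat_0_less_iff zero_less_Suc zero_less_divide_1_iff)
  then obtain g where g: "\<And>n. g n \<in> A" "\<And>n. Lp_fun M p (g n)"
    "\<And>n. Lp_norm_pow M p (\<lambda>x. f x - g n x) < 1 / real (Suc n)"
    by metis
  have "(\<lambda>n. Lp_norm_pow M p (\<lambda>x. f x - g n x)) \<longlonglongrightarrow> 0"
    by (rule tendsto_sandwich[OF _ _ tendsto_const LIMSEQ_Suc[OF lim_1_over_n]])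
       (use g(3) in \<open>auto simp: Lp_norm_pow_nonneg less_imp_le\<close>)
  with g show thesis using that by blast
qed

lemma subset_Lp_closure: "f \<in> A \<Longrightarrow> Lp_fun M p f \<Longrightarrow> f \<in> Lp_closure M p A"
  unfolding Lp_closure_def by (auto simp: Lp_norm_pow_def intro!: bexI[of _ f])

lemma Lp_closure_closed:
  fixes f :: "'a \<Rightarrow> 'b::{real_normed_vector, second_countable_topology}"
  assumes f: "Lp_fun M p f" and p: "p \<ge> 0"
    and approx: "\<And>e. e > 0 \<Longrightarrow> \<exists>g\<in>Lp_closure M p A. Lp_norm_pow M p (\<lambda>x. f x - g x) < e"
  shows "f \<in> Lp_closure M p A"
  unfolding Lp_closure_def
proof (intro CollectI conjI allI impI f)
  fix e :: real assume "e > 0"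
  then have e': "e / (2 * 2 powr p) > 0" by simp
  obtain g where g: "g \<in> Lp_closure M p A" "Lp_norm_pow M p (\<lambda>x. f x - g x) < e / (2 * 2 powr p)"
    using approx[OF e'] by blast
  obtain h where h: "h \<in> A" "Lp_fun M p h" "Lp_norm_pow M p (\<lambda>x. g x - h x) < e / (2 * 2 powr p)"
    using Lp_closureE[OF g(1) e'] .
  have "Lp_norm_pow M p (\<lambda>x. f x - h x) \<le>
      2 powr p * (Lp_norm_pow M p (\<lambda>x. f x - g x) + Lp_norm_pow M p (\<lambda>x. g x - h x))"
    by (rule Lp_norm_pow_triangle[OF f Lp_closure_Lp_fun[OF g(1)] h(2) p])
  also have "\<dots> < 2 powr p * (e / (2 * 2 powr p) + e / (2 * 2 powr p))"
    using g(2) h(3) by (intro mult_strict_left_mono) auto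
  also have "\<dots> = e" by simp
  finally show "\<exists>h\<in>A. Lp_fun M p h \<and> Lp_norm_pow M p (\<lambda>x. f x - h x) < e" using h by blast
qed

lemma Lp_closure_LIMSEQ:
  fixes f :: "'a \<Rightarrow> 'b::{real_normed_vector, second_countable_topology}"
  assumes f: "Lp_fun M p f" and p: "p \<ge> 0" and g: "\<And>n::nat. g n \<in> Lp_closure M p A"
    and lim: "(\<lambda>n. Lp_norm_pow M p (\<lambda>x. g n x - f x)) \<longlonglongrightarrow> 0"
  shows "f \<in> Lp_closure M p A"
proof (rule Lp_closure_closed[OF f p])
  fix e :: real assume "e > 0"
  then have "\<forall>\<^sub>F n in sequentially. Lp_norm_pow M p (\<lambda>x. g n x - f x) < e"
    using lim by (intro order_tendstoD(2))
  then obtain n where "Lp_norm_pow M p (\<lambda>x. g n x - f x) < e"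
    by (meson eventually_sequentially order_refl)
  then have "Lp_norm_pow M p (\<lambda>x. f x - g n x) < e" by (subst Lp_norm_pow_minus_commute)
  then show "\<exists>g\<in>Lp_closure M p A. Lp_norm_pow M p (\<lambda>x. f x - g x) < e"
    using g by blast
qed

lemma Lp_closure_add:
  fixes f g :: "'a \<Rightarrow> 'b::{real_normed_vector, second_countable_topology}"
  assumes f: "f \<in> Lp_closure M p A" and g: "g \<in> Lp_closure M p A" and p: "p \<ge> 0"
    and A: "\<And>f g. f \<in> A \<Longrightarrow> g \<in> A \<Longrightarrow> (\<lambda>x. f x + g x) \<in> A"
  shows "(\<lambda>x. f x + g x) \<in> Lp_closure M p A"
  unfolding Lp_closure_def
proof (intro CollectI conjI allI impI)
  note fL = Lp_closure_Lp_fun[OF f] and gL = Lp_closure_Lp_fun[OF g]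
  show "Lp_fun M p (\<lambda>x. f x + g x)" by (rule Lp_fun_add[OF fL gL p])
  fix e :: real assume "e > 0"
  then have e': "e / (2 * 2 powr p) > 0" by simp
  obtain f' where f': "f' \<in> A" "Lp_fun M p f'" "Lp_norm_pow M p (\<lambda>x. f x - f' x) < e / (2 * 2 powr p)"
    using Lp_closureE[OF f e'] .
  obtain g' where g': "g' \<in> A" "Lp_fun M p g'" "Lp_norm_pow M p (\<lambda>x. g x - g' x) < e / (2 * 2 powr p)"
    using Lp_closureE[OF g e'] .
  have "Lp_norm_pow M p (\<lambda>x. (f x - f' x) + (g x - g' x)) \<le>
      2 powr p * (Lp_norm_pow M p (\<lambda>x. f x - f' x) + Lp_norm_pow M p (\<lambda>x. g x - g' x))"
    by (intro Lp_norm_pow_add_le Lp_fun_diff fL gL f' g' p)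
  also have "\<dots> < 2 powr p * (e / (2 * 2 powr p) + e / (2 * 2 powr p))"
    using f'(3) g'(3) by (intro mult_strict_left_mono) auto
  also have "\<dots> = e" by simp
  finally show "\<exists>h\<in>A. Lp_fun M p h \<and> Lp_norm_pow M p (\<lambda>x. f x + g x - h x) < e"
    using A[OF f'(1) g'(1)] Lp_fun_add[OF f'(2) g'(2) p] by (auto simp: add_diff_add)
qed

lemma Lp_closure_sum:
  fixes f :: "'i \<Rightarrow> 'a \<Rightarrow> 'b::{real_normed_vector, second_countable_topology}"
  assumes "finite I" "\<And>i. i \<in> I \<Longrightarrow> f i \<in> Lp_closure M p A" "p \<ge> 0" "(\<lambda>x. 0) \<in> A"
    and "\<And>f g. f \<in> A \<Longrightarrow> g \<in> A \<Longrightarrow> (\<lambda>x. f x + g x) \<in> A"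
  shows "(\<lambda>x. \<Sum>i\<in>I. f i x) \<in> Lp_closure M p A"
  using assms(1,2)
proof (induction I rule: finite_induct)
  case empty
  have "Lp_fun M p (\<lambda>x. 0 :: 'b)" by (simp add: Lp_fun_def)
  then show ?case using subset_Lp_closure[OF assms(4)] by simp
next
  case (insert i I)
  have "(\<lambda>x. f i x + (\<Sum>i\<in>I. f i x)) \<in> Lp_closure M p A"
    by (rule Lp_closure_add[OF _ _ assms(3,5)]) (use insert in auto)
  then show ?case using insert.hyps by simp
qed

lemma Lp_closure_bounded_map:
  fixes f :: "'a \<Rightarrow> 'b::{real_normed_vector, second_countable_topology}"
    and T :: "('a \<Rightarrow> 'b) \<Rightarrow> 'c \<Rightarrow> 'd::real_normed_vector"
  assumes f: "f \<in> Lp_closure M p A" and p: "p \<ge> 0" and C: "C \<ge> 0"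
    and Lp: "\<And>g. Lp_fun M p g \<Longrightarrow> Lp_fun N p (T g)"
    and bound: "\<And>g. Lp_fun M p g \<Longrightarrow> Lp_norm_pow N p (T g) \<le> C * Lp_norm_pow M p g"
    and diff: "\<And>g h. T (\<lambda>x. g x - h x) = (\<lambda>y. T g y - T h y)"
    and A: "\<And>g. g \<in> A \<Longrightarrow> T g \<in> B"
  shows "T f \<in> Lp_closure N p B"
  unfolding Lp_closure_def
proof (intro CollectI conjI allI impI)
  show "Lp_fun N p (T f)" by (rule Lp[OF Lp_closure_Lp_fun[OF f]])
  fix e :: real assume "e > 0"
  then have "e / (C + 1) > 0" using C by simp
  then obtain g where g: "g \<in> A" "Lp_fun M p g" "Lp_norm_pow M p (\<lambda>x. f x - g x) < e / (C + 1)"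
    using Lp_closureE[OF f] by metis
  have "Lp_norm_pow N p (\<lambda>y. T f y - T g y) \<le> C * Lp_norm_pow M p (\<lambda>x. f x - g x)"
    using bound[OF Lp_fun_diff[OF Lp_closure_Lp_fun[OF f] g(2) p]] by (simp add: diff)
  also have "\<dots> \<le> C * (e / (C + 1))" using g(3) C by (intro mult_left_mono) auto
  also have "\<dots> < (C + 1) * (e / (C + 1))" using C \<open>e > 0\<close> by (intro mult_strict_right_mono) auto
  also have "\<dots> = e" using C by simp
  finally show "\<exists>h\<in>B. Lp_fun N p h \<and> Lp_norm_pow N p (\<lambda>y. T f y - h y) < e"
    using A[OF g(1)] Lp[OF g(2)] by blast
qed

lemma Lp_closure_cmult:
  fixes f :: "'a \<Rightarrow> real"
  assumes "f \<in> Lp_closure M p A" "p \<ge> 0" "\<And>g. g \<in> A \<Longrightarrow> (\<lambda>x. c * g x) \<in> A"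
  shows "(\<lambda>x. c * f x) \<in> Lp_closure M p A"
proof (rule Lp_closure_bounded_map[OF assms(1,2), where T = "\<lambda>f x. c * f x" and C = "\<bar>c\<bar> powr p"])
  show "Lp_norm_pow M p (\<lambda>x. c * g x) \<le> \<bar>c\<bar> powr p * Lp_norm_pow M p g" for g :: "'a \<Rightarrow> real"
    using Lp_norm_pow_scaleR[of M p c g] by simp
qed (use assms(3) in \<open>auto simp: right_diff_distrib intro: Lp_fun_cmult\<close>)

lemma Lp_closure_tendsto:
  fixes f :: "'a \<Rightarrow> 'b::{real_normed_vector, second_countable_topology}" and T :: "nat \<Rightarrow> ('a \<Rightarrow> 'b) \<Rightarrow> 'a \<Rightarrow> 'b"
  assumes f: "f \<in> Lp_closure M p A" and p: "p \<ge> 0"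
    and Lp: "\<And>N g. Lp_fun M p g \<Longrightarrow> Lp_fun M p (T N g)"
    and bound: "\<And>N g. Lp_fun M p g \<Longrightarrow> Lp_norm_pow M p (T N g) \<le> Lp_norm_pow M p g"
    and diff: "\<And>N g h x. Lp_fun M p g \<Longrightarrow> Lp_fun M p h \<Longrightarrow> T N (\<lambda>x. g x - h x) x = T N g x - T N h x"
    and lim: "\<And>g. g \<in> A \<Longrightarrow> Lp_fun M p g \<Longrightarrow> (\<lambda>N. Lp_norm_pow M p (\<lambda>x. T N g x - g x)) \<longlonglongrightarrow> 0"
  shows "(\<lambda>N. Lp_norm_pow M p (\<lambda>x. T N f x - f x)) \<longlonglongrightarrow> 0"
proof (rule Lp_norm_pow_tendsto_0I)
  fix e :: real assume "0 < e"
  define K :: real where "K = 2 powr p"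
  have K: "K > 0" by (simp add: K_def)
  define L where "L = K + K * K"
  have L: "L > 0" using K by (simp add: L_def add_pos_pos)
  define d where "d = e / 2 / L"
  have "d > 0" using L \<open>0 < e\<close> by (simp add: d_def)
  note fL = Lp_closure_Lp_fun[OF f]
  obtain g where g: "g \<in> A" "Lp_fun M p g" "Lp_norm_pow M p (\<lambda>x. f x - g x) < d"
    using Lp_closureE[OF f \<open>d > 0\<close>] .
  have "(\<lambda>N. K * (d + K * (Lp_norm_pow M p (\<lambda>x. T N g x - g x) + d))) \<longlonglongrightarrow> K * (d + K * (0 + d))"
    by (intro tendsto_intros lim g)
  also have "K * (d + K * (0 + d)) = L * d" by (simp add: L_def algebra_simps)
  also have "\<dots> = e / 2" using L by (simp add: d_def)
  finally have "\<forall>\<^sub>F N in sequentially. K * (d + K * (Lp_norm_pow M p (\<lambda>x. T N g x - g x) + d)) < e"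
    by (rule order_tendstoD(2)) (use \<open>0 < e\<close> in simp)
  then show "\<forall>\<^sub>F N in sequentially. Lp_norm_pow M p (\<lambda>x. T N f x - f x) < e"
  proof eventually_elim
    case (elim N)
    have "Lp_norm_pow M p (\<lambda>x. T N f x - f x) \<le>
        K * (Lp_norm_pow M p (\<lambda>x. T N f x - T N g x) + Lp_norm_pow M p (\<lambda>x. T N g x - f x))"
      unfolding K_def by (intro Lp_norm_pow_triangle Lp fL g p)
    also have "Lp_norm_pow M p (\<lambda>x. T N f x - T N g x) \<le> d"
      using bound[OF Lp_fun_diff[OF fL g(2) p], of N] g(3) by (simp add: diff[OF fL g(2), abs_def])
    also have "Lp_norm_pow M p (\<lambda>x. T N g x - f x) \<le>
        K * (Lp_norm_pow M p (\<lambda>x. T N g x - g x) + Lp_norm_pow M p (\<lambda>x. g x - f x))"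
      unfolding K_def by (intro Lp_norm_pow_triangle Lp fL g p)
    also have "Lp_norm_pow M p (\<lambda>x. g x - f x) \<le> d"
      using g(3) by (subst Lp_norm_pow_minus_commute) simp
    finally show ?case using elim K by simp
  qed
qed

lemma Lp_closure_cong_AE:
  fixes f g :: "'a \<Rightarrow> 'b::{real_normed_vector, second_countable_topology}"
  assumes f: "f \<in> Lp_closure M p A" and g: "g \<in> borel_measurable M" and eq: "AE x in M. f x = g x" and p: "p \<ge> 0"
  shows "g \<in> Lp_closure M p A"
proof (rule Lp_closure_LIMSEQ[OF _ p])
  note fL = Lp_closure_Lp_fun[OF f]
  show "f \<in> Lp_closure M p A" by (rule f)
  show "Lp_fun M p g" by (rule Lp_fun_cong_AE[OF g eq fL])
  have "(\<lambda>x. f x - g x) \<in> borel_measurable M" using Lp_fun_measurable[OF fL] g by measurable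
  then have "Lp_norm_pow M p (\<lambda>x. f x - g x) = Lp_norm_pow M p (\<lambda>x. 0 :: 'b)"
    using eq by (intro Lp_norm_pow_cong_AE) auto
  then show "(\<lambda>n::nat. Lp_norm_pow M p (\<lambda>x. f x - g x)) \<longlonglongrightarrow> 0" by (simp add: Lp_norm_pow_def)
qed

subsection \<open>Density of test functions\<close>

lemma borel_measurable_lebesgue_onI:
  "f \<in> borel_measurable borel \<Longrightarrow> f \<in> borel_measurable (lebesgue_on S)"
  by (intro measurable_restrict_space1 measurable_completion) simp

lemma integral_lebesgue_on_eq_lborel:
  fixes f :: "'a::euclidean_space \<Rightarrow> 'b::{banach, second_countable_topology}"
  assumes "f \<in> borel_measurable borel" "S \<in> sets lebesgue" "\<And>x. x \<notin> S \<Longrightarrow> f x = 0"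
  shows "integral\<^sup>L (lebesgue_on S) f = integral\<^sup>L lborel f"
proof -
  have "(\<lambda>x. indicator S x *\<^sub>R f x) = f" using assms(3) by (fastforce simp: indicator_def)
  then show ?thesis
    using assms by (subst integral_restrict_space) (auto simp: integral_completion)
qed

lemma finite_measure_lebesgue_on_open:
  "open U \<Longrightarrow> bounded U \<Longrightarrow> finite_measure (lebesgue_on U)"
  by (intro finite_measure_lebesgue_on bounded_set_imp_lmeasurable) auto

lemma integral_lebesgue_on_test_fun:
  "test_fun U \<psi> \<Longrightarrow> open U \<Longrightarrow> integral\<^sup>L (lebesgue_on U) \<psi> = integral\<^sup>L lborel \<psi>"
  by (intro integral_lebesgue_on_eq_lborel test_fun_borel_measurable test_fun_eq_0) auto

lemma test_fun_Lp_fun: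
  assumes "test_fun U \<psi>" "open V" "bounded V" "p \<ge> 0"
  shows "Lp_fun (lebesgue_on V) p \<psi>"
proof -
  obtain B where "\<And>x. \<bar>\<psi> x\<bar> \<le> B" using test_fun_bounded[OF assms(1)] by metis
  then show ?thesis
    using assms by (intro Lp_fun_bounded[where B = B] finite_measure_lebesgue_on_open
      borel_measurable_lebesgue_onI test_fun_borel_measurable) auto
qed

lemma test_fun_closure_indicator_open:
  assumes U: "open U" "bounded U" and p: "p > 0" and V: "open V" "V \<subseteq> U"
  shows "indicator V \<in> Lp_closure (lebesgue_on U) p (Collect (test_fun U))"
proof -
  obtain a b where V_eq: "V = (\<Union>n::nat. box (a n) (b n))" using open_eq_UN_box[OF V(1)] .
  note fin = finite_measure_lebesgue_on_open[OF U]
  have test: "test_fun U (union_bump a b k)" for k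
    using test_fun_mono[OF test_fun_union_bump] V(2) unfolding V_eq .
  have ind: "(indicator V :: _ \<Rightarrow> real) \<in> borel_measurable (lebesgue_on U)"
    using V by (intro borel_measurable_lebesgue_onI) auto
  show ?thesis
  proof (rule Lp_closure_LIMSEQ[where g = "union_bump a b"])
    show "Lp_fun (lebesgue_on U) p (indicator V :: _ \<Rightarrow> real)"
      by (intro Lp_fun_bounded[OF fin ind, of 1]) (use p in \<open>auto simp: indicator_def\<close>)
    show "union_bump a b k \<in> Lp_closure (lebesgue_on U) p (Collect (test_fun U))" for k
      using test p U by (intro subset_Lp_closure test_fun_Lp_fun[OF test]) auto
    have "\<bar>union_bump a b k x - indicator V x\<bar> \<le> 1" for k x
      using union_bump_bounds[of a b k x] by (auto simp: indicator_def)
    then show "(\<lambda>k. Lp_norm_pow (lebesgue_on U) p (\<lambda>x. union_bump a b k x - indicator V x)) \<longlonglongrightarrow> 0"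
      using p by (intro Lp_norm_pow_dominated_tendsto[where h = "\<lambda>x. 1 :: real"] ind AE_I2
          borel_measurable_lebesgue_onI test_fun_borel_measurable[OF test] Lp_fun_bounded[OF fin, of _ 1])
        (auto simp: V_eq union_bump_tendsto_indicator)
  qed (use p in simp)
qed

lemma test_fun_closure_indicator:
  assumes U: "open U" "bounded U" and p: "p > 0" and A: "A \<in> sets lebesgue" "A \<subseteq> U"
  shows "indicator A \<in> Lp_closure (lebesgue_on U) p (Collect (test_fun U))"
proof (rule Lp_closure_closed)
  have "(indicator A :: _ \<Rightarrow> real) \<in> borel_measurable (lebesgue_on U)"
    using A by (intro measurable_restrict_space1) auto
  then show "Lp_fun (lebesgue_on U) p (indicator A :: _ \<Rightarrow> real)"
    by (intro Lp_fun_bounded[where B = 1] finite_measure_lebesgue_on_open U) (use p in \<open>auto simp: indicator_def\<close>)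
  fix e :: real assume "e > 0"
  obtain T where T: "open T" "A \<subseteq> T" "T - A \<in> lmeasurable" "emeasure lebesgue (T - A) < ennreal e"
    using sets_lebesgue_outer_open[OF A(1) \<open>e > 0\<close>] by metis
  have "\<bar>indicator A x - indicator (T \<inter> U) x\<bar> powr p = indicator (T - A) x" if "x \<in> U" for x
    using T(2) that by (auto simp: indicator_def)
  then have "Lp_norm_pow (lebesgue_on U) p (\<lambda>x. indicator A x - indicator (T \<inter> U) x :: real) =
      (LINT x|lebesgue_on U. indicator (T - A) x)"
    unfolding Lp_norm_pow_def by (intro Bochner_Integration.integral_cong) auto
  also have "\<dots> = measure lebesgue ((T - A) \<inter> U)"
    using U by (simp add: measure_restrict_space)
  also have "\<dots> \<le> measure lebesgue (T - A)"
    using T(3) U by (intro measure_mono_fmeasurable) auto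
  also have "\<dots> < e"
    using T(3,4) \<open>e > 0\<close> by (simp add: emeasure_eq_measure2 ennreal_less_iff)
  finally show "\<exists>g\<in>Lp_closure (lebesgue_on U) p (Collect (test_fun U)).
      Lp_norm_pow (lebesgue_on U) p (\<lambda>x. indicator A x - g x) < e"
    using test_fun_closure_indicator_open[OF U p, of "T \<inter> U"] T(1) U(1) by blast
qed (use p in auto)

lemma simple_function_eq_sum_indicator:
  fixes F :: "'a \<Rightarrow> real"
  assumes "simple_function M F" "x \<in> space M"
  shows "F x = (\<Sum>c\<in>F ` space M. c * indicator (F -` {c} \<inter> space M) x)"
proof -
  have "(\<Sum>c\<in>F ` space M. c * indicator (F -` {c} \<inter> space M) x) = (\<Sum>c\<in>F ` space M. if c = F x then c else 0)"
    using assms(2) by (intro sum.cong) (auto simp: indicator_def)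
  also have "\<dots> = F x"
    using assms(2) simple_functionD(1)[OF assms(1)] by (subst sum.delta) auto
  finally show ?thesis ..
qed

lemma test_fun_closure_simple_function:
  fixes F :: "real^'n \<Rightarrow> real"
  assumes U: "open U" "bounded U" and p: "p > 0" and F: "simple_function (lebesgue_on U) F"
  shows "F \<in> Lp_closure (lebesgue_on U) p (Collect (test_fun U))"
proof -
  have "(\<lambda>x. \<Sum>c\<in>F ` U. c * indicator (F -` {c} \<inter> U) x) \<in> Lp_closure (lebesgue_on U) p (Collect (test_fun U))"
  proof (rule Lp_closure_sum)
    show "finite (F ` U)" using simple_functionD(1)[OF F] by simp
    fix c
    have "F -` {c} \<inter> space (lebesgue_on U) \<in> sets (lebesgue_on U)"
      by (intro measurable_sets[OF borel_measurable_simple_function[OF F]]) simp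
    then have "F -` {c} \<inter> U \<in> sets lebesgue" using U(1) by (simp add: sets_restrict_space_iff)
    then have ind: "indicator (F -` {c} \<inter> U) \<in> Lp_closure (lebesgue_on U) p (Collect (test_fun U))"
      by (intro test_fun_closure_indicator U p) auto
    show "(\<lambda>x. c * indicator (F -` {c} \<inter> U) x) \<in> Lp_closure (lebesgue_on U) p (Collect (test_fun U))"
      using p by (intro Lp_closure_cmult[OF ind]) (auto intro: test_fun_cmult)
  qed (use p in \<open>auto intro: test_fun_0 test_fun_add\<close>)
  moreover have "AE x in lebesgue_on U. (\<Sum>c\<in>F ` U. c * indicator (F -` {c} \<inter> U) x) = F x"
    by (rule AE_I2) (use simple_function_eq_sum_indicator[OF F, symmetric] in simp)
  ultimately show ?thesis
    using p by (intro Lp_closure_cong_AE[OF _ borel_measurable_simple_function[OF F]]) auto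
qed

theorem test_fun_dense_Lp:
  assumes U: "open U" "bounded U" and p: "p > 0" and f: "Lp_fun (lebesgue_on U) p f"
  shows "f \<in> Lp_closure (lebesgue_on U) p (Collect (test_fun U))"
proof -
  obtain F where F: "\<And>i. simple_function (lebesgue_on U) (F i)"
    "\<And>x. x \<in> U \<Longrightarrow> (\<lambda>i. F i x) \<longlonglongrightarrow> f x" "\<And>i x. x \<in> U \<Longrightarrow> \<bar>F i x\<bar> \<le> 2 * \<bar>f x\<bar>"
    using borel_measurable_implies_sequence_metric[OF Lp_fun_measurable[OF f], of 0]
    by (auto simp: dist_real_def intro: that)
  show ?thesis
  proof (rule Lp_closure_LIMSEQ[OF f, where g = F])
    have "norm (F i x - f x) \<le> 3 * \<bar>f x\<bar>" if "x \<in> U" for i x using F(3)[OF that, of i] by auto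
    then show "(\<lambda>i. Lp_norm_pow (lebesgue_on U) p (\<lambda>x. F i x - f x)) \<longlonglongrightarrow> 0"
      using F(2) p Lp_fun_norm[OF f]
      by (intro Lp_norm_pow_dominated_tendsto[where h = "\<lambda>x. 3 * \<bar>f x\<bar>"] AE_I2
          Lp_fun_measurable[OF f] borel_measurable_simple_function[OF F(1)] Lp_fun_cmult) auto
  qed (use p test_fun_closure_simple_function[OF U p F(1)] in auto)
qed

lemma fundamental_lemma_Lp:
  assumes U: "open U" "bounded U" and p: "p > 1" and h: "Lp_fun (lebesgue_on U) p h"
    and zero: "\<And>\<psi>. test_fun U \<psi> \<Longrightarrow> (LINT x|lebesgue_on U. h x * \<psi> x) = 0"
  shows "AE x in lebesgue_on U. h x = 0"
proof -
  let ?M = "lebesgue_on U"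
  define q where "q = p / (p - 1)"
  have pq: "p > 1" "q > 1" "1 / p + 1 / q = 1" using p conjugate_exponent[OF p] by (auto simp: q_def)
  note fin = finite_measure_lebesgue_on_open[OF U]
  have h_int: "integrable ?M h" using Lp_fun_imp_integrable[OF fin h] p by simp
  note [measurable] = Lp_fun_measurable[OF h]
  have sgn: "Lp_fun ?M q (\<lambda>x. sgn (h x))"
    by (rule Lp_fun_bounded[OF fin, of _ 1]) (use pq in \<open>auto simp: sgn_if\<close>)
  then have "(\<lambda>x. sgn (h x)) \<in> Lp_closure ?M q (Collect (test_fun U))"
    using pq by (intro test_fun_dense_Lp U) auto
  then obtain \<psi> where \<psi>_test: "\<And>n. \<psi> n \<in> Collect (test_fun U)" and \<psi>: "\<And>n. Lp_fun ?M q (\<psi> n)"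
    and lim: "(\<lambda>n. Lp_norm_pow ?M q (\<lambda>x. sgn (h x) - \<psi> n x)) \<longlonglongrightarrow> 0"
    by (rule Lp_closureE_LIMSEQ) blast
  have bound: "(LINT x|?M. \<bar>h x\<bar>) \<le>
      Lp_norm_pow ?M p h powr (1 / p) * Lp_norm_pow ?M q (\<lambda>x. sgn (h x) - \<psi> n x) powr (1 / q)" for n
  proof -
    have diff: "Lp_fun ?M q (\<lambda>x. sgn (h x) - \<psi> n x)" using pq by (intro Lp_fun_diff sgn \<psi>) auto
    have int: "integrable ?M (\<lambda>x. h x * \<psi> n x)" "integrable ?M (\<lambda>x. h x * (sgn (h x) - \<psi> n x))"
      using Lp_fun_inner_integrable[OF h \<psi> pq, of n] Lp_fun_inner_integrable[OF h diff pq] by simp_all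
    have "(LINT x|?M. \<bar>h x\<bar>) = (LINT x|?M. h x * (sgn (h x) - \<psi> n x) + h x * \<psi> n x)"
      by (intro Bochner_Integration.integral_cong) (auto simp: algebra_simps abs_sgn)
    also have "\<dots> = (LINT x|?M. h x * (sgn (h x) - \<psi> n x))"
      using int zero \<psi>_test[of n] by simp
    also have "\<dots> \<le> Lp_norm_pow ?M p h powr (1 / p) * Lp_norm_pow ?M q (\<lambda>x. sgn (h x) - \<psi> n x) powr (1 / q)"
      using Holder_integral_inner_le[OF h diff pq] by simp
    finally show ?thesis .
  qed
  have "(\<lambda>n. Lp_norm_pow ?M p h powr (1 / p) * Lp_norm_pow ?M q (\<lambda>x. sgn (h x) - \<psi> n x) powr (1 / q)) \<longlonglongrightarrow>
      Lp_norm_pow ?M p h powr (1 / p) * 0 powr (1 / q)"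
    using pq by (intro tendsto_mult tendsto_const tendsto_powr' lim) (auto simp: Lp_norm_pow_nonneg)
  then have "(LINT x|?M. \<bar>h x\<bar>) \<le> Lp_norm_pow ?M p h powr (1 / p) * 0 powr (1 / q)"
    by (rule LIMSEQ_le_const) (use bound in auto)
  then have "(LINT x|?M. \<bar>h x\<bar>) = 0" using pq by (simp add: order_antisym)
  then show ?thesis using h_int by (subst (asm) integral_nonneg_eq_0_iff_AE) auto
qed

lemma Riemann_Lebesgue:
  fixes G :: "real^'n \<Rightarrow> real"
  assumes U: "open U" "bounded U" and G: "integrable (lebesgue_on U) G"
    and eps: "\<And>j. eps j > 0" "eps \<longlonglongrightarrow> 0" and r: "r \<noteq> 0"
  shows "(\<lambda>j. LINT x|lebesgue_on U. G x * wave ((1 / eps j) *\<^sub>R r) a x) \<longlonglongrightarrow> 0"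
proof (rule tendsto_approxI)
  let ?w = "\<lambda>j. wave ((1 / eps j) *\<^sub>R r) a"
  have int: "integrable (lebesgue_on U) (\<lambda>x. h x * ?w j x)"
    and le: "\<bar>LINT x|lebesgue_on U. h x * ?w j x\<bar> \<le> (LINT x|lebesgue_on U. \<bar>h x\<bar>)"
    if "integrable (lebesgue_on U) h" for h j
    using integrable_mult_bounded[OF that, of "?w j" 1] integral_mult_bounded_le[OF that, of "?w j" 1]
    by (auto simp: abs_wave_le_1 borel_measurable_lebesgue_onI)
  fix e :: real assume "e > 0"
  have "Lp_fun (lebesgue_on U) 1 G" using G by (simp add: Lp_fun_def)
  then have "G \<in> Lp_closure (lebesgue_on U) 1 (Collect (test_fun U))" by (intro test_fun_dense_Lp U) auto
  then obtain \<psi> where "\<psi> \<in> Collect (test_fun U)" and \<psi>: "Lp_fun (lebesgue_on U) 1 \<psi>"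
    "Lp_norm_pow (lebesgue_on U) 1 (\<lambda>x. G x - \<psi> x) < e"
    using \<open>e > 0\<close> by (rule Lp_closureE)
  then have \<psi>_test: "test_fun U \<psi>" by simp
  have \<psi>_int: "integrable (lebesgue_on U) \<psi>"
    using Lp_fun_imp_integrable[OF finite_measure_lebesgue_on_open[OF U] \<psi>(1)] by simp
  obtain C where C: "\<And>s. s > 0 \<Longrightarrow> \<bar>LINT x|lborel. wave (s *\<^sub>R r) a x * \<psi> x\<bar> \<le> C / s"
    using test_fun_wave_integral_bound[OF \<psi>_test r] by metis
  have "(LINT x|lebesgue_on U. \<psi> x * ?w j x) = (LINT x|lborel. ?w j x * \<psi> x)" for j
    using integral_lebesgue_on_test_fun[OF test_fun_smooth_mult[OF smooth_fun_wave \<psi>_test] U(1)]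
    by (simp add: mult.commute)
  then have "norm (LINT x|lebesgue_on U. \<psi> x * ?w j x) \<le> C * eps j" for j
    using C[of "1 / eps j"] eps(1)[of j] by simp
  then have lim: "(\<lambda>j. LINT x|lebesgue_on U. \<psi> x * ?w j x) \<longlonglongrightarrow> 0"
    by (intro Lim_null_comparison[OF always_eventually tendsto_mult_right_zero[OF eps(2)]]) auto
  have "dist (LINT x|lebesgue_on U. G x * ?w j x) (LINT x|lebesgue_on U. \<psi> x * ?w j x) \<le> e" for j
  proof -
    have "(LINT x|lebesgue_on U. G x * ?w j x) - (LINT x|lebesgue_on U. \<psi> x * ?w j x) =
        (LINT x|lebesgue_on U. (G x - \<psi> x) * ?w j x)"
      using int[OF G] int[OF \<psi>_int] by (simp add: left_diff_distrib)
    also have "\<bar>\<dots>\<bar> \<le> e"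
      using le[OF Bochner_Integration.integrable_diff[OF G \<psi>_int], of j] \<psi>(2) by (simp add: Lp_norm_pow_def)
    finally show ?thesis by (simp add: dist_real_def)
  qed
  then show "\<exists>g m. (g \<longlonglongrightarrow> m) \<and>
      (\<forall>\<^sub>F j in sequentially. dist (LINT x|lebesgue_on U. G x * ?w j x) (g j) \<le> e) \<and> dist m 0 \<le> e"
    using lim \<open>e > 0\<close> by (intro exI[of _ "\<lambda>j. LINT x|lebesgue_on U. \<psi> x * ?w j x"] exI[of _ 0]) auto
qed

subsection \<open>The unit cell\<close>

abbreviation cell_measure :: "(real^'m) measure" where
  "cell_measure \<equiv> restrict_space lborel unit_cell"

lemma unit_cell_borel [measurable, simp]: "(unit_cell :: (real^'m) set) \<in> sets borel"
proof -
  have "(unit_cell :: (real^'m) set) = (\<Inter>i\<in>UNIV. {y. 0 \<le> y $ i} \<inter> {y. y $ i < 1})"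
    by (auto simp: unit_cell_def)
  moreover have "{y::real^'m. 0 \<le> y $ i} \<inter> {y. y $ i < 1} \<in> sets borel" for i
    by (intro sets.Int borel_closed borel_open closed_halfspace_component_ge_cart open_halfspace_component_lt_cart)
  then have "(\<Inter>i\<in>UNIV. {y::real^'m. 0 \<le> y $ i} \<inter> {y. y $ i < 1}) \<in> sets borel"
    by (intro sets.finite_INT) auto
  ultimately show ?thesis by simp
qed

lemma space_cell_measure [simp]: "space cell_measure = unit_cell"
  by (simp add: space_restrict_space)

lemma box_subset_unit_cell: "box 0 1 \<subseteq> (unit_cell :: (real^'m) set)"
  and unit_cell_subset_cbox: "unit_cell \<subseteq> (cbox 0 1 :: (real^'m) set)"
  by (auto simp: unit_cell_def mem_box_cart less_imp_le)

lemma emeasure_unit_cell: "emeasure lborel (unit_cell :: (real^'m) set) = 1"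
proof (rule antisym)
  have "emeasure lborel (cbox 0 (1::real^'m)) = 1" "emeasure lborel (box 0 (1::real^'m)) = 1"
    by (simp_all add: emeasure_lborel_cbox_eq emeasure_lborel_box_eq Basis_vec_def inner_axis prod.neutral)
  then show "emeasure lborel (unit_cell :: (real^'m) set) \<le> 1" "1 \<le> emeasure lborel (unit_cell :: (real^'m) set)"
    using emeasure_mono[OF unit_cell_subset_cbox[where 'm = 'm], of lborel]
      emeasure_mono[OF box_subset_unit_cell[where 'm = 'm], of lborel]
    by auto
qed

global_interpretation cell: finite_measure "cell_measure :: (real^'m) measure"
  by (rule finite_measureI) (simp add: emeasure_restrict_space emeasure_unit_cell)

lemma measure_cell [simp]: "measure cell_measure (unit_cell :: (real^'m) set) = 1"
  by (simp add: measure_def emeasure_restrict_space emeasure_unit_cell)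

lemma cell_measurableI: "f \<in> borel_measurable borel \<Longrightarrow> f \<in> borel_measurable cell_measure"
  by (rule measurable_restrict_space1) simp

lemma int_vec_axis: "int_vec (axis i 1)" "int_vec (- axis i 1)"
  by (auto simp: int_vec_def axis_def)

lemma int_vec_add: "int_vec k \<Longrightarrow> int_vec l \<Longrightarrow> int_vec (k + l)"
  and int_vec_diff: "int_vec k \<Longrightarrow> int_vec l \<Longrightarrow> int_vec (k - l)"
  and int_vec_0: "int_vec 0"
  by (auto simp: int_vec_def)

lemma countable_int_vec: "countable {k::real^'m. int_vec k}"
proof -
  have "k \<in> range (\<lambda>f::'m \<Rightarrow> int. \<chi> i. of_int (f i))" if "int_vec k" for k :: "real^'m"
    using that by (intro image_eqI[where x = "\<lambda>i. \<lfloor>k $ i\<rfloor>"]) (auto simp: int_vec_def vec_eq_iff Ints_def)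
  then have "{k::real^'m. int_vec k} \<subseteq> range (\<lambda>f::'m \<Rightarrow> int. \<chi> i. of_int (f i))" by blast
  then show ?thesis by (rule countable_subset) (intro countable_image countableI_type)
qed

lemma exists_unit_cell_representative:
  fixes y :: "real^'m"
  obtains k where "int_vec k" "y + k \<in> unit_cell"
proof (rule that)
  show "int_vec (\<chi> i. - real_of_int \<lfloor>y $ i\<rfloor>)" by (auto simp: int_vec_def)
  show "y + (\<chi> i. - real_of_int \<lfloor>y $ i\<rfloor>) \<in> unit_cell"
    by (auto simp: unit_cell_def) linarith
qed

lemma int_vec_inner_Ints: "int_vec k \<Longrightarrow> int_vec l \<Longrightarrow> k \<bullet> l \<in> \<int>"
  by (auto simp: int_vec_def inner_vec_def intro: Ints_sum Ints_mult)

text \<open>Shifting the cell by \<open>s\<close> along an axis, the part pushed beyond the opposite face re-enters after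
  subtracting a period.\<close>

lemma indicator_unit_cell_axis_shift:
  fixes y :: "real^'m"
  assumes "0 \<le> s" "s \<le> 1"
  shows "indicator unit_cell y = (indicator (unit_cell \<inter> {u. s \<le> u $ i}) (y + axis i s)
     + indicator (unit_cell \<inter> {u. u $ i < s}) (y + axis i (s - 1)) :: real)"
proof -
  have mem: "u \<in> unit_cell \<longleftrightarrow> (\<forall>j. j \<noteq> i \<longrightarrow> 0 \<le> u $ j \<and> u $ j < 1) \<and> 0 \<le> u $ i \<and> u $ i < 1" for u :: "real^'m"
    unfolding unit_cell_def mem_Collect_eq by metis
  have "y + axis i s \<in> unit_cell \<inter> {u. s \<le> u $ i} \<longleftrightarrow> y \<in> unit_cell \<and> y $ i < 1 - s"
    using assms by (auto simp: mem axis_def)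
  moreover have "y + axis i (s - 1) \<in> unit_cell \<inter> {u. u $ i < s} \<longleftrightarrow> y \<in> unit_cell \<and> 1 - s \<le> y $ i"
    using assms by (auto simp: mem axis_def)
  ultimately show ?thesis by (simp add: indicator_def)
qed

lemma cell_integral_axis_shift:
  fixes f :: "real^'m \<Rightarrow> real"
  assumes per: "periodic_cell f" and [measurable]: "f \<in> borel_measurable borel"
    and bdd: "\<And>y. \<bar>f y\<bar> \<le> B" and s: "0 \<le> s" "s \<le> 1"
  shows "(LINT y|cell_measure. f (y + axis i s)) = (LINT y|cell_measure. f y)"
proof -
  define upper lower :: "(real^'m) set"
    where "upper = unit_cell \<inter> {u. s \<le> u $ i}" and "lower = unit_cell \<inter> {u. u $ i < s}"
  have [measurable]: "{u::real^'m. u $ i < s} \<in> sets borel" "{u::real^'m. s \<le> u $ i} \<in> sets borel"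
    using open_halfspace_component_lt_cart[of i s] closed_halfspace_component_ge_cart[of s i] by auto
  have parts [measurable]: "upper \<in> sets borel" "lower \<in> sets borel"
    unfolding upper_def lower_def by measurable
  have int: "integrable lborel (\<lambda>y. indicator S y *\<^sub>R f y)" if S: "S \<subseteq> unit_cell" "S \<in> sets borel" for S
  proof (rule integrableI_bounded_set_indicator)
    show "emeasure lborel S < \<infinity>"
      using emeasure_mono[OF S(1), of lborel] by (auto simp: emeasure_unit_cell order_le_less_trans)
    show "AE x in lborel. x \<in> S \<longrightarrow> norm (f x) \<le> B" using bdd by auto
  qed (use S in auto)
  have int_parts: "integrable lborel (\<lambda>y. indicator upper y *\<^sub>R f y)"
      "integrable lborel (\<lambda>y. indicator lower y *\<^sub>R f y)"
    by (intro int parts; auto simp: upper_def lower_def)+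
  have "y + axis i (s - 1) = (y + axis i s) + - axis i 1" for y :: "real^'m"
    by (simp add: vec_eq_iff axis_def)
  then have wrap: "f (y + axis i (s - 1)) = f (y + axis i s)" for y
    using per int_vec_axis(2)[of i] unfolding periodic_cell_def by metis
  have "(LINT y|cell_measure. f (y + axis i s)) = (LINT y|lborel. indicator unit_cell y *\<^sub>R f (y + axis i s))"
    by (simp add: integral_restrict_space)
  also have "\<dots> = (LINT y|lborel. indicator upper (y + axis i s) *\<^sub>R f (y + axis i s)
      + indicator lower (y + axis i (s - 1)) *\<^sub>R f (y + axis i (s - 1)))"
    unfolding indicator_unit_cell_axis_shift[OF s, of _ i] upper_def lower_def wrap by (simp add: distrib_right)
  also have "\<dots> = (LINT y|lborel. indicator upper y *\<^sub>R f y) + (LINT y|lborel. indicator lower y *\<^sub>R f y)"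
    using integrable_lborel_shift[of "\<lambda>y. indicator upper y *\<^sub>R f y"]
      integrable_lborel_shift[of "\<lambda>y. indicator lower y *\<^sub>R f y"]
      integral_lborel_shift[of "\<lambda>y. indicator upper y *\<^sub>R f y"]
      integral_lborel_shift[of "\<lambda>y. indicator lower y *\<^sub>R f y"] int_parts
    by (subst Bochner_Integration.integral_add) simp_all
  also have "\<dots> = (LINT y|lborel. indicator upper y *\<^sub>R f y + indicator lower y *\<^sub>R f y)"
    using int_parts by simp
  also have "\<dots> = (LINT y|lborel. indicator unit_cell y *\<^sub>R f y)"
    by (intro Bochner_Integration.integral_cong) (auto simp: upper_def lower_def indicator_def)
  also have "\<dots> = (LINT y|cell_measure. f y)" by (simp add: integral_restrict_space)
  finally show ?thesis .
qed

subsection \<open>Trigonometric polynomials and convolution on the cell\<close>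

abbreviation harmonic :: "real^'m \<Rightarrow> real \<Rightarrow> real^'m \<Rightarrow> real" where
  "harmonic k \<equiv> wave ((2 * pi) *\<^sub>R k)"

lemma periodic_cell_harmonic:
  fixes k :: "real^'m"
  assumes "int_vec k"
  shows "periodic_cell (harmonic k a)"
  unfolding periodic_cell_def
proof (intro allI impI)
  fix y l :: "real^'m" assume "int_vec l"
  then obtain n where "k \<bullet> l = of_int n" using int_vec_inner_Ints[OF assms] Ints_cases by blast
  then have "harmonic k a (y + l) = cos (((2 * pi) *\<^sub>R k) \<bullet> y + a + 2 * pi * of_int n)"
    by (simp add: wave_def inner_add_right algebra_simps)
  then show "harmonic k a (y + l) = harmonic k a y"
    by (simp add: wave_def cos_add[of _ "2 * pi * of_int n"] cos_int_2pin sin_int_2pin)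
qed

lemma cell_integral_harmonic:
  fixes k :: "real^'m"
  assumes k: "int_vec k"
  shows "(LINT y|cell_measure. harmonic k a y) = (if k = 0 then cos a else 0)"
proof (cases "k = 0")
  case False
  then obtain i where i: "k $ i \<noteq> 0" by (metis vec_eq_iff zero_index)
  obtain n where n: "k $ i = of_int n" using k unfolding int_vec_def by (metis Ints_cases)
  define s where "s = 1 / (2 * \<bar>k $ i\<bar>)"
  have "\<bar>k $ i\<bar> \<ge> 1" using i n by simp
  then have s: "0 \<le> s" "s \<le> 1" by (auto simp: s_def field_simps)
  have phase: "a + ((2 * pi) *\<^sub>R k) \<bullet> axis i s = (if k $ i > 0 then a + pi else a - pi)"
    using i by (simp add: inner_axis s_def)
  have "harmonic k a (y + axis i s) = - harmonic k a y" for y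
    unfolding wave_shift phase by (simp add: wave_antiphase)
  moreover have "(LINT y|cell_measure. harmonic k a (y + axis i s)) = (LINT y|cell_measure. harmonic k a y)"
    by (rule cell_integral_axis_shift[where B = 1])
       (use s periodic_cell_harmonic[OF k] in \<open>auto simp: abs_wave_le_1\<close>)
  ultimately show ?thesis using False by simp
qed (simp add: wave_def)

inductive trig_poly :: "(real^'m \<Rightarrow> real) \<Rightarrow> bool" where
  harmonic: "int_vec k \<Longrightarrow> trig_poly (\<lambda>u. c * harmonic k a u)"
| add: "trig_poly f \<Longrightarrow> trig_poly g \<Longrightarrow> trig_poly (\<lambda>u. f u + g u)"

lemma trig_poly_const: "trig_poly (\<lambda>u. c)"
  using trig_poly.harmonic[OF int_vec_0, of c 0] by (simp add: wave_def)

lemma trig_poly_cmult: "trig_poly f \<Longrightarrow> trig_poly (\<lambda>u. b * f u)"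
proof (induction rule: trig_poly.induct)
  case (harmonic k c a)
  then show ?case using trig_poly.harmonic[of k "b * c"] by (simp add: mult.assoc)
next
  case (add f g)
  then show ?case using trig_poly.add by (simp add: distrib_left)
qed

lemma wave_mult_wave: "wave r a x * wave s b x = (wave (r - s) (a - b) x + wave (r + s) (a + b) x) / 2"
proof -
  have "r \<bullet> x + a - (s \<bullet> x + b) = (r - s) \<bullet> x + (a - b)" "r \<bullet> x + a + (s \<bullet> x + b) = (r + s) \<bullet> x + (a + b)"
    by (simp_all add: inner_add_left inner_diff_left)
  then show ?thesis unfolding wave_def cos_times_cos by (simp only:)
qed

lemma trig_poly_harmonic_mult:
  assumes "int_vec k" "trig_poly g"
  shows "trig_poly (\<lambda>u. harmonic k a u * g u)"
  using assms(2)
proof (induction rule: trig_poly.induct)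
  case (harmonic l c b)
  have "trig_poly (\<lambda>u. (c / 2) * harmonic (k - l) (a - b) u + (c / 2) * harmonic (k + l) (a + b) u)"
    by (intro trig_poly.intros int_vec_add int_vec_diff assms harmonic)
  moreover have "harmonic k a u * (c * harmonic l b u) =
      (c / 2) * harmonic (k - l) (a - b) u + (c / 2) * harmonic (k + l) (a + b) u" for u
  proof -
    have "harmonic k a u * (c * harmonic l b u) = c * (harmonic k a u * harmonic l b u)" by simp
    then show ?thesis
      by (simp add: wave_mult_wave scaleR_right_diff_distrib scaleR_right_distrib distrib_left add_divide_distrib)
  qed
  ultimately show ?case by simp
next
  case (add f g)
  then show ?case using trig_poly.add by (simp add: distrib_left)
qed

lemma trig_poly_mult:
  assumes "trig_poly f" "trig_poly g"
  shows "trig_poly (\<lambda>u. f u * g u)"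
  using assms(1)
proof (induction rule: trig_poly.induct)
  case (harmonic k c a)
  then show ?case
    using trig_poly_cmult[OF trig_poly_harmonic_mult[OF _ assms(2)], of k c a] by (simp add: mult.assoc)
next
  case (add f h)
  then show ?case using trig_poly.add by (simp add: distrib_right)
qed

lemma trig_poly_prod: "(\<And>i. i \<in> A \<Longrightarrow> trig_poly (f i)) \<Longrightarrow> trig_poly (\<lambda>u. \<Prod>i\<in>A. f i u)"
  by (induction A rule: infinite_finite_induct) (auto intro: trig_poly_const trig_poly_mult)

lemma trig_poly_power: "trig_poly f \<Longrightarrow> trig_poly (\<lambda>u. f u ^ n)"
  by (induction n) (auto intro: trig_poly_const trig_poly_mult)

lemma trig_poly_continuous_on: "trig_poly f \<Longrightarrow> continuous_on S f"
  by (induction rule: trig_poly.induct) (auto intro!: continuous_intros continuous_on_wave)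

lemma trig_poly_borel_measurable: "trig_poly f \<Longrightarrow> f \<in> borel_measurable borel"
  by (intro borel_measurable_continuous_onI trig_poly_continuous_on)

lemma trig_poly_periodic: "trig_poly f \<Longrightarrow> periodic_cell f"
proof (induction rule: trig_poly.induct)
  case (harmonic k c a)
  then show ?case using periodic_cell_harmonic[of k a] by (simp add: periodic_cell_def)
qed (auto simp: periodic_cell_def)

lemma trig_poly_bounded:
  assumes "trig_poly f"
  obtains B where "B \<ge> 0" "\<And>u. \<bar>f u\<bar> \<le> B"
proof -
  from assms have "\<exists>B\<ge>0. \<forall>u. \<bar>f u\<bar> \<le> B"
  proof (induction rule: trig_poly.induct)
    case (harmonic k c a)
    show ?case by (intro exI[of _ "\<bar>c\<bar>"]) (auto simp: abs_mult abs_wave_le_1 mult_left_le)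
  next
    case (add f g)
    then obtain B C where "B \<ge> 0" "C \<ge> 0" "\<And>u. \<bar>f u\<bar> \<le> B" "\<And>u. \<bar>g u\<bar> \<le> C" by blast
    then show ?case by (intro exI[of _ "B + C"]) (auto intro: order.trans[OF abs_triangle_ineq add_mono])
  qed
  then show thesis using that by blast
qed

lemma trig_poly_cell_integrable:
  assumes "trig_poly f"
  shows "integrable cell_measure f"
proof -
  obtain B where "\<And>u. \<bar>f u\<bar> \<le> B" using trig_poly_bounded[OF assms] by metis
  then show ?thesis
    by (intro cell.integrable_const_bound[where B = B] cell_measurableI trig_poly_borel_measurable assms) auto
qed

definition cell_conv :: "(real^'m \<Rightarrow> real) \<Rightarrow> (real^'m \<Rightarrow> real) \<Rightarrow> real^'m \<Rightarrow> real" where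
  "cell_conv K w y = (LINT z|cell_measure. K (y - z) * w z)"

text \<open>The phases \<open>a = 0\<close> and \<open>a = - \<pi> / 2\<close> give the cosine and the sine coefficient.\<close>

definition fourier_moment :: "real^'m \<Rightarrow> real \<Rightarrow> (real^'m \<Rightarrow> real) \<Rightarrow> real" where
  "fourier_moment k a w = (LINT z|cell_measure. harmonic k a z * w z)"

lemma integrable_wave_mult: "integrable cell_measure w \<Longrightarrow> integrable cell_measure (\<lambda>z. wave r a z * w z)"
  using integrable_mult_bounded[of cell_measure w "wave r a" 1]
  by (simp add: abs_wave_le_1 cell_measurableI mult.commute)

lemma integrable_trig_poly_diff_mult:
  assumes "trig_poly K" "integrable cell_measure w"
  shows "integrable cell_measure (\<lambda>z. K (y - z) * w z)"
proof -
  obtain B where "B \<ge> 0" "\<And>u. \<bar>K u\<bar> \<le> B" using trig_poly_bounded[OF assms(1)] by metis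
  moreover have "(\<lambda>z. K (y - z)) \<in> borel_measurable cell_measure"
    by (intro cell_measurableI measurable_compose[OF _ trig_poly_borel_measurable[OF assms(1)]]) measurable
  ultimately show ?thesis
    using integrable_mult_bounded[OF assms(2), of "\<lambda>z. K (y - z)" B] by (simp add: mult.commute)
qed

lemma cell_conv_add_left:
  assumes "trig_poly f" "trig_poly g" "integrable cell_measure w"
  shows "cell_conv (\<lambda>u. f u + g u) w y = cell_conv f w y + cell_conv g w y"
  unfolding cell_conv_def distrib_right
  by (intro Bochner_Integration.integral_add integrable_trig_poly_diff_mult assms)

lemma cell_conv_diff_right:
  assumes "trig_poly K" "integrable cell_measure f" "integrable cell_measure g"
  shows "cell_conv K (\<lambda>z. f z - g z) y = cell_conv K f y - cell_conv K g y"
  unfolding cell_conv_def right_diff_distrib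
  by (intro Bochner_Integration.integral_diff integrable_trig_poly_diff_mult assms)

lemma cell_conv_harmonic:
  assumes "integrable cell_measure w"
  shows "cell_conv (\<lambda>u. c * harmonic k a u) w y =
    c * (harmonic k a y * fourier_moment k 0 w + harmonic k (a - pi / 2) y * fourier_moment k (- (pi / 2)) w)"
proof -
  have "c * harmonic k a (y - z) * w z =
      c * harmonic k a y * (harmonic k 0 z * w z) +
          c * harmonic k (a - pi / 2) y * (harmonic k (- (pi / 2)) z * w z)" for z
  proof -
    have "((2 * pi) *\<^sub>R k) \<bullet> (y - z) + a = (((2 * pi) *\<^sub>R k) \<bullet> y + a) - ((2 * pi) *\<^sub>R k) \<bullet> z"
      by (simp add: inner_diff_right)
    then have "harmonic k a (y - z) =
        harmonic k a y * harmonic k 0 z + harmonic k (a - pi / 2) y * harmonic k (0 - pi / 2) z"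
      unfolding wave_quarter_phase(2) unfolding wave_def by (simp only: cos_diff) simp
    then show ?thesis by (simp add: algebra_simps)
  qed
  then have "cell_conv (\<lambda>u. c * harmonic k a u) w y =
      c * harmonic k a y * fourier_moment k 0 w + c * harmonic k (a - pi / 2) y * fourier_moment k (- (pi / 2)) w"
    unfolding cell_conv_def fourier_moment_def using integrable_wave_mult[OF assms] by simp
  then show ?thesis by (simp add: algebra_simps)
qed

lemma trig_poly_cell_conv:
  assumes K: "trig_poly K" and w: "integrable cell_measure w"
  shows "trig_poly (cell_conv K w)"
  using K
proof (induction rule: trig_poly.induct)
  case (harmonic k c a)
  have "trig_poly (\<lambda>y. (c * fourier_moment k 0 w) * harmonic k a y
      + (c * fourier_moment k (- (pi / 2)) w) * harmonic k (a - pi / 2) y)"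
    by (intro trig_poly.intros harmonic)
  then show ?case by (subst cell_conv_harmonic[OF w, abs_def]) (simp add: algebra_simps)
next
  case (add f g)
  have "cell_conv (\<lambda>u. f u + g u) w = (\<lambda>y. cell_conv f w y + cell_conv g w y)"
    using cell_conv_add_left[OF add.hyps w] by auto
  then show ?case using trig_poly.add[OF add.IH] by (simp only:)
qed

lemma cell_integral_cell_conv:
  assumes K: "trig_poly K" and w: "integrable cell_measure w"
  shows "(LINT y|cell_measure. cell_conv K w y) = (LINT y|cell_measure. K y) * (LINT y|cell_measure. w y)"
  using K
proof (induction rule: trig_poly.induct)
  case (harmonic k c a)
  have "integrable cell_measure (harmonic k b)" for b
    using trig_poly_cell_integrable[OF trig_poly.harmonic[OF harmonic, of 1 b]] by simp
  then have "(LINT y|cell_measure. cell_conv (\<lambda>u. c * harmonic k a u) w y) =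
      c * ((if k = 0 then cos a else 0) * fourier_moment k 0 w + (if k =
          0 then sin a else 0) * fourier_moment k (- (pi / 2)) w)"
    by (simp add: cell_conv_harmonic[OF w] cell_integral_harmonic[OF harmonic] cos_diff)
  also have "\<dots> = (LINT y|cell_measure. c * harmonic k a y) * (LINT y|cell_measure. w y)"
    by (simp add: cell_integral_harmonic[OF harmonic]) (simp add: fourier_moment_def wave_def)
  finally show ?case .
next
  case (add f g)
  then show ?case
    using add.hyps[THEN trig_poly_cell_conv[OF _ w], THEN trig_poly_cell_integrable]
      add.hyps[THEN trig_poly_cell_integrable]
    by (simp add: cell_conv_add_left[OF add.hyps w] distrib_right)
qed

lemma cell_integral_trig_poly_diff:
  assumes "trig_poly K"
  shows "(LINT z|cell_measure. K (y - z)) = (LINT z|cell_measure. K z)"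
proof -
  have one: "integrable cell_measure (\<lambda>z::real^'a. 1::real)" by simp
  from assms have "cell_conv K (\<lambda>z. 1) y = (LINT z|cell_measure. K z)"
  proof (induction rule: trig_poly.induct)
    case (harmonic k c a)
    have "cell_conv (\<lambda>u. c * harmonic k a u) (\<lambda>z. 1) y =
        c * (harmonic k a y * (if k = 0 then 1 else 0) + harmonic k (a - pi / 2) y * (if k =
            0 then cos (- (pi / 2)) else 0))"
      unfolding cell_conv_harmonic[OF one] fourier_moment_def mult_1_right cell_integral_harmonic[OF harmonic]
      by simp
    then show ?case by (simp add: cell_integral_harmonic[OF harmonic]) (simp add: wave_def)
  next
    case (add f g)
    then show ?case by (simp add: cell_conv_add_left[OF add.hyps one] trig_poly_cell_integrable)
  qed
  then show ?thesis by (simp add: cell_conv_def)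
qed

subsection \<open>An approximate identity of trigonometric polynomials\<close>

definition peak :: "real^'m \<Rightarrow> real" where
  "peak u = (\<Prod>i\<in>UNIV. (1 + cos (2 * pi * u $ i)) / 2)"

lemma trig_poly_peak: "trig_poly peak"
proof -
  have "trig_poly (\<lambda>u::real^'a. 1/2 + 1/2 * harmonic (axis i 1) 0 u)" for i
    by (intro trig_poly.intros trig_poly_const int_vec_axis)
  then show ?thesis
    unfolding peak_def by (intro trig_poly_prod) (simp add: wave_def inner_axis' add_divide_distrib)
qed

lemma half_one_plus_cos_bounds: "0 \<le> (1 + cos t) / (2::real)" "(1 + cos t) / 2 \<le> (1::real)"
proof -
  have "0 \<le> (1 + c) / 2 \<and> (1 + c) / 2 \<le> 1" if "-1 \<le> c" "c \<le> 1" for c :: real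
    using that by simp
  then show "0 \<le> (1 + cos t) / (2::real)" "(1 + cos t) / 2 \<le> (1::real)"
    using cos_ge_minus_one cos_le_one by blast+
qed

lemma peak_bounds: "0 \<le> peak u" "peak u \<le> 1"
  unfolding peak_def using half_one_plus_cos_bounds by (auto intro!: prod_nonneg prod_le_1)

definition near_int :: "real \<Rightarrow> real^'m \<Rightarrow> bool" where
  "near_int \<delta> u \<longleftrightarrow> (\<exists>k. int_vec k \<and> (\<forall>i. \<bar>u $ i - k $ i\<bar> < \<delta>))"

lemma near_int_mono: "near_int \<delta> u \<Longrightarrow> \<delta> \<le> \<delta>' \<Longrightarrow> near_int \<delta>' u"
  unfolding near_int_def by (meson less_le_trans)

lemma peak_le_away_from_int:
  assumes "0 < \<delta>" "\<delta> \<le> 1/2" "\<not> near_int \<delta> u"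
  shows "peak u \<le> (1 + cos (2 * pi * \<delta>)) / 2"
proof -
  have "int_vec (\<chi> i. real_of_int (round (u $ i)))" by (auto simp: int_vec_def)
  then obtain i where i: "\<bar>u $ i - of_int (round (u $ i))\<bar> \<ge> \<delta>"
    using assms(3) unfolding near_int_def by (metis not_less vec_lambda_beta)
  let ?d = "\<bar>u $ i - of_int (round (u $ i))\<bar>"
  have "?d \<le> 1/2" using of_int_round_abs_le[of "u $ i"] by (simp add: abs_minus_commute)
  have "cos (2 * pi * u $ i) = cos (2 * pi * (u $ i - of_int (round (u $ i))))"
    by (simp add: right_diff_distrib cos_diff cos_int_2pin sin_int_2pin)
  also have "\<dots> = cos (2 * pi * ?d)"
    by (metis abs_mult abs_of_pos cos_abs_real mult_pos_pos pi_gt_zero zero_less_numeral)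
  also have "\<dots> \<le> cos (2 * pi * \<delta>)"
    using \<open>?d \<le> 1/2\<close> i assms by (intro cos_monotone_0_pi_le) auto
  finally have factor: "(1 + cos (2 * pi * u $ i)) / 2 \<le> (1 + cos (2 * pi * \<delta>)) / 2" by simp
  have "peak u = (1 + cos (2 * pi * u $ i)) / 2 * (\<Prod>j\<in>UNIV - {i}. (1 + cos (2 * pi * u $ j)) / 2)"
    unfolding peak_def by (intro prod.remove) auto
  also have "\<dots> \<le> (1 + cos (2 * pi * u $ i)) / 2 * 1"
    using half_one_plus_cos_bounds by (intro mult_left_mono prod_le_1) auto
  finally show ?thesis using factor by simp
qed

lemma measure_cell_open_neighborhood_0:
  fixes V :: "(real^'m) set"
  assumes "open V" "0 \<in> V"
  shows "0 < measure cell_measure (unit_cell \<inter> V)"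
proof -
  define W where "W = V \<inter> box 0 (1::real^'m)"
  have "0 \<in> closure (box 0 (1::real^'m))" by (subst closure_box) (auto simp: mem_box_cart interval_ne_empty_cart)
  then have "W \<noteq> {}" using assms unfolding W_def by (metis closure_iff_nhds_not_empty order_refl inf_commute)
  moreover have "open W" using assms by (auto simp: W_def)
  ultimately have "\<not> negligible W" by (simp add: open_not_negligible)
  then have "emeasure lborel W \<noteq> 0"
    using \<open>open W\<close> by (simp add: negligible_iff_null_sets null_sets_def)
  moreover have "emeasure lborel W \<le> emeasure lborel (unit_cell \<inter> V)"
    using box_subset_unit_cell assms by (intro emeasure_mono) (auto simp: W_def)
  moreover have "emeasure cell_measure (unit_cell \<inter> V) = emeasure lborel (unit_cell \<inter> V)"
    using assms by (intro emeasure_restrict_space) auto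
  ultimately show ?thesis
    using cell.emeasure_eq_measure[of "unit_cell \<inter> V"] by (metis ennreal_0 le_zero_eq measure_nonneg order_le_less)
qed

lemma peak_power_integral_ge:
  assumes "0 \<le> s" "s < 1"
  obtains \<kappa> where "\<kappa> > 0" "\<And>N. \<kappa> * s ^ N \<le> (LINT y|(cell_measure :: (real^'m) measure). peak y ^ N)"
proof -
  define V :: "(real^'m) set" where "V = peak -` {s<..}"
  have V: "open V" "0 \<in> V"
    unfolding V_def using assms trig_poly_continuous_on[OF trig_poly_peak]
    by (auto intro!: open_vimage simp: peak_def)
  then have [measurable]: "V \<in> sets borel" by auto
  show thesis
  proof (rule that[OF measure_cell_open_neighborhood_0[OF V]])
    fix N
    have "measure cell_measure (unit_cell \<inter> V) * s ^ N = (LINT y|cell_measure. indicator V y * s ^ N)"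
      by (simp add: Int_commute)
    also have "\<dots> \<le> (LINT y|(cell_measure :: (real^'m) measure). peak y ^ N)"
    proof (rule integral_mono)
      show "integrable cell_measure (\<lambda>y. indicator V y * s ^ N)"
        by (rule cell.integrable_const_bound[where B = "s ^ N"])
           (use assms in \<open>auto intro!: cell_measurableI simp: indicator_def\<close>)
      show "integrable cell_measure (\<lambda>y::real^'m. peak y ^ N)"
        by (rule trig_poly_cell_integrable[OF trig_poly_power[OF trig_poly_peak]])
      show "indicator V y * s ^ N \<le> peak y ^ N" for y
        using assms peak_bounds[of y] by (auto simp: indicator_def V_def intro!: power_mono)
    qed
    finally show "measure cell_measure (unit_cell \<inter> V) * s ^ N \<le>
        (LINT y|(cell_measure :: (real^'m) measure). peak y ^ N)" .
  qed
qed

lemma peak_power_integral_pos: "(LINT y|(cell_measure :: (real^'m) measure). peak y ^ N) > 0"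
proof -
  obtain \<kappa> where "\<kappa> > 0" "\<And>N. \<kappa> * (1/2) ^ N \<le> (LINT y|(cell_measure :: (real^'m) measure). peak y ^ N)"
    by (rule peak_power_integral_ge[of "1/2"]) auto
  then show ?thesis by (meson less_le_trans mult_pos_pos zero_less_divide_1_iff zero_less_numeral zero_less_power)
qed

definition peak_kernel :: "nat \<Rightarrow> real^'m \<Rightarrow> real" where
  "peak_kernel N u = peak u ^ N / (LINT y|(cell_measure :: (real^'m) measure). peak y ^ N)"

lemma trig_poly_peak_kernel: "trig_poly (peak_kernel N)"
  using trig_poly_cmult[OF trig_poly_power[OF trig_poly_peak, of N], of
    "1 / (LINT y|(cell_measure :: (real^'a) measure). peak y ^ N)"]
  by (simp add: peak_kernel_def[abs_def])

lemma peak_kernel_nonneg: "peak_kernel N u \<ge> 0"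
  unfolding peak_kernel_def using peak_power_integral_pos peak_bounds
  by (intro divide_nonneg_pos zero_le_power) auto

lemma integral_peak_kernel: "(LINT y|cell_measure. peak_kernel N y) = 1"
  unfolding peak_kernel_def
  using peak_power_integral_pos[of N, where 'm = 'a] by (subst integral_divide_zero) simp

lemma integral_peak_kernel_diff: "(LINT z|cell_measure. peak_kernel N (y - z)) = 1"
  by (simp add: cell_integral_trig_poly_diff[OF trig_poly_peak_kernel] integral_peak_kernel)

lemma integrable_peak_kernel_diff: "integrable cell_measure (\<lambda>z. peak_kernel N (y - z))"
  using integrable_trig_poly_diff_mult[OF trig_poly_peak_kernel, of "\<lambda>z. 1"] by simp

lemma peak_kernel_away_from_int:
  assumes "0 < \<delta>" "\<delta> \<le> 1/2"
  obtains \<omega> where "\<omega> \<longlonglongrightarrow> (0::real)" "\<And>N. \<omega> N \<ge> 0" "\<And>N (u::real^'m). \<not> near_int \<delta> u \<Longrightarrow> peak_kernel N u \<le> \<omega> N"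
proof -
  define r where "r = (1 + cos (2 * pi * \<delta>)) / 2"
  have "cos (2 * pi * \<delta>) < cos 0" using assms by (intro cos_monotone_0_pi) auto
  then have r: "0 \<le> r" "r < 1" using half_one_plus_cos_bounds[of "2 * pi * \<delta>"] by (auto simp: r_def)
  define s where "s = (1 + r) / 2"
  have s: "r < s" "s < 1" "0 < s" using r by (auto simp: s_def)
  obtain \<kappa> where \<kappa>: "\<kappa> > 0" "\<And>N. \<kappa> * s ^ N \<le> (LINT y|(cell_measure :: (real^'m) measure). peak y ^ N)"
    using peak_power_integral_ge s by (metis less_imp_le)
  show thesis
  proof (rule that[of "\<lambda>N. (r / s) ^ N / \<kappa>"])
    have "(\<lambda>N. (r / s) ^ N / \<kappa>) \<longlonglongrightarrow> 0 / \<kappa>"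
      using r s \<kappa> by (intro tendsto_divide LIMSEQ_realpow_zero) auto
    then show "(\<lambda>N. (r / s) ^ N / \<kappa>) \<longlonglongrightarrow> 0" by simp
    show "0 \<le> (r / s) ^ N / \<kappa>" for N using r s \<kappa> by simp
    show "peak_kernel N u \<le> (r / s) ^ N / \<kappa>" if "\<not> near_int \<delta> u" for N and u :: "real^'m"
    proof -
      have "peak u \<le> r" using peak_le_away_from_int[OF assms that] by (simp add: r_def)
      then have "peak_kernel N u \<le> r ^ N / (LINT y|(cell_measure :: (real^'m) measure). peak y ^ N)"
        unfolding peak_kernel_def using peak_power_integral_pos peak_bounds
        by (intro divide_right_mono power_mono) (auto intro: less_imp_le)
      also have "\<dots> \<le> r ^ N / (\<kappa> * s ^ N)"
        using \<kappa> s r by (intro divide_left_mono) (auto intro!: mult_pos_pos peak_power_integral_pos)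
      also have "\<dots> = (r / s) ^ N / \<kappa>" by (simp add: power_divide)
      finally show ?thesis .
    qed
  qed
qed

subsection \<open>Uniform approximation on the torus\<close>

definition torus_uniformly_continuous :: "(real^'m \<Rightarrow> real) \<Rightarrow> bool" where
  "torus_uniformly_continuous f \<longleftrightarrow>
     (\<forall>\<eta>>0. \<exists>\<delta>>0. \<forall>y\<in>unit_cell. \<forall>z\<in>unit_cell. near_int \<delta> (y - z) \<longrightarrow> \<bar>f z - f y\<bar> \<le> \<eta>)"

lemma uniformly_continuous_on_componentwise:
  fixes f :: "real^'m \<Rightarrow> real"
  assumes "uniformly_continuous_on S f" "\<eta> > 0"
  obtains \<delta> where "\<delta> > 0" "\<And>x y. x \<in> S \<Longrightarrow> y \<in> S \<Longrightarrow> (\<And>i. \<bar>(x - y) $ i\<bar> < \<delta>) \<Longrightarrow> \<bar>f x - f y\<bar> < \<eta>"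
proof -
  obtain d where d: "d > 0" "\<And>x y. x \<in> S \<Longrightarrow> y \<in> S \<Longrightarrow> dist x y < d \<Longrightarrow> dist (f x) (f y) < \<eta>"
    using assms unfolding uniformly_continuous_on_def by metis
  show thesis
  proof (rule that[of "d / real CARD('m)"])
    fix x y assume x: "x \<in> S" and y: "y \<in> S" and near: "\<And>i. \<bar>(x - y) $ i\<bar> < d / real CARD('m)"
    have "norm (x - y) \<le> (\<Sum>i\<in>UNIV. \<bar>(x - y) $ i\<bar>)" by (rule norm_le_l1_cart)
    also have "\<dots> < (\<Sum>i\<in>(UNIV::'m set). d / real CARD('m))" using near by (intro sum_strict_mono) auto
    finally show "\<bar>f x - f y\<bar> < \<eta>" using d(2)[OF x y] by (simp add: dist_norm)
  qed (use d in simp)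
qed

lemma continuous_periodic_imp_torus_uniformly_continuous:
  fixes f :: "real^'m \<Rightarrow> real"
  assumes cont: "continuous_on UNIV f" and per: "periodic_cell f"
  shows "torus_uniformly_continuous f"
  unfolding torus_uniformly_continuous_def
proof (intro allI impI)
  fix \<eta> :: real assume "\<eta> > 0"
  define C where "C = cbox ((\<chi> i. -1)::real^'m) (\<chi> i. 2)"
  have "uniformly_continuous_on C f"
    unfolding C_def by (intro compact_uniformly_continuous continuous_on_subset[OF cont]) auto
  then obtain \<delta> where \<delta>: "\<delta> > 0" "\<And>x y. x \<in> C \<Longrightarrow> y \<in> C \<Longrightarrow> (\<And>i. \<bar>(x - y) $ i\<bar> < \<delta>) \<Longrightarrow> \<bar>f x - f y\<bar> < \<eta>"
    using \<open>\<eta> > 0\<close> by (rule uniformly_continuous_on_componentwise) blast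
  have "\<bar>f z - f y\<bar> \<le> \<eta>" if y: "y \<in> unit_cell" and z: "z \<in> unit_cell"
      and near: "near_int (min \<delta> 1) (y - z)" for y z
  proof -
    obtain k where k: "int_vec k" "\<And>i. \<bar>(y - z) $ i - k $ i\<bar> < min \<delta> 1" using near unfolding near_int_def by blast
    have "f y = f (y - k + k)" by simp
    also have "\<dots> = f (y - k)" using per k(1) unfolding periodic_cell_def by blast
    finally have shift: "f y = f (y - k)" .
    have cell: "0 \<le> z $ i \<and> z $ i < 1" for i using z by (simp add: unit_cell_def)
    have "-1 \<le> (y - k) $ i \<and> (y - k) $ i \<le> 2" "-1 \<le> z $ i \<and> z $ i \<le> 2" for i
      using k(2)[of i] cell[of i] by auto
    then have "z \<in> C" "y - k \<in> C" by (simp_all add: C_def mem_box_cart)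
    moreover have "\<bar>(z - (y - k)) $ i\<bar> < \<delta>" for i using k(2)[of i] by auto
    ultimately show ?thesis unfolding shift using \<delta>(2) less_imp_le by blast
  qed
  then show "\<exists>\<delta>>0. \<forall>y\<in>unit_cell. \<forall>z\<in>unit_cell. near_int \<delta> (y - z) \<longrightarrow> \<bar>f z - f y\<bar> \<le> \<eta>"
    using \<delta>(1) by (intro exI[of _ "min \<delta> 1"]) auto
qed

lemma compact_subset_unit_box_margin:
  assumes "compact K" "K \<subseteq> box 0 (1::real^'m)"
  obtains d where "d > 0" "\<And>x i. x \<in> K \<Longrightarrow> d \<le> x $ i" "\<And>x i. x \<in> K \<Longrightarrow> x $ i \<le> 1 - d"
proof -
  obtain d where d: "d > 0" "\<And>x y. x \<in> K \<Longrightarrow> y \<in> - box 0 1 \<Longrightarrow> d \<le> dist x y"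
    using separate_compact_closed[OF assms(1), of "- box 0 (1::real^'m)"] assms(2) by blast
  have norm_axis_real: "norm (axis i (c::real)) = \<bar>c\<bar>" for i :: 'm and c
  proof -
    have "axis i c = c *\<^sub>R axis i (1::real)" by (simp add: vec_eq_iff axis_def)
    then show ?thesis by simp
  qed
  show thesis
  proof (rule that[OF d(1)])
    fix x i assume x: "x \<in> K"
    have xi: "0 < x $ i" "x $ i < 1" using x assms(2) by (auto simp: mem_box_cart subset_iff)
    have "x - axis i (x $ i) \<in> - box 0 1" by (auto simp: mem_box_cart axis_def intro!: exI[of _ i])
    from d(2)[OF x this] show "d \<le> x $ i" using xi by (simp add: dist_norm norm_axis_real)
    have "x + axis i (1 - x $ i) \<in> - box 0 1" by (auto simp: mem_box_cart axis_def intro!: exI[of _ i])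
    from d(2)[OF x this] show "x $ i \<le> 1 - d" using xi by (simp add: dist_norm norm_axis_real)
  qed
qed

text \<open>Points of the cell that are close on the torus but not in the cell lie near opposite faces,
  where \<open>\<psi>\<close> vanishes.\<close>

lemma test_fun_imp_torus_uniformly_continuous:
  fixes \<psi> :: "real^'m \<Rightarrow> real"
  assumes \<psi>: "test_fun (box 0 1) \<psi>"
  shows "torus_uniformly_continuous \<psi>"
  unfolding torus_uniformly_continuous_def
proof (intro allI impI)
  fix \<eta> :: real assume "\<eta> > 0"
  obtain K where K: "compact K" "K \<subseteq> box 0 (1::real^'m)" "\<And>x. x \<notin> K \<Longrightarrow> \<psi> x = 0"
    using test_funE_compact[OF \<psi>] by metis
  obtain d where d: "d > 0" "\<And>x i. x \<in> K \<Longrightarrow> d \<le> x $ i" "\<And>x i. x \<in> K \<Longrightarrow> x $ i \<le> 1 - d"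
    using compact_subset_unit_box_margin[OF K(1,2)] by blast
  have "uniformly_continuous_on (cbox 0 1) \<psi>"
    by (intro compact_uniformly_continuous smooth_fun_continuous_on test_fun_smooth[OF \<psi>]) auto
  then obtain \<delta> where \<delta>: "\<delta> > 0" "\<And>x y. x \<in> cbox 0 1 \<Longrightarrow> y \<in> cbox 0 1 \<Longrightarrow> (\<And>i. \<bar>(x - y) $ i\<bar> < \<delta>) \<Longrightarrow> \<bar>\<psi> x - \<psi> y\<bar> < \<eta>"
    using \<open>\<eta> > 0\<close> by (rule uniformly_continuous_on_componentwise) blast
  define r where "r = min \<delta> (min d 1)"
  have r: "r > 0" "r \<le> \<delta>" "r \<le> d" "r \<le> 1" using \<delta>(1) d(1) by (auto simp: r_def)
  have "\<bar>\<psi> z - \<psi> y\<bar> \<le> \<eta>" if y: "y \<in> unit_cell" and z: "z \<in> unit_cell" and near: "near_int r (y - z)" for y z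
  proof -
    obtain k where k: "int_vec k" "\<And>i. \<bar>(y - z) $ i - k $ i\<bar> < r" using near unfolding near_int_def by blast
    show ?thesis
    proof (cases "k = 0")
      case True
      then have "\<bar>(z - y) $ i\<bar> < \<delta>" for i using k(2)[of i] r(2) by auto
      moreover have "z \<in> cbox 0 1" "y \<in> cbox 0 1" using y z unit_cell_subset_cbox by auto
      ultimately show ?thesis using \<delta>(2) less_imp_le by blast
    next
      case False
      then obtain i where i: "k $ i \<noteq> 0" by (metis vec_eq_iff zero_index)
      obtain n where n: "k $ i = of_int n" using k(1) unfolding int_vec_def by (metis Ints_cases)
      have cell: "0 \<le> y $ i" "y $ i < 1" "0 \<le> z $ i" "z $ i < 1" using y z by (auto simp: unit_cell_def)
      have close: "\<bar>y $ i - z $ i - of_int n\<bar> < r" using k(2)[of i] n by simp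
      then have "\<bar>real_of_int n\<bar> < 2" using cell r(4) by linarith
      then have "n = 1 \<or> n = -1" using i n by auto
      then have "(y $ i > 1 - d \<and> z $ i < d) \<or> (y $ i < d \<and> z $ i > 1 - d)"
        using close cell r(3) by (elim disjE) (auto simp: abs_less_iff)
      then have "y \<notin> K" "z \<notin> K" using d(2)[of y i] d(3)[of y i] d(2)[of z i] d(3)[of z i] by auto
      then show ?thesis using K(3) \<open>\<eta> > 0\<close> by simp
    qed
  qed
  then show "\<exists>\<delta>>0. \<forall>y\<in>unit_cell. \<forall>z\<in>unit_cell. near_int \<delta> (y - z) \<longrightarrow> \<bar>\<psi> z - \<psi> y\<bar> \<le> \<eta>"
    using r(1) by blast
qed

lemma cell_conv_peak_kernel_minus_le:
  assumes f: "integrable cell_measure f"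
  shows "\<bar>cell_conv (peak_kernel N) f y - f y\<bar> \<le> (LINT z|cell_measure. peak_kernel N (y - z) * \<bar>f z - f y\<bar>)"
proof -
  note int = integrable_trig_poly_diff_mult[OF trig_poly_peak_kernel[of N] f, of y]
      integrable_peak_kernel_diff[of N y]
  have "cell_conv (peak_kernel N) f y - f y =
      (LINT z|cell_measure. peak_kernel N (y - z) * f z) - (LINT z|cell_measure. peak_kernel N (y - z) * f y)"
    using integral_peak_kernel_diff[of N y] by (simp add: cell_conv_def)
  also have "\<dots> = (LINT z|cell_measure. peak_kernel N (y - z) * (f z - f y))"
    unfolding right_diff_distrib using int by (intro Bochner_Integration.integral_diff[symmetric]) auto
  also have "\<bar>\<dots>\<bar> \<le> (LINT z|cell_measure. \<bar>peak_kernel N (y - z) * (f z - f y)\<bar>)" by (rule integral_abs_bound)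
  finally show ?thesis by (simp add: abs_mult peak_kernel_nonneg)
qed

lemma abs_cell_conv_peak_kernel_le:
  fixes f :: "real^'m \<Rightarrow> real"
  assumes "integrable cell_measure f" "\<And>y. y \<in> unit_cell \<Longrightarrow> \<bar>f y\<bar> \<le> B"
  shows "\<bar>cell_conv (peak_kernel N) f y\<bar> \<le> B"
proof -
  note int = integrable_trig_poly_diff_mult[OF trig_poly_peak_kernel[of N] assms(1), of y]
  have "\<bar>cell_conv (peak_kernel N) f y\<bar> \<le> (LINT z|cell_measure. \<bar>peak_kernel N (y - z) * f z\<bar>)"
    unfolding cell_conv_def by (rule integral_abs_bound)
  also have "\<dots> \<le> (LINT z|cell_measure. peak_kernel N (y - z) * B)"
  proof (rule integral_mono)
    show "\<bar>peak_kernel N (y - z) * f z\<bar> \<le> peak_kernel N (y - z) * B" if "z \<in> space cell_measure" for z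
      using mult_left_mono[OF assms(2) peak_kernel_nonneg, of z N "y - z"] that
      by (simp add: abs_mult peak_kernel_nonneg)
  qed (use int integrable_peak_kernel_diff[of N y] in auto)
  also have "\<dots> = B" by (simp add: integral_peak_kernel_diff)
  finally show ?thesis .
qed

lemma cell_conv_peak_kernel_uniform_error:
  fixes f :: "real^'m \<Rightarrow> real"
  assumes f: "f \<in> borel_measurable cell_measure" and B: "\<And>y. y \<in> unit_cell \<Longrightarrow> \<bar>f y\<bar> \<le> B"
    and near: "\<And>y z. y \<in> unit_cell \<Longrightarrow> z \<in> unit_cell \<Longrightarrow> near_int \<delta> (y - z) \<Longrightarrow> \<bar>f z - f y\<bar> \<le> \<eta>"
    and far: "\<And>u::real^'m. \<not> near_int \<delta> u \<Longrightarrow> peak_kernel N u \<le> \<omega>"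
    and pos: "\<omega> \<ge> 0" "\<eta> \<ge> 0" and y: "y \<in> unit_cell"
  shows "\<bar>cell_conv (peak_kernel N) f y - f y\<bar> \<le> \<eta> + 2 * B * \<omega>"
proof -
  have "B \<ge> 0" using B[OF y] by linarith
  have f_int: "integrable cell_measure f"
    using f B by (intro cell.integrable_const_bound[where B = B]) auto
  note K_int = integrable_peak_kernel_diff[of N y]
  have "\<bar>cell_conv (peak_kernel N) f y - f y\<bar> \<le> (LINT z|cell_measure. peak_kernel N (y - z) * \<bar>f z - f y\<bar>)"
    by (rule cell_conv_peak_kernel_minus_le[OF f_int])
  also have "\<dots> \<le> (LINT z|cell_measure. peak_kernel N (y - z) * \<eta> + 2 * B * \<omega>)"
  proof (rule integral_mono)
    show "integrable cell_measure (\<lambda>z. peak_kernel N (y - z) * \<bar>f z - f y\<bar>)"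
      using f_int by (intro integrable_trig_poly_diff_mult trig_poly_peak_kernel) auto
    show "integrable cell_measure (\<lambda>z. peak_kernel N (y - z) * \<eta> + 2 * B * \<omega>)" using K_int by simp
    fix z :: "real^'m" assume "z \<in> space cell_measure"
    then have z: "z \<in> unit_cell" by simp
    show "peak_kernel N (y - z) * \<bar>f z - f y\<bar> \<le> peak_kernel N (y - z) * \<eta> + 2 * B * \<omega>"
    proof (cases "near_int \<delta> (y - z)")
      case True
      then have "peak_kernel N (y - z) * \<bar>f z - f y\<bar> \<le> peak_kernel N (y - z) * \<eta>"
        using near[OF y z] by (intro mult_left_mono peak_kernel_nonneg)
      then show ?thesis using \<open>B \<ge> 0\<close> pos by (simp add: add_increasing2)
    next
      case False
      have "peak_kernel N (y - z) * \<bar>f z - f y\<bar> \<le> \<omega> * (2 * B)"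
        using far[OF False] B[OF y] B[OF z] pos by (intro mult_mono) auto
      then show ?thesis using mult_nonneg_nonneg[OF peak_kernel_nonneg pos(2), of N "y - z"]
        by (simp add: algebra_simps)
    qed
  qed
  also have "\<dots> = \<eta> + 2 * B * \<omega>"
    using K_int integral_peak_kernel_diff[of N y] by simp
  finally show ?thesis .
qed

lemma cell_conv_peak_kernel_uniform_limit:
  fixes f :: "real^'m \<Rightarrow> real"
  assumes f: "f \<in> borel_measurable cell_measure" "\<And>y. y \<in> unit_cell \<Longrightarrow> \<bar>f y\<bar> \<le> B" "torus_uniformly_continuous f"
  shows "uniform_limit unit_cell (\<lambda>N. cell_conv (peak_kernel N) f) f sequentially"
proof (rule uniform_limitI)
  fix e :: real assume "e > 0"
  then obtain \<delta> where "\<delta> > 0"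
      and near: "\<And>y z. y \<in> unit_cell \<Longrightarrow> z \<in> unit_cell \<Longrightarrow> near_int \<delta> (y - z) \<Longrightarrow> \<bar>f z - f y\<bar> \<le> e / 2"
    using f(3) unfolding torus_uniformly_continuous_def by (meson half_gt_zero)
  define r where "r = min \<delta> (1/2)"
  have r: "0 < r" "r \<le> 1/2" "r \<le> \<delta>" using \<open>\<delta> > 0\<close> by (auto simp: r_def)
  obtain \<omega> where \<omega>: "\<omega> \<longlonglongrightarrow> 0" "\<And>N. \<omega> N \<ge> 0" "\<And>N (u::real^'m). \<not> near_int r u \<Longrightarrow> peak_kernel N u \<le> \<omega> N"
    using peak_kernel_away_from_int[OF r(1,2), where 'm = 'm] by metis
  have "(\<lambda>N. 2 * B * \<omega> N) \<longlonglongrightarrow> 2 * B * 0" by (intro tendsto_intros \<omega>)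
  then have "\<forall>\<^sub>F N in sequentially. 2 * B * \<omega> N < e / 2"
    using \<open>e > 0\<close> by (intro order_tendstoD(2)) auto
  then show "\<forall>\<^sub>F N in sequentially. \<forall>y\<in>unit_cell. dist (cell_conv (peak_kernel N) f y) (f y) < e"
  proof eventually_elim
    case (elim N)
    have "\<bar>cell_conv (peak_kernel N) f y - f y\<bar> \<le> e / 2 + 2 * B * \<omega> N" if "y \<in> unit_cell" for y
      by (rule cell_conv_peak_kernel_uniform_error[OF f(1,2) _ \<omega>(3) \<omega>(2) _ that])
         (use near near_int_mono[OF _ r(3)] \<open>e > 0\<close> in auto)
    then show ?case using elim by (fastforce simp: dist_real_def)
  qed
qed

subsection \<open>Approximation in \<open>L\<^sup>p\<close> of the cell\<close>

lemma cell_conv_Jensen: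
  fixes w :: "real^'m \<Rightarrow> real"
  assumes p: "p > 1" and w: "Lp_fun cell_measure p w"
  shows "\<bar>cell_conv (peak_kernel N) w y\<bar> powr p \<le> cell_conv (peak_kernel N) (\<lambda>z. \<bar>w z\<bar> powr p) y"
proof -
  have "integrable cell_measure (\<lambda>z. peak_kernel N (y - z) * \<bar>w z\<bar> powr p)"
    using Lp_fun_integrable_powr[OF w] by (intro integrable_trig_poly_diff_mult trig_poly_peak_kernel) simp
  then have "(LINT z|cell_measure. peak_kernel N (y - z) * \<bar>w z\<bar>) powr p \<le>
      cell_conv (peak_kernel N) (\<lambda>z. \<bar>w z\<bar> powr p) y"
    unfolding cell_conv_def
    by (intro weighted_Jensen_powr integrable_peak_kernel_diff peak_kernel_nonneg integral_peak_kernel_diff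
      Lp_fun_measurable[OF w] p)
  moreover have "\<bar>cell_conv (peak_kernel N) w y\<bar> \<le> (LINT z|cell_measure. peak_kernel N (y - z) * \<bar>w z\<bar>)"
    using integral_abs_bound[of cell_measure "\<lambda>z. peak_kernel N (y - z) * w z"]
    by (simp add: cell_conv_def abs_mult peak_kernel_nonneg)
  ultimately show ?thesis using p powr_mono2[of p]
    by (meson abs_ge_zero less_eq_real_def order.trans zero_less_one)
qed

lemma
  fixes w :: "real^'m \<Rightarrow> real"
  assumes p: "p > 1" and w: "Lp_fun cell_measure p w"
  shows Lp_fun_cell_conv: "Lp_fun cell_measure p (cell_conv (peak_kernel N) w)"
    and Lp_norm_pow_cell_conv_le: "Lp_norm_pow cell_measure p (cell_conv (peak_kernel N) w) \<le>
        Lp_norm_pow cell_measure p w"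
proof -
  have w_int: "integrable cell_measure w" "integrable cell_measure (\<lambda>z. \<bar>w z\<bar> powr p)"
    using Lp_fun_imp_integrable[OF cell.finite_measure_axioms w] Lp_fun_integrable_powr[OF w] p by auto
  note conv = w_int[THEN trig_poly_cell_conv[OF trig_poly_peak_kernel[of N]]]
  obtain B where "\<And>u. \<bar>cell_conv (peak_kernel N) w u\<bar> \<le> B" using trig_poly_bounded[OF conv(1)] by metis
  then show Lp: "Lp_fun cell_measure p (cell_conv (peak_kernel N) w)"
    using p by (intro Lp_fun_bounded[where B = B] cell.finite_measure_axioms cell_measurableI
      trig_poly_borel_measurable conv) auto
  have "Lp_norm_pow cell_measure p (cell_conv (peak_kernel N) w) \<le>
      (LINT y|cell_measure. cell_conv (peak_kernel N) (\<lambda>z. \<bar>w z\<bar> powr p) y)"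
    unfolding Lp_norm_pow_def
    by (rule integral_mono[OF Lp_fun_integrable_powr[OF Lp] trig_poly_cell_integrable[OF conv(2)]])
       (use cell_conv_Jensen[OF p w] in simp)
  then show "Lp_norm_pow cell_measure p (cell_conv (peak_kernel N) w) \<le> Lp_norm_pow cell_measure p w"
    by (simp add: cell_integral_cell_conv[OF trig_poly_peak_kernel w_int(2)] integral_peak_kernel Lp_norm_pow_def)
qed

lemma
  fixes f :: "real^'m \<Rightarrow> 'b::{banach, second_countable_topology}"
  assumes "f \<in> borel_measurable cell_measure"
  shows measurable_lebesgue_on_cell: "f \<in> borel_measurable (lebesgue_on unit_cell)"
    and integrable_lebesgue_on_cell: "integrable (lebesgue_on unit_cell) f \<longleftrightarrow> integrable cell_measure f"
    and integral_lebesgue_on_cell: "integral\<^sup>L (lebesgue_on unit_cell) f = integral\<^sup>L cell_measure f"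
proof -
  have meas: "(\<lambda>x. indicator unit_cell x *\<^sub>R f x) \<in> borel_measurable lborel"
    using assms by (subst (asm) borel_measurable_restrict_space_iff) auto
  then show "f \<in> borel_measurable (lebesgue_on unit_cell)"
    by (subst borel_measurable_restrict_space_iff) (auto intro: measurable_completion)
  show "integrable (lebesgue_on unit_cell) f \<longleftrightarrow> integrable cell_measure f"
    by (simp add: integrable_restrict_space integrable_completion[OF meas])
  show "integral\<^sup>L (lebesgue_on unit_cell) f = integral\<^sup>L cell_measure f"
    by (simp add: integral_restrict_space integral_completion[OF meas])
qed

lemma
  fixes f :: "'a::euclidean_space \<Rightarrow> 'b::{banach, second_countable_topology}"
  assumes sets: "S \<in> sets lebesgue" "T \<in> sets lebesgue" and sub: "T \<subseteq> S" and neg: "negligible (S - T)"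
    and f: "f \<in> borel_measurable (lebesgue_on S)"
  shows integrable_lebesgue_on_negligible_diff: "integrable (lebesgue_on T) f \<longleftrightarrow> integrable (lebesgue_on S) f"
    and integral_lebesgue_on_negligible_diff: "integral\<^sup>L (lebesgue_on T) f = integral\<^sup>L (lebesgue_on S) f"
proof -
  have "f \<in> borel_measurable (lebesgue_on T)" by (rule measurable_restrict_mono[OF f sub])
  then have meas: "(\<lambda>x. indicator T x *\<^sub>R f x) \<in> borel_measurable lebesgue"
      "(\<lambda>x. indicator S x *\<^sub>R f x) \<in> borel_measurable lebesgue"
    using f sets by (simp_all add: borel_measurable_restrict_space_iff)
  have "AE x in lebesgue. x \<notin> S - T" using neg by (intro AE_not_in) (simp add: negligible_iff_null_sets)
  then have eq: "AE x in lebesgue. indicator T x *\<^sub>R f x = indicator S x *\<^sub>R f x"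
    by eventually_elim (use sub in \<open>auto simp: indicator_def\<close>)
  show "integrable (lebesgue_on T) f \<longleftrightarrow> integrable (lebesgue_on S) f"
    using sets integrable_cong_AE[OF meas eq] by (simp add: integrable_restrict_space)
  show "integral\<^sup>L (lebesgue_on T) f = integral\<^sup>L (lebesgue_on S) f"
    using sets integral_cong_AE[OF meas eq] by (simp add: integral_restrict_space)
qed

lemma
  fixes f :: "real^'m \<Rightarrow> real"
  assumes f: "f \<in> borel_measurable cell_measure"
  shows Lp_fun_box_iff_cell: "Lp_fun (lebesgue_on (box 0 1)) p f \<longleftrightarrow> Lp_fun cell_measure p f"
    and Lp_norm_pow_box_eq_cell: "Lp_norm_pow (lebesgue_on (box 0 1)) p f = Lp_norm_pow cell_measure p f"
proof -
  have "negligible (unit_cell - box 0 1 :: (real^'m) set)"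
    using unit_cell_subset_cbox by (intro negligible_subset[OF negligible_frontier_interval[of 0 1]]) auto
  note diff = sets_completionI_sets[of _ lborel] box_subset_unit_cell this
  have pow: "(\<lambda>x. norm (f x) powr p) \<in> borel_measurable cell_measure" using f by measurable
  note pow_leb = measurable_lebesgue_on_cell[OF pow]
  have "f \<in> borel_measurable (lebesgue_on (box 0 1))"
    by (rule measurable_restrict_mono[OF measurable_lebesgue_on_cell[OF f] box_subset_unit_cell])
  then show "Lp_fun (lebesgue_on (box 0 1)) p f \<longleftrightarrow> Lp_fun cell_measure p f"
    using f integrable_lebesgue_on_negligible_diff[OF diff(1) diff(1) diff(2,3) pow_leb]
      integrable_lebesgue_on_cell[OF pow]
    by (simp add: Lp_fun_def)
  show "Lp_norm_pow (lebesgue_on (box 0 1)) p f = Lp_norm_pow cell_measure p f"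
    using integral_lebesgue_on_negligible_diff[OF diff(1) diff(1) diff(2,3) pow_leb]
      integral_lebesgue_on_cell[OF pow]
    by (simp add: Lp_norm_pow_def)
qed

lemma test_fun_dense_cell:
  fixes w :: "real^'m \<Rightarrow> real"
  assumes p: "p > 0" and w: "Lp_fun cell_measure p w"
  shows "w \<in> Lp_closure cell_measure p (Collect (test_fun (box 0 1)))"
  unfolding Lp_closure_def
proof (intro CollectI conjI allI impI w)
  note w_meas = Lp_fun_measurable[OF w]
  fix e :: real assume "e > 0"
  have "w \<in> Lp_closure (lebesgue_on (box 0 1)) p (Collect (test_fun (box 0 1)))"
    using w p by (intro test_fun_dense_Lp) (auto simp: Lp_fun_box_iff_cell[OF w_meas])
  then obtain \<psi> where "\<psi> \<in> Collect (test_fun (box 0 1))" and \<psi>: "Lp_fun (lebesgue_on (box 0 1)) p \<psi>"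
    "Lp_norm_pow (lebesgue_on (box 0 1)) p (\<lambda>x. w x - \<psi> x) < e"
    using \<open>e > 0\<close> by (rule Lp_closureE)
  then have test: "test_fun (box 0 1) \<psi>" by simp
  have \<psi>_meas: "\<psi> \<in> borel_measurable cell_measure" by (intro cell_measurableI test_fun_borel_measurable[OF test])
  then have "(\<lambda>x. w x - \<psi> x) \<in> borel_measurable cell_measure" using w_meas by measurable
  then show "\<exists>g\<in>Collect (test_fun (box 0 1)). Lp_fun cell_measure p g \<and>
      Lp_norm_pow cell_measure p (\<lambda>x. w x - g x) < e"
    using test \<psi> \<psi>_meas by (auto simp: Lp_fun_box_iff_cell Lp_norm_pow_box_eq_cell)
qed

lemma cell_conv_Lp_tendsto:
  fixes w :: "real^'m \<Rightarrow> real"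
  assumes p: "p > 1" and w: "Lp_fun cell_measure p w"
  shows "(\<lambda>N. Lp_norm_pow cell_measure p (\<lambda>y. cell_conv (peak_kernel N) w y - w y)) \<longlonglongrightarrow> 0"
proof (rule Lp_closure_tendsto)
  show "w \<in> Lp_closure cell_measure p (Collect (test_fun (box 0 1)))" using p w by (intro test_fun_dense_cell) auto
  show "cell_conv (peak_kernel N) (\<lambda>x. g x - h x) y =
      cell_conv (peak_kernel N) g y - cell_conv (peak_kernel N) h y"
    if "Lp_fun cell_measure p g" "Lp_fun cell_measure p h" for N g h y
    using that p by (intro cell_conv_diff_right trig_poly_peak_kernel
      Lp_fun_imp_integrable[OF cell.finite_measure_axioms, of p]) auto
  show "(\<lambda>N. Lp_norm_pow cell_measure p (\<lambda>x. cell_conv (peak_kernel N) \<psi> x - \<psi> x)) \<longlonglongrightarrow> 0"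
    if "\<psi> \<in> Collect (test_fun (box 0 1))" and \<psi>: "Lp_fun cell_measure p \<psi>" for \<psi> :: "real^'m \<Rightarrow> real"
  proof -
    have test: "test_fun (box 0 1) \<psi>" using that by simp
    obtain B where B: "\<And>x. \<bar>\<psi> x\<bar> \<le> B" using test_fun_bounded[OF test] by metis
    note lim = cell_conv_peak_kernel_uniform_limit[OF Lp_fun_measurable[OF \<psi>] B
        test_fun_imp_torus_uniformly_continuous[OF test]]
    show ?thesis
    proof (rule Lp_norm_pow_tendsto_0I)
      fix e :: real assume "0 < e"
      define d where "d = (e / 2) powr (1 / p)"
      have d: "d > 0" "d powr p = e / 2" using \<open>0 < e\<close> p by (auto simp: d_def powr_powr)
      show "\<forall>\<^sub>F N in sequentially. Lp_norm_pow cell_measure p (\<lambda>x. cell_conv (peak_kernel N) \<psi> x - \<psi> x) < e"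
        using uniform_limitD[OF lim d(1)]
      proof eventually_elim
        case (elim N)
        have "(\<lambda>x. cell_conv (peak_kernel N) \<psi> x - \<psi> x) \<in> borel_measurable cell_measure"
          using Lp_fun_measurable[OF Lp_fun_cell_conv[OF p \<psi>]] Lp_fun_measurable[OF \<psi>] by measurable
        then have "Lp_norm_pow cell_measure p (\<lambda>x. cell_conv (peak_kernel N) \<psi> x - \<psi> x) \<le>
            d powr p * measure cell_measure (space (cell_measure :: (real^'m) measure))"
          using elim p by (intro Lp_norm_pow_bounded cell.finite_measure_axioms)
            (auto simp: dist_real_def less_imp_le)
        then show ?case using d(2) \<open>0 < e\<close> by simp
      qed
    qed
  qed
qed (use p in \<open>auto intro: Lp_fun_cell_conv Lp_norm_pow_cell_conv_le\<close>)

subsection \<open>Mean value property of quasi-periodic oscillations\<close>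

lemma Caratheodory_measurable:
  fixes F :: "'a \<Rightarrow> 'b::{metric_space, second_countable_topology} \<Rightarrow> 'c::metric_space"
  assumes F: "\<And>v. (\<lambda>x. F x v) \<in> borel_measurable M"
    and cont: "\<And>x. x \<in> space M \<Longrightarrow> continuous_on UNIV (F x)"
    and g: "g \<in> borel_measurable M"
  shows "(\<lambda>x. F x (g x)) \<in> borel_measurable M"
proof -
  obtain G where G: "\<And>i. simple_function M (G i)" "\<And>x. x \<in> space M \<Longrightarrow> (\<lambda>i. G i x) \<longlonglongrightarrow> g x"
    using borel_measurable_implies_sequence_metric[OF g, of undefined] by blast
  show ?thesis
  proof (rule borel_measurable_LIMSEQ_metric)
    show "(\<lambda>x. F x (G i x)) \<in> borel_measurable M" for i
    proof (rule measurable_compose_countable'[where f = "\<lambda>v x. F x v" and I = "G i ` space M"])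
      have fin: "finite (G i ` space M)" using G(1)[of i] by (simp add: simple_function_def)
      then show "countable (G i ` space M)" by (rule countable_finite)
      show "G i \<in> measurable M (count_space (G i ` space M))"
        using G(1)[of i] fin by (subst measurable_count_space_eq2) (auto simp: simple_function_def)
    qed (rule F)
    show "(\<lambda>i. F x (G i x)) \<longlonglongrightarrow> F x (g x)" if "x \<in> space M" for x
      using continuous_on_tendsto_compose[OF cont[OF that] G(2)[OF that]] by simp
  qed
qed

lemma cSUP_eq_cSUP_dense:
  fixes f :: "'a::topological_space \<Rightarrow> real"
  assumes cont: "continuous_on UNIV f" and bdd: "bdd_above (range f)" and dense: "closure D = UNIV"
  shows "(SUP y. f y) = (SUP y\<in>D. f y)"
proof (rule antisym)
  have bdd_D: "bdd_above (f ` D)" using bdd by (rule bdd_above_mono) auto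
  have "D \<noteq> {}" using dense by auto
  then show "(SUP y\<in>D. f y) \<le> (SUP y. f y)" using bdd by (intro cSUP_subset_mono) auto
  have "closed {y. f y \<le> (SUP y\<in>D. f y)}" by (intro closed_Collect_le cont continuous_on_const)
  moreover have "D \<subseteq> {y. f y \<le> (SUP y\<in>D. f y)}" using bdd_D by (auto intro: cSUP_upper)
  ultimately have "f y \<le> (SUP y\<in>D. f y)" for y using dense closure_minimal by blast
  then show "(SUP y. f y) \<le> (SUP y\<in>D. f y)" by (intro cSUP_least) auto
qed

lemma borel_measurable_SUP_continuous:
  fixes f :: "'a \<Rightarrow> 'b::second_countable_topology \<Rightarrow> real"
  assumes meas: "\<And>y. (\<lambda>x. f x y) \<in> borel_measurable M"
    and cont: "\<And>x. x \<in> space M \<Longrightarrow> continuous_on UNIV (f x)"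
    and bdd: "\<And>x. x \<in> space M \<Longrightarrow> bdd_above (range (f x))"
  shows "(\<lambda>x. SUP y. f x y) \<in> borel_measurable M"
proof -
  obtain D :: "'b set" where D: "countable D" "\<And>X. open X \<Longrightarrow> X \<noteq> {} \<Longrightarrow> \<exists>d\<in>D. d \<in> X"
    by (rule countable_dense_setE) blast
  have "x \<in> closure D" for x
    unfolding closure_iff_nhds_not_empty using D(2) by (metis disjoint_iff empty_iff subsetD)
  then have dense: "closure D = UNIV" by blast
  have "(\<lambda>x. SUP y\<in>D. f x y) \<in> borel_measurable M"
    using meas bdd by (intro borel_measurable_cSUP D(1)) (auto intro: bdd_above_mono[OF bdd])
  then show ?thesis
    by (subst measurable_cong[OF cSUP_eq_cSUP_dense]) (use cont bdd dense in auto)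
qed

locale oscillation =
  fixes \<Omega> :: "(real^'n) set" and R :: "real^'n^'m" and eps :: "nat \<Rightarrow> real"
  assumes open_\<Omega>: "open \<Omega>" and bounded_\<Omega>: "bounded \<Omega>"
    and nonresonant: "\<And>k::real^'m. int_vec k \<Longrightarrow> k \<noteq> 0 \<Longrightarrow> transpose R *v k \<noteq> 0"
    and eps_pos: "\<And>j. eps j > 0" and eps_tendsto_0: "eps \<longlonglongrightarrow> 0"
begin

abbreviation (input) MO :: "(real^'n) measure" where "MO \<equiv> lebesgue_on \<Omega>"

abbreviation (input) PM :: "((real^'n) \<times> (real^'m)) measure" where "PM \<equiv> lebesgue_on \<Omega> \<Otimes>\<^sub>M cell_measure"

sublocale slow: finite_measure "lebesgue_on \<Omega>"
  using open_\<Omega> bounded_\<Omega> by (rule finite_measure_lebesgue_on_open)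

sublocale slow_fast: pair_sigma_finite "lebesgue_on \<Omega>" "cell_measure :: (real^'m) measure" ..

lemma finite_measure_PM: "finite_measure PM"
  by (intro finite_measure_pair_measure slow.finite_measure_axioms cell.finite_measure_axioms)

lemma \<Omega>_lebesgue: "\<Omega> \<in> sets lebesgue"
  using open_\<Omega> by auto

lemma measurable_snd_PM: "snd \<in> borel_measurable PM"
  by (rule measurable_compose[OF measurable_snd]) (auto intro: cell_measurableI)

lemma AE_PM_fst:
  assumes "AE x in MO. P x"
  shows "AE z in PM. P (fst z)"
proof -
  obtain N where P: "\<And>x. x \<in> space MO - N \<Longrightarrow> P x" and N: "N \<in> null_sets MO"
    using AE_E3[OF assms] by blast
  have "(unit_cell :: (real^'m) set) \<in> sets cell_measure" using sets.top[of "cell_measure :: (real^'m) measure"]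
    by simp
  then have "N \<times> unit_cell \<in> null_sets PM"
    using N cell.emeasure_pair_measure_Times[of N MO unit_cell] by (auto simp: null_sets_def)
  then show ?thesis
    by (rule AE_I') (use P in \<open>fastforce simp: space_pair_measure\<close>)
qed

lemma
  fixes f :: "real^'n \<Rightarrow> real"
  assumes f: "integrable MO f"
  shows integrable_PM_fst: "integrable PM (\<lambda>z. f (fst z))"
    and integral_PM_fst: "(LINT z|PM. f (fst z)) = (LINT x|MO. f x)"
proof -
  show "integrable PM (\<lambda>z. f (fst z))"
  proof (rule slow_fast.Fubini_integrable)
    show "(\<lambda>z. f (fst z)) \<in> borel_measurable PM" using f by (intro measurable_compose[OF measurable_fst]) auto
  qed (use f in auto)
  then show "(LINT z|PM. f (fst z)) = (LINT x|MO. f x)" using slow_fast.integral_fst' by force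
qed

lemma
  fixes f :: "real^'n \<Rightarrow> 'b::real_normed_vector"
  assumes "Lp_fun MO p f"
  shows Lp_fun_PM_fst: "Lp_fun PM p (\<lambda>z. f (fst z))"
    and Lp_norm_pow_PM_fst: "Lp_norm_pow PM p (\<lambda>z. f (fst z)) = Lp_norm_pow MO p f"
  using assms measurable_compose[OF measurable_fst Lp_fun_measurable[OF assms]]
    integrable_PM_fst[of "\<lambda>x. norm (f x) powr p"] integral_PM_fst[of "\<lambda>x. norm (f x) powr p"]
  by (auto simp: Lp_fun_def Lp_norm_pow_def)

definition fast :: "nat \<Rightarrow> real^'n \<Rightarrow> real^'m" where
  "fast j x = (1 / eps j) *\<^sub>R (R *v x)"

definition freq :: "nat \<Rightarrow> real^'m \<Rightarrow> real^'n" where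
  "freq j k = (1 / eps j) *\<^sub>R ((2 * pi) *\<^sub>R (transpose R *v k))"

lemma fast_measurable: "fast j \<in> borel_measurable MO"
  unfolding fast_def
  by (intro borel_measurable_lebesgue_onI borel_measurable_continuous_onI continuous_intros
      linear_continuous_on matrix_vector_mul_bounded_linear)

lemma harmonic_fast: "harmonic k a (fast j x) = wave (freq j k) a x"
proof -
  have "k \<bullet> (R *v x) = (transpose R *v k) \<bullet> x"
    by (metis dot_lmul_matrix transpose_matrix_vector)
  then show ?thesis by (simp add: wave_def fast_def freq_def)
qed

lemma Riemann_Lebesgue_fast:
  assumes "integrable MO G" "int_vec k" "k \<noteq> 0"
  shows "(\<lambda>j. LINT x|MO. G x * harmonic k a (fast j x)) \<longlonglongrightarrow> 0"
  unfolding harmonic_fast freq_def using nonresonant[OF assms(2,3)] assms(1)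
  by (intro Riemann_Lebesgue open_\<Omega> bounded_\<Omega> eps_pos eps_tendsto_0) auto

definition caratheodory :: "((real^'n) \<times> (real^'m) \<Rightarrow> real) \<Rightarrow> (real^'n \<Rightarrow> real) \<Rightarrow> bool" where
  "caratheodory F h \<longleftrightarrow> (\<forall>y. (\<lambda>x. F (x, y)) \<in> borel_measurable MO) \<and>
     (\<forall>x\<in>\<Omega>. continuous_on UNIV (\<lambda>y. F (x, y)) \<and> periodic_cell (\<lambda>y. F (x, y)) \<and> (\<forall>y. \<bar>F (x, y)\<bar> \<le> h x)) \<and>
     integrable MO h"

context
  fixes F h assumes F: "caratheodory F h"
begin

lemma
  shows caratheodory_measurable: "(\<lambda>x. F (x, y)) \<in> borel_measurable MO"
    and caratheodory_continuous: "x \<in> \<Omega> \<Longrightarrow> continuous_on UNIV (\<lambda>y. F (x, y))"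
    and caratheodory_periodic: "x \<in> \<Omega> \<Longrightarrow> periodic_cell (\<lambda>y. F (x, y))"
    and caratheodory_bound: "x \<in> \<Omega> \<Longrightarrow> \<bar>F (x, y)\<bar> \<le> h x"
    and caratheodory_majorant: "integrable MO h"
  using F unfolding caratheodory_def by auto

lemma caratheodory_fast_integrable: "integrable MO (\<lambda>x. F (x, fast j x))"
proof (rule Bochner_Integration.integrable_bound[OF caratheodory_majorant])
  show "(\<lambda>x. F (x, fast j x)) \<in> borel_measurable MO"
    by (rule Caratheodory_measurable[where F = "\<lambda>x y. F (x, y)"])
       (use caratheodory_measurable caratheodory_continuous fast_measurable in auto)
  show "AE x in MO. norm (F (x, fast j x)) \<le> norm (h x)"
    by (rule AE_I2) (use caratheodory_bound in \<open>auto intro: order.trans[OF _ abs_ge_self]\<close>)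
qed

lemma caratheodory_PM_measurable: "F \<in> borel_measurable PM"
proof -
  have "(\<lambda>z. F (fst z, snd z)) \<in> borel_measurable PM"
    by (rule Caratheodory_measurable[where F = "\<lambda>z y. F (fst z, y)"])
       (use measurable_compose[OF measurable_fst caratheodory_measurable] caratheodory_continuous measurable_snd_PM
        in \<open>auto simp: space_pair_measure\<close>)
  then show ?thesis by simp
qed

lemma caratheodory_PM_integrable: "integrable PM F"
  by (rule Bochner_Integration.integrable_bound[OF integrable_PM_fst[OF caratheodory_majorant]
    caratheodory_PM_measurable], rule AE_I2)
     (use caratheodory_bound in \<open>auto simp: space_pair_measure intro: order.trans[OF _ abs_ge_self]\<close>)

lemma caratheodory_cell_integrable:
  assumes "x \<in> \<Omega>"
  shows "integrable cell_measure (\<lambda>y. F (x, y))"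
  using assms caratheodory_bound
  by (intro cell.integrable_const_bound[where B = "h x"] cell_measurableI borel_measurable_continuous_onI
      caratheodory_continuous) auto

lemma caratheodory_moment_integrable: "integrable MO (\<lambda>x. fourier_moment k a (\<lambda>y. F (x, y)))"
proof -
  have "integrable PM (\<lambda>z. F z * harmonic k a (snd z))"
    using abs_wave_le_1
    by (intro integrable_mult_bounded[where B = 1] caratheodory_PM_integrable
        measurable_compose[OF measurable_snd_PM] borel_measurable_wave) auto
  from slow_fast.integrable_fst'[OF this] show ?thesis by (simp add: fourier_moment_def mult.commute)
qed

lemma integrable_mult_harmonic_fast:
  assumes "integrable MO G"
  shows "integrable MO (\<lambda>x. G x * harmonic k a (fast j x))"
  using assms abs_wave_le_1
  by (intro integrable_mult_bounded[where B = 1] measurable_compose[OF fast_measurable borel_measurable_wave]) auto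

lemma cell_conv_fast_integrable:
  assumes "trig_poly K"
  shows "integrable MO (\<lambda>x. cell_conv K (\<lambda>y. F (x, y)) (fast j x))"
  using assms
proof (induction rule: trig_poly.induct)
  case (harmonic k c a)
  show ?case
    using integrable_mult_harmonic_fast[OF caratheodory_moment_integrable[of k 0], of k a j]
      integrable_mult_harmonic_fast[OF caratheodory_moment_integrable[of k "- (pi / 2)"], of k "a - pi / 2" j]
    by (subst Bochner_Integration.integrable_cong[OF refl cell_conv_harmonic[OF caratheodory_cell_integrable]])
       (auto simp: mult.commute)
next
  case (add f g)
  then show ?case
    by (subst Bochner_Integration.integrable_cong[OF refl
      cell_conv_add_left[OF add.hyps caratheodory_cell_integrable]]) auto
qed

lemma cell_conv_fast_tendsto:
  assumes "trig_poly K"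
  shows "(\<lambda>j. LINT x|MO. cell_conv K (\<lambda>y. F (x, y)) (fast j x)) \<longlonglongrightarrow> (LINT y|cell_measure. K y) * (LINT z|PM. F z)"
  using assms
proof (induction rule: trig_poly.induct)
  case (harmonic k c a)
  show ?case
  proof (cases "k = 0")
    case True
    have "(LINT x|MO. LINT y|cell_measure. F (x, y)) = (LINT z|PM. F z)"
      by (rule slow_fast.integral_fst'[OF caratheodory_PM_integrable])
    then show ?thesis using True by (simp add: cell_conv_def wave_def)
  next
    case False
    let ?m = "\<lambda>a x. fourier_moment k a (\<lambda>y. F (x, y))"
    have "(LINT x|MO. cell_conv (\<lambda>u. c * harmonic k a u) (\<lambda>y. F (x, y)) (fast j x)) =
        c * ((LINT x|MO. ?m 0 x * harmonic k a (fast j x)) +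
            (LINT x|MO. ?m (- (pi / 2)) x * harmonic k (a - pi / 2) (fast j x)))" for j
      using integrable_mult_harmonic_fast[OF caratheodory_moment_integrable[of k 0], of k a j]
        integrable_mult_harmonic_fast[OF caratheodory_moment_integrable[of k "- (pi / 2)"], of k "a - pi / 2" j]
      by (subst Bochner_Integration.integral_cong[OF refl cell_conv_harmonic[OF caratheodory_cell_integrable]])
         (auto simp: mult.commute)
    moreover have "(\<lambda>j. c * ((LINT x|MO. ?m 0 x * harmonic k a (fast j x)) +
        (LINT x|MO. ?m (- (pi / 2)) x * harmonic k (a - pi / 2) (fast j x)))) \<longlonglongrightarrow> c * (0 + 0)"
      by (intro tendsto_intros Riemann_Lebesgue_fast caratheodory_moment_integrable harmonic False)
    ultimately show ?thesis using False by (simp add: cell_integral_harmonic[OF harmonic])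
  qed
next
  case (add f g)
  have "(LINT x|MO. cell_conv (\<lambda>u. f u + g u) (\<lambda>y. F (x, y)) (fast j x)) =
      (LINT x|MO. cell_conv f (\<lambda>y. F (x, y)) (fast j x)) +
          (LINT x|MO. cell_conv g (\<lambda>y. F (x, y)) (fast j x))" for j
    using cell_conv_fast_integrable[OF add.hyps(1)] cell_conv_fast_integrable[OF add.hyps(2)]
    by (subst Bochner_Integration.integral_cong[OF refl
      cell_conv_add_left[OF add.hyps caratheodory_cell_integrable]]) auto
  then show ?case
    using tendsto_add[OF add.IH] add.hyps[THEN trig_poly_cell_integrable] by (simp add: distrib_right)
qed

definition conv_error :: "nat \<Rightarrow> real^'n \<Rightarrow> real" where
  "conv_error N x = (SUP y. \<bar>cell_conv (peak_kernel N) (\<lambda>y. F (x, y)) y - F (x, y)\<bar>)"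

lemma abs_conv_diff_le:
  assumes "x \<in> \<Omega>"
  shows "\<bar>cell_conv (peak_kernel N) (\<lambda>y. F (x, y)) y - F (x, y)\<bar> \<le> 2 * h x"
  using abs_cell_conv_peak_kernel_le[OF caratheodory_cell_integrable[OF assms]
    caratheodory_bound[OF assms], of N y]
    caratheodory_bound[OF assms, of y] by linarith

lemma bdd_above_conv_diff:
  "x \<in> \<Omega> \<Longrightarrow> bdd_above (range (\<lambda>y. \<bar>cell_conv (peak_kernel N) (\<lambda>y. F (x, y)) y - F (x, y)\<bar>))"
  using abs_conv_diff_le by (intro bdd_aboveI2)

lemma abs_conv_diff_le_conv_error:
  "x \<in> \<Omega> \<Longrightarrow> \<bar>cell_conv (peak_kernel N) (\<lambda>y. F (x, y)) y - F (x, y)\<bar> \<le> conv_error N x"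
  unfolding conv_error_def by (intro cSUP_upper bdd_above_conv_diff) auto

lemma conv_error_bounds: "x \<in> \<Omega> \<Longrightarrow> 0 \<le> conv_error N x" "x \<in> \<Omega> \<Longrightarrow> conv_error N x \<le> 2 * h x"
proof -
  show "x \<in> \<Omega> \<Longrightarrow> 0 \<le> conv_error N x" by (rule order.trans[OF abs_ge_zero abs_conv_diff_le_conv_error])
  show "x \<in> \<Omega> \<Longrightarrow> conv_error N x \<le> 2 * h x" unfolding conv_error_def by (intro cSUP_least abs_conv_diff_le) auto
qed

lemma cell_conv_slice_trig_poly: "x \<in> \<Omega> \<Longrightarrow> trig_poly (cell_conv (peak_kernel N) (\<lambda>y. F (x, y)))"
  by (intro trig_poly_cell_conv trig_poly_peak_kernel caratheodory_cell_integrable)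

lemma conv_error_integrable: "integrable MO (conv_error N)"
proof (rule Bochner_Integration.integrable_bound[of _ "\<lambda>x. 2 * h x"])
  show "conv_error N \<in> borel_measurable MO"
    unfolding conv_error_def
  proof (rule borel_measurable_SUP_continuous)
    fix y
    have "(\<lambda>z. peak_kernel N (y - snd z) * F z) \<in> borel_measurable PM"
      by (intro borel_measurable_times caratheodory_PM_measurable borel_measurable_diff borel_measurable_const
        measurable_snd_PM
          measurable_compose[OF _ trig_poly_borel_measurable[OF trig_poly_peak_kernel]])
    then have "(\<lambda>x. cell_conv (peak_kernel N) (\<lambda>y. F (x, y)) y) \<in> borel_measurable MO"
      unfolding cell_conv_def by (intro cell.borel_measurable_lebesgue_integral) (simp add: case_prod_unfold)
    then show "(\<lambda>x. \<bar>cell_conv (peak_kernel N) (\<lambda>y. F (x, y)) y - F (x, y)\<bar>) \<in> borel_measurable MO"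
      using caratheodory_measurable[of y] by measurable
  next
    fix x assume "x \<in> space MO"
    then have x: "x \<in> \<Omega>" by simp
    show "continuous_on UNIV (\<lambda>y. \<bar>cell_conv (peak_kernel N) (\<lambda>y. F (x, y)) y - F (x, y)\<bar>)"
      by (intro continuous_intros trig_poly_continuous_on cell_conv_slice_trig_poly caratheodory_continuous x)
    show "bdd_above (range (\<lambda>y. \<bar>cell_conv (peak_kernel N) (\<lambda>y. F (x, y)) y - F (x, y)\<bar>))"
      by (rule bdd_above_conv_diff[OF x])
  qed
qed (use caratheodory_majorant conv_error_bounds in \<open>auto intro!: AE_I2 order.trans[OF _ abs_ge_self]\<close>)

lemma conv_error_tendsto_0:
  assumes x: "x \<in> \<Omega>"
  shows "(\<lambda>N. conv_error N x) \<longlonglongrightarrow> 0"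
proof (rule tendstoI)
  fix e :: real assume "e > 0"
  let ?C = "\<lambda>N. cell_conv (peak_kernel N) (\<lambda>y. F (x, y))"
  have "uniform_limit unit_cell ?C (\<lambda>y. F (x, y)) sequentially"
    using x caratheodory_cell_integrable caratheodory_bound
    by (intro cell_conv_peak_kernel_uniform_limit[where B = "h x"]
      continuous_periodic_imp_torus_uniformly_continuous
        caratheodory_continuous caratheodory_periodic) auto
  then have "\<forall>\<^sub>F N in sequentially. \<forall>y\<in>unit_cell. dist (?C N y) (F (x, y)) < e / 2"
    using \<open>e > 0\<close> by (intro uniform_limitD) auto
  then show "\<forall>\<^sub>F N in sequentially. dist (conv_error N x) 0 < e"
  proof eventually_elim
    case (elim N)
    have "\<bar>?C N y - F (x, y)\<bar> \<le> e / 2" for y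
    proof -
      obtain k where k: "int_vec k" "y + k \<in> unit_cell" using exists_unit_cell_representative .
      have "?C N (y + k) = ?C N y" "F (x, y + k) = F (x, y)"
        using k(1) caratheodory_periodic[OF x] trig_poly_periodic[OF cell_conv_slice_trig_poly[OF x]]
        unfolding periodic_cell_def by blast+
      then show ?thesis using elim k(2) by (metis dist_real_def less_imp_le)
    qed
    then have "conv_error N x \<le> e / 2" unfolding conv_error_def by (intro cSUP_least) auto
    then show ?case using conv_error_bounds(1)[OF x, of N] \<open>e > 0\<close> by simp
  qed
qed

lemma integral_conv_error_tendsto_0: "(\<lambda>N. LINT x|MO. conv_error N x) \<longlonglongrightarrow> 0"
proof -
  have "(\<lambda>N. LINT x|MO. conv_error N x) \<longlonglongrightarrow> (LINT x|MO. 0)"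
    by (rule integral_dominated_convergence[where w = "\<lambda>x. 2 * h x"])
       (use caratheodory_majorant conv_error_bounds conv_error_tendsto_0 conv_error_integrable
        in \<open>auto intro!: AE_I2\<close>)
  then show ?thesis by simp
qed

theorem mean_value_tendsto: "(\<lambda>j. LINT x|MO. F (x, fast j x)) \<longlonglongrightarrow> (LINT z|PM. F z)"
proof (rule tendsto_approxI)
  fix e :: real assume "e > 0"
  then have "\<forall>\<^sub>F N in sequentially. (LINT x|MO. conv_error N x) < e"
    by (intro order_tendstoD(2)[OF integral_conv_error_tendsto_0])
  then obtain N where N: "(LINT x|MO. conv_error N x) < e"
    by (meson eventually_sequentially order_refl)
  let ?C = "\<lambda>x. cell_conv (peak_kernel N) (\<lambda>y. F (x, y))"
  note int = cell_conv_fast_integrable[OF trig_poly_peak_kernel[of N]] caratheodory_fast_integrable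
  have "dist (LINT x|MO. F (x, fast j x)) (LINT x|MO. ?C x (fast j x)) \<le> e" for j
  proof -
    have "dist (LINT x|MO. F (x, fast j x)) (LINT x|MO. ?C x (fast j x)) =
        \<bar>LINT x|MO. ?C x (fast j x) - F (x, fast j x)\<bar>"
      using int by (simp add: dist_real_def abs_minus_commute)
    also have "\<dots> \<le> (LINT x|MO. \<bar>?C x (fast j x) - F (x, fast j x)\<bar>)"
      by (rule integral_abs_bound)
    also have "\<dots> \<le> (LINT x|MO. conv_error N x)"
      using int conv_error_integrable abs_conv_diff_le_conv_error by (intro integral_mono) auto
    finally show ?thesis using N by simp
  qed
  then show "\<exists>g m. (g \<longlonglongrightarrow> m) \<and>
      (\<forall>\<^sub>F j in sequentially. dist (LINT x|MO. F (x, fast j x)) (g j) \<le> e) \<and> dist m (LINT z|PM. F z) \<le> e"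
    using cell_conv_fast_tendsto[OF trig_poly_peak_kernel[of N]] \<open>e > 0\<close>
    by (intro exI[of _ "\<lambda>j. LINT x|MO. ?C x (fast j x)"] exI[of _ "LINT z|PM. F z"])
       (simp add: integral_peak_kernel)
qed

end

end

subsection \<open>Weak limits of bounded sequences\<close>

definition hyp :: "real \<Rightarrow> real" where
  "hyp t = sqrt (1 + t\<^sup>2)"

definition hyp_gap :: "real \<Rightarrow> real \<Rightarrow> real" where
  "hyp_gap a b = (hyp a + hyp b) / 2 - hyp ((a + b) / 2)"

lemma hyp_power2: "(hyp t)\<^sup>2 = 1 + t\<^sup>2"
  by (simp add: hyp_def add_nonneg_nonneg)

lemma hyp_pos: "0 < hyp t"
  unfolding hyp_def by (intro real_sqrt_gt_zero add_pos_nonneg) auto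

lemma hyp_le: "hyp t \<le> 1 + \<bar>t\<bar>"
  unfolding hyp_def by (intro real_le_lsqrt) (auto simp: power2_eq_square algebra_simps)

lemma hyp_borel_measurable [measurable]: "hyp \<in> borel_measurable borel"
  unfolding hyp_def[abs_def] by measurable

text \<open>Both factors of \<open>(a - b)\<^sup>2 = (hyp a * hyp b)\<^sup>2 - (1 + a * b)\<^sup>2\<close> are controlled: the difference is
  twice \<open>S\<^sup>2 - c\<^sup>2\<close> for the mean \<open>S\<close> of the values and the value \<open>c\<close> at the mean, the sum is at most
  \<open>2 * S\<^sup>2\<close>.\<close>

lemma
  fixes a b :: real
  shows hyp_gap_nonneg: "0 \<le> hyp_gap a b"
    and power2_diff_le_hyp_gap: "(a - b)\<^sup>2 \<le> 8 * ((hyp a + hyp b) / 2) ^ 3 * hyp_gap a b"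
proof -
  define S c P where "S = (hyp a + hyp b) / 2" and "c = hyp ((a + b) / 2)" and "P = hyp a * hyp b"
  have pos: "S > 0" "c > 0" "P > 0" by (simp_all add: S_def c_def P_def hyp_pos add_pos_pos)
  have P_power2: "P\<^sup>2 = (1 + a * b)\<^sup>2 + (a - b)\<^sup>2"
    unfolding P_def power_mult_distrib hyp_power2 by (simp add: power2_eq_square algebra_simps)
  have "(1 + a * b)\<^sup>2 \<le> P\<^sup>2" unfolding P_power2 by simp
  then have P_ge: "1 + a * b \<le> P" using pos by (metis power2_le_imp_le less_imp_le)
  have "S\<^sup>2 = ((hyp a)\<^sup>2 + (hyp b)\<^sup>2 + 2 * P) / 4"
    unfolding S_def P_def by (simp add: power_divide power2_sum)
  moreover have "c\<^sup>2 = 1 + ((a + b) / 2)\<^sup>2" unfolding c_def by (rule hyp_power2)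
  ultimately have power2_gap: "S\<^sup>2 - c\<^sup>2 = (P - (1 + a * b)) / 2"
    unfolding hyp_power2 by (simp add: power_divide power2_sum field_simps)
  have "S\<^sup>2 - P = ((hyp a - hyp b) / 2)\<^sup>2"
    unfolding S_def P_def by (simp add: power_divide power2_sum power2_diff)
  then have AM_GM: "P \<le> S\<^sup>2" using zero_le_power2[of "(hyp a - hyp b) / 2"] by linarith
  have "0 \<le> S\<^sup>2 - c\<^sup>2" unfolding power2_gap using P_ge by simp
  then have "c\<^sup>2 \<le> S\<^sup>2" by simp
  then have cS: "c \<le> S" using pos by (metis power2_le_imp_le less_imp_le)
  then show "0 \<le> hyp_gap a b" by (simp add: hyp_gap_def S_def c_def)
  have "(a - b)\<^sup>2 = (P - (1 + a * b)) * (P + (1 + a * b))" using P_power2 by algebra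
  also have "\<dots> \<le> (P - (1 + a * b)) * (2 * S\<^sup>2)" using P_ge AM_GM by (intro mult_left_mono) auto
  also have "\<dots> = (S\<^sup>2 - c\<^sup>2) * (4 * S\<^sup>2)" using power2_gap by simp
  also have "\<dots> = (S - c) * (S + c) * (4 * S\<^sup>2)" by algebra
  also have "\<dots> \<le> (S - c) * (2 * S) * (4 * S\<^sup>2)" using cS by (intro mult_right_mono mult_left_mono) auto
  also have "\<dots> = 8 * S ^ 3 * (S - c)" by (simp add: power2_eq_square power3_eq_cube)
  finally show "(a - b)\<^sup>2 \<le> 8 * ((hyp a + hyp b) / 2) ^ 3 * hyp_gap a b" unfolding S_def c_def hyp_gap_def .
qed

lemma abs_diff_le_hyp_gap:
  assumes M: "M \<ge> 1" and \<eta>: "\<eta> > 0" and p: "p > 1"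
  shows "\<bar>a - b\<bar> \<le> \<eta> + (64 * M ^ 3 / \<eta>) * hyp_gap a b + 2 * M powr (1 - p) * (\<bar>a\<bar> powr p + \<bar>b\<bar> powr p)"
proof (cases "\<bar>a\<bar> \<le> M \<and> \<bar>b\<bar> \<le> M")
  case True
  have "(hyp a + hyp b) / 2 \<le> 2 * M" using hyp_le[of a] hyp_le[of b] True M by auto
  then have cube: "((hyp a + hyp b) / 2) ^ 3 \<le> (2 * M) ^ 3"
    using hyp_pos[of a] hyp_pos[of b] by (intro power_mono) auto
  have "(a - b)\<^sup>2 \<le> 8 * ((hyp a + hyp b) / 2) ^ 3 * hyp_gap a b" by (rule power2_diff_le_hyp_gap)
  also have "\<dots> \<le> 8 * (2 * M) ^ 3 * hyp_gap a b"
    using cube by (intro mult_right_mono mult_left_mono hyp_gap_nonneg) auto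
  also have "\<dots> = 64 * M ^ 3 * hyp_gap a b" by (simp add: power_mult_distrib)
  finally have "(a - b)\<^sup>2 \<le> 64 * M ^ 3 * hyp_gap a b" .
  then have "(a - b)\<^sup>2 / \<eta> \<le> 64 * M ^ 3 / \<eta> * hyp_gap a b" using \<eta> by (simp add: divide_right_mono)
  moreover have "\<bar>a - b\<bar> \<le> \<eta> + (a - b)\<^sup>2 / \<eta>"
  proof (cases "\<bar>a - b\<bar> \<le> \<eta>")
    case False
    then have "\<bar>a - b\<bar> * \<eta> \<le> \<bar>a - b\<bar> * \<bar>a - b\<bar>" by (intro mult_left_mono) auto
    then have "\<bar>a - b\<bar> \<le> (a - b)\<^sup>2 / \<eta>" using \<eta> by (simp add: field_simps power2_eq_square)
    then show ?thesis using \<eta> by linarith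
  qed (use \<eta> in \<open>simp add: add_increasing2\<close>)
  moreover have "0 \<le> 2 * M powr (1 - p) * (\<bar>a\<bar> powr p + \<bar>b\<bar> powr p)" by simp
  ultimately show ?thesis by linarith
next
  case False
  define m where "m = max \<bar>a\<bar> \<bar>b\<bar>"
  have m: "m > M" "m > 0" using False M by (auto simp: m_def)
  have "m powr 1 = m powr (1 - p) * m powr p" by (subst powr_add[symmetric]) simp
  also have "\<dots> \<le> M powr (1 - p) * m powr p"
    using m M p by (intro mult_right_mono powr_mono2') auto
  also have "\<dots> \<le> M powr (1 - p) * (\<bar>a\<bar> powr p + \<bar>b\<bar> powr p)"
    by (intro mult_left_mono) (auto simp: m_def max_def)
  finally have "m \<le> M powr (1 - p) * (\<bar>a\<bar> powr p + \<bar>b\<bar> powr p)" using m by simp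
  moreover have "\<bar>a - b\<bar> \<le> 2 * m" by (auto simp: m_def)
  moreover have "0 \<le> 64 * M ^ 3 / \<eta> * hyp_gap a b" using M \<eta> hyp_gap_nonneg by simp
  ultimately show ?thesis using \<eta> by linarith
qed

lemma powr_midpoint_le:
  fixes a b p :: real
  assumes "p > 1"
  shows "\<bar>(a + b) / 2\<bar> powr p \<le> (\<bar>a\<bar> powr p + \<bar>b\<bar> powr p) / 2"
proof -
  have half: "(t / 2) powr p \<le> t powr p / 2" if "t \<ge> 0" for t :: real
  proof -
    have "(1/2::real) powr p \<le> (1/2) powr 1" using assms by (intro powr_mono') auto
    then have "t powr p * (1/2) powr p \<le> t powr p * (1/2)" by (intro mult_left_mono) auto
    then show ?thesis using that by (simp add: powr_divide powr_one_eq_one)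
  qed
  have "((\<bar>a\<bar> + \<bar>b\<bar>) / 2) powr p \<le> (\<bar>a\<bar> powr p + \<bar>b\<bar> powr p) / 2"
  proof (cases "a = 0 \<or> b = 0")
    case True
    then show ?thesis using half[of "\<bar>a\<bar>"] half[of "\<bar>b\<bar>"] by auto
  next
    case False
    then show ?thesis
      using convex_onD[OF powr_convex, of p "1/2" "\<bar>a\<bar>" "\<bar>b\<bar>"] assms by (simp add: add_divide_distrib)
  qed
  moreover have "\<bar>(a + b) / 2\<bar> powr p \<le> ((\<bar>a\<bar> + \<bar>b\<bar>) / 2) powr p"
    using assms by (intro powr_mono2) auto
  ultimately show ?thesis by linarith
qed

lemma AE_summable_norm:
  fixes f :: "nat \<Rightarrow> 'a \<Rightarrow> 'b::{banach, second_countable_topology}"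
  assumes f: "\<And>k. integrable M (f k)" and sum: "summable (\<lambda>k. LINT x|M. norm (f k x))"
  shows "AE x in M. summable (\<lambda>k. norm (f k x))"
proof -
  have "(\<integral>\<^sup>+ x. (\<Sum>k. ennreal (norm (f k x))) \<partial>M) = (\<Sum>k. \<integral>\<^sup>+ x. ennreal (norm (f k x)) \<partial>M)"
    by (intro nn_integral_suminf) (use f in auto)
  also have "\<dots> = (\<Sum>k. ennreal (LINT x|M. norm (f k x)))"
    using f by (subst nn_integral_eq_integral) auto
  also have "\<dots> = ennreal (\<Sum>k. LINT x|M. norm (f k x))"
    by (intro suminf_ennreal2 sum) auto
  finally have "(\<integral>\<^sup>+ x. (\<Sum>k. ennreal (norm (f k x))) \<partial>M) \<noteq> \<infinity>" by simp
  then have "AE x in M. (\<Sum>k. ennreal (norm (f k x))) \<noteq> \<infinity>"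
    by (intro nn_integral_noteq_infinite) (use f in auto)
  then show ?thesis by eventually_elim (auto intro: summable_suminf_not_top)
qed

lemma L1_summable_increments_imp_AE_convergent:
  fixes s :: "nat \<Rightarrow> 'a \<Rightarrow> real"
  assumes s: "\<And>k. integrable M (s k)"
    and sum: "summable (\<lambda>k. LINT x|M. norm (s (Suc k) x - s k x))"
  obtains v h where "v \<in> borel_measurable M" "integrable M h" "AE x in M. (\<lambda>k. s k x) \<longlonglongrightarrow> v x"
    "\<And>k. AE x in M. \<bar>s k x\<bar> \<le> h x"
proof -
  define f where "f k x = s (Suc k) x - s k x" for k x
  have f: "integrable M (f k)" for k unfolding f_def using s by simp
  have summable: "AE x in M. summable (\<lambda>k. norm (f k x))"
    using AE_summable_norm[OF f] sum by (simp add: f_def)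
  have telescope: "s n x = s 0 x + (\<Sum>k<n. f k x)" for n x
    by (induction n) (auto simp: f_def)
  show thesis
  proof (rule that[of "\<lambda>x. lim (\<lambda>k. s k x)" "\<lambda>x. \<bar>s 0 x\<bar> + (\<Sum>k. norm (f k x))"])
    have [measurable]: "s k \<in> borel_measurable M" for k using s by auto
    show "(\<lambda>x. lim (\<lambda>k. s k x)) \<in> borel_measurable M" by measurable
    show "integrable M (\<lambda>x. \<bar>s 0 x\<bar> + (\<Sum>k. norm (f k x)))"
    proof (rule Bochner_Integration.integrable_add[OF _ integrable_suminf])
      show "integrable M (\<lambda>x. norm (f k x))" for k using f by simp
      show "integrable M (\<lambda>x. \<bar>s 0 x\<bar>)" using s[of 0] by simp
      show "AE x in M. summable (\<lambda>k. norm (norm (f k x)))" using summable by simp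
      show "summable (\<lambda>k. LINT x|M. norm (norm (f k x)))" using sum by (simp add: f_def)
    qed
    show "AE x in M. (\<lambda>k. s k x) \<longlonglongrightarrow> lim (\<lambda>k. s k x)"
      using summable
    proof eventually_elim
      case (elim x)
      then have "(\<lambda>n. s 0 x + (\<Sum>k<n. f k x)) \<longlonglongrightarrow> s 0 x + (\<Sum>k. f k x)"
        by (intro tendsto_intros summable_LIMSEQ) (rule summable_norm_cancel)
      then show ?case unfolding telescope[symmetric] by (simp add: limI)
    qed
    show "AE x in M. \<bar>s n x\<bar> \<le> \<bar>s 0 x\<bar> + (\<Sum>k. norm (f k x))" for n
      using summable
    proof eventually_elim
      case (elim x)
      have "\<bar>\<Sum>k<n. f k x\<bar> \<le> (\<Sum>k<n. norm (f k x))" by (simp add: sum_abs)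
      moreover have "(\<Sum>k<n. norm (f k x)) \<le> (\<Sum>k. norm (f k x))" using elim by (intro sum_le_suminf) auto
      ultimately show ?case using telescope[of n x] by linarith
    qed
  qed
qed

lemma L1_Cauchy_imp_AE_convergent_subseq:
  fixes s :: "nat \<Rightarrow> 'a \<Rightarrow> real"
  assumes s: "\<And>k. integrable M (s k)"
    and Cauchy: "\<And>e. e > 0 \<Longrightarrow> \<exists>N. \<forall>n\<ge>N. \<forall>m\<ge>n. (LINT x|M. \<bar>s n x - s m x\<bar>) < e"
  obtains r v h where "strict_mono r" "v \<in> borel_measurable M" "integrable M h"
    "AE x in M. (\<lambda>k. s (r k) x) \<longlonglongrightarrow> v x" "\<And>k::nat. AE x in M. \<bar>s (r k) x\<bar> \<le> h x"
proof -
  have "\<exists>N. \<forall>n\<ge>N. \<forall>m\<ge>n. (LINT x|M. \<bar>s n x - s m x\<bar>) < (1/2) ^ k" for k :: nat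
    by (intro Cauchy) simp
  then obtain N where N: "\<And>k n m. N k \<le> n \<Longrightarrow> n \<le> m \<Longrightarrow> (LINT x|M. \<bar>s n x - s m x\<bar>) < (1/2::real) ^ k"
    by metis
  define r where "r k = (\<Sum>i\<le>k. N i) + k" for k
  have r: "N k \<le> r k" "r k < r (Suc k)" for k
    unfolding r_def by (auto intro: trans_le_add1 member_le_sum)
  have small: "(LINT x|M. norm (s (r (Suc k)) x - s (r k) x)) < (1/2) ^ k" for k
    using N[OF r(1) less_imp_le[OF r(2)], of k] by (simp add: abs_minus_commute)
  have "summable (\<lambda>k. LINT x|M. norm (s (r (Suc k)) x - s (r k) x))"
  proof (rule summable_comparison_test')
    show "summable (\<lambda>k. (1/2::real) ^ k)" by (rule summable_geometric) simp
    show "norm (LINT x|M. norm (s (r (Suc k)) x - s (r k) x)) \<le> (1/2) ^ k" for k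
      using small[of k] by (simp add: less_imp_le)
  qed
  then obtain v h where "v \<in> borel_measurable M" "integrable M h"
    "AE x in M. (\<lambda>k. s (r k) x) \<longlonglongrightarrow> v x" "\<And>k. AE x in M. \<bar>s (r k) x\<bar> \<le> h x"
    by (rule L1_summable_increments_imp_AE_convergent[OF s]) blast
  moreover have "strict_mono r" using r(2) by (simp add: strict_mono_Suc_iff)
  ultimately show thesis using that by blast
qed

lemma Lp_fun_AE_limit:
  fixes s :: "nat \<Rightarrow> 'a \<Rightarrow> real"
  assumes s: "\<And>k. Lp_fun M p (s k)" "\<And>k. Lp_norm_pow M p (s k) \<le> C"
    and lim: "AE x in M. (\<lambda>k. s k x) \<longlonglongrightarrow> v x" and v: "v \<in> borel_measurable M" and p: "p > 0"
  shows "Lp_fun M p v"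
  unfolding Lp_fun_def
proof (intro conjI v integrableI_nonneg)
  note [measurable] = v Lp_fun_measurable[OF s(1)]
  have "AE x in M. ennreal (\<bar>v x\<bar> powr p) = liminf (\<lambda>k. ennreal (\<bar>s k x\<bar> powr p))"
    using lim
  proof eventually_elim
    case (elim x)
    have "(\<lambda>k. ennreal (\<bar>s k x\<bar> powr p)) \<longlonglongrightarrow> ennreal (\<bar>v x\<bar> powr p)"
      using p by (intro tendsto_ennrealI tendsto_powr' tendsto_intros elim) auto
    then show ?case by (metis lim_imp_Liminf sequentially_bot)
  qed
  then have "(\<integral>\<^sup>+ x. ennreal (\<bar>v x\<bar> powr p) \<partial>M) = (\<integral>\<^sup>+ x. liminf (\<lambda>k. ennreal (\<bar>s k x\<bar> powr p)) \<partial>M)"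
    by (rule nn_integral_cong_AE)
  also have "\<dots> \<le> liminf (\<lambda>k. \<integral>\<^sup>+ x. ennreal (\<bar>s k x\<bar> powr p) \<partial>M)"
    by (intro nn_integral_liminf) measurable
  also have "\<dots> \<le> liminf (\<lambda>k::nat. ennreal C)"
    using s Lp_fun_integrable_powr[OF s(1)]
    by (intro Liminf_mono always_eventually)
       (auto simp: nn_integral_eq_integral Lp_norm_pow_def intro!: ennreal_leI)
  also have "\<dots> = ennreal C" by (simp add: Liminf_const)
  finally show "(\<integral>\<^sup>+ x. ennreal (norm (v x) powr p) \<partial>M) < \<infinity>"
    by (simp add: order_le_less_trans)
qed (use v in auto)

inductive midhull :: "(nat \<Rightarrow> 'a \<Rightarrow> real) \<Rightarrow> nat \<Rightarrow> ('a \<Rightarrow> real) \<Rightarrow> bool" for u n where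
  base: "n \<le> j \<Longrightarrow> midhull u n (u j)"
| mid: "midhull u n f \<Longrightarrow> midhull u n g \<Longrightarrow> midhull u n (\<lambda>x. (f x + g x) / 2)"

lemma midhull_antimono: "midhull u n f \<Longrightarrow> m \<le> n \<Longrightarrow> midhull u m f"
  by (induction rule: midhull.induct) (auto intro: midhull.intros)

text \<open>A substitute for weak compactness of balls in \<open>L\<^sup>p\<close>: near-minimisers of the strictly convex
  functional \<open>\<integral>\<surd>(1 + f\<^sup>2)\<close> over the tail convex hulls form a Cauchy sequence in \<open>L\<^sup>1\<close>.\<close>

locale bounded_Lp_seq = finite_measure M for M :: "'a measure" +
  fixes u :: "nat \<Rightarrow> 'a \<Rightarrow> real" and p C :: real
  assumes p: "p > 1" and u_Lp: "\<And>j. Lp_fun M p (u j)" and u_bound: "\<And>j. Lp_norm_pow M p (u j) \<le> C"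
begin

lemma midhull_Lp: "midhull u n f \<Longrightarrow> Lp_fun M p f \<and> Lp_norm_pow M p f \<le> C"
proof (induction rule: midhull.induct)
  case (base j)
  then show ?case using u_Lp u_bound by simp
next
  case (mid f g)
  have Lp: "Lp_fun M p (\<lambda>x. (f x + g x) / 2)"
    using Lp_fun_scaleR[OF Lp_fun_add[of M p f g], of "1/2"] mid.IH p by simp
  note int = Lp_fun_integrable_powr[OF conjunct1[OF mid.IH(1)]] Lp_fun_integrable_powr[OF conjunct1[OF mid.IH(2)]]
  have "Lp_norm_pow M p (\<lambda>x. (f x + g x) / 2) \<le> (LINT x|M. (\<bar>f x\<bar> powr p + \<bar>g x\<bar> powr p) / 2)"
    unfolding Lp_norm_pow_def real_norm_def
    using Lp_fun_integrable_powr[OF Lp] int by (intro integral_mono powr_midpoint_le p) auto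
  also have "\<dots> = (Lp_norm_pow M p f + Lp_norm_pow M p g) / 2"
    using int by (simp add: Lp_norm_pow_def)
  finally show ?case using Lp mid.IH by simp
qed

lemma midhull_integrable: "midhull u n f \<Longrightarrow> integrable M f"
  using Lp_fun_imp_integrable[OF finite_measure_axioms] midhull_Lp p by (metis less_imp_le)

lemma hyp_integrable: "integrable M f \<Longrightarrow> integrable M (\<lambda>x. hyp (f x))"
proof (rule Bochner_Integration.integrable_bound[where f = "\<lambda>x. 1 + \<bar>f x\<bar>"])
  show "AE x in M. norm (hyp (f x)) \<le> norm (1 + \<bar>f x\<bar>)"
    using hyp_le hyp_pos by (intro AE_I2) (simp add: abs_of_pos)
qed auto

lemma hyp_gap_integrable: "integrable M f \<Longrightarrow> integrable M g \<Longrightarrow> integrable M (\<lambda>x. hyp_gap (f x) (g x))"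
  unfolding hyp_gap_def
  by (intro Bochner_Integration.integrable_diff integrable_divide Bochner_Integration.integrable_add
    hyp_integrable)

definition energy :: "('a \<Rightarrow> real) \<Rightarrow> real" where "energy f = (LINT x|M. hyp (f x))"

definition level :: "nat \<Rightarrow> real" where "level n = Inf (energy ` {f. midhull u n f})"

lemma energy_nonneg: "energy f \<ge> 0"
  unfolding energy_def by (intro integral_nonneg_AE) (auto simp: hyp_pos less_imp_le)

lemma bdd_below_energy: "bdd_below (energy ` A)"
  by (intro bdd_belowI[of _ 0]) (auto simp: energy_nonneg)

lemma level_le_energy: "midhull u n f \<Longrightarrow> level n \<le> energy f"
  unfolding level_def by (intro cInf_lower bdd_below_energy) auto

lemma midhull_nonempty: "{f. midhull u n f} \<noteq> {}"
  using midhull.base[of n n u] by blast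

lemma level_mono: "m \<le> n \<Longrightarrow> level m \<le> level n"
  unfolding level_def using midhull_nonempty[of n]
  by (intro cInf_superset_mono bdd_below_energy) (auto intro!: midhull_antimono)

lemma level_bounded: "level n \<le> 2 * measure M (space M) + C"
proof -
  have hull: "midhull u n (u n)" by (rule midhull.base) simp
  note int = midhull_integrable[OF hull]
  have "level n \<le> energy (u n)" by (rule level_le_energy[OF hull])
  also have "\<dots> \<le> (LINT x|M. 1 + norm (u n x))"
    unfolding energy_def using int hyp_integrable[OF int] hyp_le by (intro integral_mono) auto
  also have "\<dots> = measure M (space M) + (LINT x|M. norm (u n x))" using int by simp
  also have "(LINT x|M. norm (u n x)) \<le> measure M (space M) + Lp_norm_pow M p (u n)"
    using p by (intro integral_norm_le_Lp_norm_pow finite_measure_axioms u_Lp) auto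
  finally show ?thesis using u_bound[of n] by linarith
qed

lemma level_tendsto: "level \<longlonglongrightarrow> (SUP n. level n)" and level_le_SUP: "level n \<le> (SUP n. level n)"
proof -
  have bdd: "bdd_above (range level)" using level_bounded by (intro bdd_aboveI2)
  then show "level \<longlonglongrightarrow> (SUP n. level n)" by (intro LIMSEQ_incseq_SUP) (auto simp: incseq_def level_mono)
  show "level n \<le> (SUP n. level n)" by (intro cSUP_upper bdd) auto
qed

definition minimiser :: "nat \<Rightarrow> 'a \<Rightarrow> real" where
  "minimiser n = (SOME f. midhull u n f \<and> energy f < level n + 1 / real (Suc n))"

lemma midhull_minimiser: "midhull u n (minimiser n)"
  and energy_minimiser: "energy (minimiser n) < level n + 1 / real (Suc n)"
proof -
  have "\<exists>e\<in>energy ` {f. midhull u n f}. e < level n + 1 / real (Suc n)"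
    unfolding level_def using midhull_nonempty
    by (subst cInf_less_iff[symmetric]) (auto intro!: bdd_below_energy)
  then have "\<exists>f. midhull u n f \<and> energy f < level n + 1 / real (Suc n)" by auto
  then show "midhull u n (minimiser n)" "energy (minimiser n) < level n + 1 / real (Suc n)"
    unfolding minimiser_def by (metis (mono_tags, lifting) someI_ex)+
qed

lemma minimiser_integrable: "integrable M (minimiser n)"
  by (rule midhull_integrable[OF midhull_minimiser])

lemma minimiser_Lp: "Lp_fun M p (minimiser n)" and minimiser_bound: "Lp_norm_pow M p (minimiser n) \<le> C"
  using midhull_Lp[OF midhull_minimiser] by auto

lemma integral_hyp_gap_minimiser_le:
  assumes "n \<le> m"
  shows "(LINT x|M. hyp_gap (minimiser n x) (minimiser m x)) \<le> ((SUP n. level n) - level n) + 1 / real (Suc n)"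
proof -
  let ?mid = "\<lambda>x. (minimiser n x + minimiser m x) / 2"
  have mid: "midhull u n ?mid"
    using assms midhull_antimono[OF midhull_minimiser[of m]] by (intro midhull.mid midhull_minimiser) auto
  have "(LINT x|M. hyp_gap (minimiser n x) (minimiser m x)) =
      (energy (minimiser n) + energy (minimiser m)) / 2 - energy ?mid"
    unfolding hyp_gap_def energy_def
    using hyp_integrable[OF minimiser_integrable[of n]] hyp_integrable[OF minimiser_integrable[of m]]
      hyp_integrable[OF midhull_integrable[OF mid]] by simp
  also have "\<dots> \<le> (energy (minimiser n) + energy (minimiser m)) / 2 - level n"
    using level_le_energy[OF mid] by simp
  also have "\<dots> \<le> ((SUP n. level n) - level n) + 1 / real (Suc n)"
  proof -
    have "1 / real (Suc m) \<le> 1 / real (Suc n)" using assms by (simp add: field_simps)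
    moreover have "(x + y) / 2 - l \<le> S - l + a"
        if "a' \<le> a" "l \<le> l'" "x < l + a" "y < l' + a'" "l' \<le> S" for x y l l' a a' S :: real
      using that by simp
    ultimately show ?thesis
      using energy_minimiser[of n] energy_minimiser[of m] level_le_SUP[of m] level_mono[OF assms] by blast
  qed
  finally show ?thesis .
qed

lemma integral_abs_minimiser_diff_le:
  assumes B: "B \<ge> 1" and \<eta>: "\<eta> > 0"
  shows "(LINT x|M. \<bar>minimiser n x - minimiser m x\<bar>) \<le> \<eta> * measure M (space M)
    + (64 * B ^ 3 / \<eta>) * (LINT x|M. hyp_gap (minimiser n x) (minimiser m x)) + 4 * C * B powr (1 - p)"
proof -
  let ?w = minimiser
  note gap = hyp_gap_integrable[OF minimiser_integrable[of n] minimiser_integrable[of m]]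
  note pow = Lp_fun_integrable_powr[OF minimiser_Lp, unfolded real_norm_def]
  have "(LINT x|M. \<bar>?w n x - ?w m x\<bar>) \<le>
      (LINT x|M. \<eta> + (64 * B ^ 3 / \<eta>) * hyp_gap (?w n x) (?w m x) +
          2 * B powr (1 - p) * (\<bar>?w n x\<bar> powr p + \<bar>?w m x\<bar> powr p))"
  proof (rule integral_mono)
    show "integrable M (\<lambda>x. \<bar>?w n x - ?w m x\<bar>)" using minimiser_integrable by simp
    show "integrable M (\<lambda>x. \<eta> + (64 * B ^ 3 / \<eta>) * hyp_gap (?w n x) (?w m x) +
        2 * B powr (1 - p) * (\<bar>?w n x\<bar> powr p + \<bar>?w m x\<bar> powr p))"
      by (intro Bochner_Integration.integrable_add integrable_mult_right gap pow integrable_const)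
  qed (rule abs_diff_le_hyp_gap[OF B \<eta> p])
  also have "\<dots> = \<eta> * measure M (space M) + (64 * B ^ 3 / \<eta>) * (LINT x|M. hyp_gap (?w n x) (?w m x))
      + 2 * B powr (1 - p) * (Lp_norm_pow M p (?w n) + Lp_norm_pow M p (?w m))"
    using gap pow[of n] pow[of m] by (simp add: Lp_norm_pow_def mult.commute)
  also have "2 * B powr (1 - p) * (Lp_norm_pow M p (?w n) + Lp_norm_pow M p (?w m)) \<le> 2 * B powr (1 - p) * (C + C)"
    by (intro mult_left_mono add_mono minimiser_bound) auto
  finally show ?thesis by (simp add: algebra_simps)
qed

lemma minimiser_Cauchy:
  assumes "e > 0"
  shows "\<exists>N. \<forall>n\<ge>N. \<forall>m\<ge>n. (LINT x|M. \<bar>minimiser n x - minimiser m x\<bar>) < e"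
proof -
  define V where "V = measure M (space M)"
  have V: "V \<ge> 0" by (simp add: V_def)
  define \<eta> where "\<eta> = e / 4 / (V + 1)"
  have \<eta>: "\<eta> > 0" using assms V by (simp add: \<eta>_def)
  have \<eta>V: "\<eta> * V \<le> e / 4" using assms V by (simp add: \<eta>_def field_simps)
  have "((\<lambda>B. 4 * C * B powr (1 - p)) \<longlongrightarrow> 4 * C * 0) at_top"
    using p by (intro tendsto_intros tendsto_neg_powr filterlim_ident) auto
  then have "\<forall>\<^sub>F B in at_top. 4 * C * B powr (1 - p) < e / 4"
    using assms by (intro order_tendstoD(2)[where y = 0]) auto
  from eventually_conj[OF this eventually_ge_at_top[of 1]]
  obtain B where B: "B \<ge> 1" "4 * C * B powr (1 - p) < e / 4"
    by (metis (mono_tags, lifting) eventually_happens trivial_limit_at_top_linorder)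
  define k where "k = 64 * B ^ 3 / \<eta>"
  have k: "k > 0" using B \<eta> by (simp add: k_def)
  have "(\<lambda>n. k * (((SUP n. level n) - level n) + 1 / real (Suc n)))
      \<longlonglongrightarrow> k * (((SUP n. level n) - (SUP n. level n)) + 0)"
    by (intro tendsto_intros level_tendsto LIMSEQ_Suc lim_1_over_n)
  then have "\<forall>\<^sub>F n in sequentially. k * (((SUP n. level n) - level n) + 1 / real (Suc n)) < e / 4"
    using assms by (intro order_tendstoD(2)[where y = 0]) auto
  then obtain N where N: "\<And>n. n \<ge> N \<Longrightarrow> k * (((SUP n. level n) - level n) + 1 / real (Suc n)) < e / 4"
    by (auto simp: eventually_sequentially)
  have "(LINT x|M. \<bar>minimiser n x - minimiser m x\<bar>) < e" if "N \<le> n" "n \<le> m" for n m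
  proof -
    have "k * (LINT x|M. hyp_gap (minimiser n x) (minimiser m x)) < e / 4"
      using mult_left_mono[OF integral_hyp_gap_minimiser_le[OF that(2)] less_imp_le[OF k]] N[OF that(1)]
      by linarith
    then show ?thesis
      using integral_abs_minimiser_diff_le[OF B(1) \<eta>, of n m] \<eta>V B(2) assms unfolding k_def V_def by linarith
  qed
  then show ?thesis by blast
qed

lemma midhull_functional_close:
  assumes b: "b \<in> borel_measurable M" "\<And>x. x \<in> space M \<Longrightarrow> \<bar>b x\<bar> \<le> B" "B \<ge> 0"
    and close: "\<And>j. j \<ge> n \<Longrightarrow> \<bar>(LINT x|M. u j x * b x) - L\<bar> \<le> \<eta>"
    and f: "midhull u n f"
  shows "\<bar>(LINT x|M. f x * b x) - L\<bar> \<le> \<eta>"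
  using f
proof (induction rule: midhull.induct)
  case (base j)
  then show ?case using close by simp
next
  case (mid f g)
  note int = integrable_mult_bounded[OF midhull_integrable b]
  have "(LINT x|M. (f x + g x) / 2 * b x) = (LINT x|M. (f x * b x + g x * b x) / 2)"
    by (simp add: algebra_simps add_divide_distrib)
  also have "\<dots> = ((LINT x|M. f x * b x) + (LINT x|M. g x * b x)) / 2"
    using int[OF mid.hyps(1)] int[OF mid.hyps(2)] by simp
  finally show ?case using mid.IH by (auto simp: abs_le_iff field_simps)
qed

lemma minimiser_functional_tendsto:
  assumes b: "b \<in> borel_measurable M" "\<And>x. x \<in> space M \<Longrightarrow> \<bar>b x\<bar> \<le> B" "B \<ge> 0"
    and L: "(\<lambda>j. LINT x|M. u j x * b x) \<longlonglongrightarrow> L"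
  shows "(\<lambda>n. LINT x|M. minimiser n x * b x) \<longlonglongrightarrow> L"
proof (rule LIMSEQ_I)
  fix e :: real assume "e > 0"
  then obtain j0 where j0: "\<And>j. j \<ge> j0 \<Longrightarrow> norm ((LINT x|M. u j x * b x) - L) < e / 2"
    using LIMSEQ_D[OF L, of "e/2"] by auto
  have "\<bar>(LINT x|M. minimiser n x * b x) - L\<bar> \<le> e / 2" if "n \<ge> j0" for n
    using j0 that by (intro midhull_functional_close[OF b _ midhull_minimiser]) (auto simp: less_imp_le)
  then show "\<exists>N. \<forall>n\<ge>N. norm ((LINT x|M. minimiser n x * b x) - L) < e"
    using \<open>e > 0\<close> by (intro exI[of _ j0]) fastforce
qed

theorem ex_weak_limit:
  obtains v where "Lp_fun M p v"
    "\<And>b B L. b \<in> borel_measurable M \<Longrightarrow> (\<And>x. x \<in> space M \<Longrightarrow> \<bar>b x\<bar> \<le> B) \<Longrightarrow> B \<ge> 0 \<Longrightarrow>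
       (\<lambda>j. LINT x|M. u j x * b x) \<longlonglongrightarrow> L \<Longrightarrow> (LINT x|M. v x * b x) = L"
proof -
  obtain r v h where r: "strict_mono r" and v: "v \<in> borel_measurable M" and h: "integrable M h"
    and lim: "AE x in M. (\<lambda>k. minimiser (r k) x) \<longlonglongrightarrow> v x" and le: "\<And>k. AE x in M. \<bar>minimiser (r k) x\<bar> \<le> h x"
    using L1_Cauchy_imp_AE_convergent_subseq[OF minimiser_integrable minimiser_Cauchy] by blast
  show thesis
  proof (rule that)
    show "Lp_fun M p v"
      using p by (intro Lp_fun_AE_limit[OF minimiser_Lp minimiser_bound lim v]) auto
    fix b B L assume b: "b \<in> borel_measurable M" "\<And>x. x \<in> space M \<Longrightarrow> \<bar>b x\<bar> \<le> B" "B \<ge> 0"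
      and L: "(\<lambda>j. LINT x|M. u j x * b x) \<longlonglongrightarrow> L"
    have "(\<lambda>k. LINT x|M. minimiser (r k) x * b x) \<longlonglongrightarrow> (LINT x|M. v x * b x)"
    proof (rule integral_dominated_convergence[where w = "\<lambda>x. h x * B"])
      note [measurable] = b(1) v borel_measurable_integrable[OF minimiser_integrable]
      show "(\<lambda>x. v x * b x) \<in> borel_measurable M" "(\<lambda>x. minimiser (r k) x * b x) \<in> borel_measurable M" for k
        by measurable
      show "integrable M (\<lambda>x. h x * B)" using h by simp
      show "AE x in M. (\<lambda>k. minimiser (r k) x * b x) \<longlonglongrightarrow> v x * b x"
        using lim by eventually_elim (intro tendsto_intros)
      show "AE x in M. norm (minimiser (r k) x * b x) \<le> h x * B" for k
        using le[of k] AE_space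
        by eventually_elim (use b in \<open>auto simp: abs_mult intro!: mult_mono\<close>)
    qed
    moreover have "(\<lambda>k. LINT x|M. minimiser (r k) x * b x) \<longlonglongrightarrow> L"
      using LIMSEQ_subseq_LIMSEQ[OF minimiser_functional_tendsto[OF b L] r] by (simp add: o_def)
    ultimately show "(LINT x|M. v x * b x) = L" by (rule LIMSEQ_unique)
  qed
qed

end

subsection \<open>Functions of a slow and a fast variable\<close>

lemma borel_measurable_lebesgue_on_cong_AE:
  fixes f g :: "'a::euclidean_space \<Rightarrow> 'b::real_normed_vector"
  assumes S: "S \<in> sets lebesgue" and g: "g \<in> borel_measurable (lebesgue_on S)"
    and eq: "AE x in lebesgue_on S. f x = g x"
  shows "f \<in> borel_measurable (lebesgue_on S)"
proof (rule measurableI)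
  fix A :: "'b set" assume "A \<in> sets borel"
  then have "g -` A \<inter> S \<in> sets (lebesgue_on S)" using measurable_sets[OF g] by simp
  then have preimage_g: "g -` A \<inter> S \<in> sets lebesgue" using S by (simp add: sets_restrict_space_iff)
  have "AE x in lebesgue. x \<in> S \<longrightarrow> f x = g x" using eq S by (simp add: AE_restrict_space_iff)
  then have "AE x in lebesgue. x \<in> g -` A \<inter> S \<longleftrightarrow> x \<in> f -` A \<inter> S" by eventually_elim auto
  from completion.in_sets_AE[OF this preimage_g] show "f -` A \<inter> space (lebesgue_on S) \<in> sets (lebesgue_on S)"
    using S by (simp add: sets_restrict_space_iff)
qed simp

lemma integral_lebesgue_on_cong_AE:
  fixes f g :: "'a::euclidean_space \<Rightarrow> 'b::{banach, second_countable_topology}"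
  assumes S: "S \<in> sets lebesgue" and eq: "AE x in lebesgue_on S. f x = g x"
  shows "integral\<^sup>L (lebesgue_on S) f = integral\<^sup>L (lebesgue_on S) g"
proof (cases "g \<in> borel_measurable (lebesgue_on S)")
  case True
  then show ?thesis using borel_measurable_lebesgue_on_cong_AE[OF S True eq] eq by (intro integral_cong_AE)
next
  case False
  have "AE x in lebesgue_on S. g x = f x" using eq by eventually_elim simp
  then have "f \<notin> borel_measurable (lebesgue_on S)"
    using False borel_measurable_lebesgue_on_cong_AE[OF S] by blast
  then show ?thesis using False by (metis borel_measurable_integrable not_integrable_integral_eq)
qed

lemma AE_lebesgue_on_unit_cell_iff:
  "(AE y in lebesgue_on unit_cell. P y) \<longleftrightarrow> (AE y in (cell_measure :: (real^'m) measure). P y)"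
  by (simp add: AE_restrict_space_iff AE_completion_iff)

lemma ex_borel_representative:
  fixes f :: "'a::euclidean_space \<Rightarrow> real^'n"
  assumes f: "f \<in> borel_measurable (lebesgue_on S)" and S: "S \<in> sets lebesgue"
  obtains g where "g \<in> borel_measurable borel" "AE x in lebesgue_on S. f x = g x"
proof -
  have "(\<lambda>x. indicator S x *\<^sub>R f x) \<in> borel_measurable lebesgue"
    using f S by (subst (asm) borel_measurable_restrict_space_iff) auto
  from borel_measurable_vec_nth[OF this]
  have "\<exists>g'\<in>borel_measurable lborel. AE x in lborel. (indicator S x *\<^sub>R f x) $ i = g' x" for i
    by (rule completion_ex_borel_measurable_real)
  then obtain g' where g': "\<And>i. g' i \<in> borel_measurable lborel"
      "\<And>i. AE x in lborel. (indicator S x *\<^sub>R f x) $ i = g' i x"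
    by metis
  show thesis
  proof
    show "(\<lambda>x. \<chi> i. g' i x) \<in> borel_measurable borel"
      by (rule borel_measurable_vecI) (use g'(1) in simp)
    have "AE x in lborel. \<forall>i. (indicator S x *\<^sub>R f x) $ i = g' i x"
      using g'(2) by (subst AE_all_countable) auto
    then have "AE x in lborel. x \<in> S \<longrightarrow> f x = (\<chi> i. g' i x)" by eventually_elim (auto simp: vec_eq_iff)
    then show "AE x in lebesgue_on S. f x = (\<chi> i. g' i x)"
      using S by (simp add: AE_restrict_space_iff AE_completion_iff)
  qed
qed

lemma continuous_on_apply_bcontfun_fun: "continuous_on UNIV (\<lambda>h. apply_bcontfun h y)"
  unfolding continuous_on_iff by (metis dist_bounded order.strict_trans1)

lemma cell_Jensen:
  assumes f: "Lp_fun cell_measure p f" and p: "p > 1"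
  shows "\<bar>LINT y|cell_measure. f y\<bar> powr p \<le> (LINT y|(cell_measure :: (real^'m) measure). \<bar>f y\<bar> powr p)"
proof -
  have "(LINT y|cell_measure. 1 * \<bar>f y\<bar>) powr p \<le> (LINT y|(cell_measure :: (real^'m) measure). 1 * \<bar>f y\<bar> powr p)"
    using Lp_fun_measurable[OF f] Lp_fun_integrable_powr[OF f] p by (intro weighted_Jensen_powr) auto
  moreover have "\<bar>LINT y|cell_measure. f y\<bar> powr p \<le> (LINT y|cell_measure. \<bar>f y\<bar>) powr p"
    using p by (intro powr_mono2 integral_abs_bound) auto
  ultimately show ?thesis by simp
qed

context oscillation
begin

abbreviation (input) S :: "((real^'n) \<times> (real^'m)) set" where "S \<equiv> \<Omega> \<times> unit_cell"

lemma S_borel: "S \<in> sets borel" and S_lebesgue: "S \<in> sets lebesgue"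
  using open_\<Omega> by (auto intro!: borel_Times sets_completionI_sets simp: borel_open)

lemma borel_measurable_PM:
  assumes "F \<in> borel_measurable borel"
  shows "F \<in> borel_measurable PM"
proof -
  have "(\<lambda>z. (fst z, snd z)) \<in> borel_measurable PM"
    by (intro borel_measurable_Pair measurable_snd_PM
      measurable_compose[OF measurable_fst borel_measurable_lebesgue_onI]) auto
  from measurable_compose[OF this assms] show ?thesis by simp
qed

lemma nn_integral_PM:
  assumes F [measurable]: "F \<in> borel_measurable borel"
  shows "(\<integral>\<^sup>+z. F z \<partial>PM) = (\<integral>\<^sup>+z. F z \<partial>lebesgue_on S)"
proof -
  have "(\<integral>\<^sup>+z. F z \<partial>PM) = (\<integral>\<^sup>+x. (\<integral>\<^sup>+y. F (x, y) \<partial>cell_measure) \<partial>MO)"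
    by (rule cell.nn_integral_fst[OF borel_measurable_PM[OF F], symmetric])
  also have "\<dots> = (\<integral>\<^sup>+x. (\<integral>\<^sup>+y. F (x, y) * indicator S (x, y) \<partial>lborel) \<partial>lborel)"
    using \<Omega>_lebesgue by (simp add: nn_integral_restrict_space nn_integral_completion)
      (auto simp: indicator_def intro!: nn_integral_cong)
  also have "\<dots> = (\<integral>\<^sup>+z. F z * indicator S z \<partial>(lborel \<Otimes>\<^sub>M lborel))"
    using S_borel by (intro lborel.nn_integral_fst) (simp add: lborel_prod)
  also have "\<dots> = (\<integral>\<^sup>+z. F z \<partial>lebesgue_on S)"
    using S_lebesgue by (simp add: lborel_prod nn_integral_restrict_space nn_integral_completion)
  finally show ?thesis .
qed

lemma AE_lebesgue_on_imp_PM: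
  assumes "AE z in lebesgue_on S. P z"
  shows "AE z in PM. P z"
proof -
  have "AE z in lborel. z \<in> S \<longrightarrow> P z"
    using assms S_lebesgue by (simp add: AE_restrict_space_iff AE_completion_iff)
  then obtain N where N: "\<And>z. z \<in> space lborel - N \<Longrightarrow> z \<in> S \<longrightarrow> P z" "N \<in> null_sets lborel"
    by (rule AE_E3) blast
  have [measurable]: "N \<in> sets borel" using N(2) by auto
  have "(\<integral>\<^sup>+z. indicator N z \<partial>PM) = (\<integral>\<^sup>+z. indicator N z * indicator S z \<partial>lborel)"
    using S_lebesgue by (subst nn_integral_PM) (simp_all add: nn_integral_restrict_space nn_integral_completion)
  also have "\<dots> \<le> (\<integral>\<^sup>+z. indicator N z \<partial>lborel)"
    by (intro nn_integral_mono) (simp add: indicator_def)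
  also have "\<dots> = 0" using N(2) by (auto simp: null_sets_def)
  finally have "(\<integral>\<^sup>+z. indicator N z \<partial>PM) = 0" by simp
  then have "AE z in PM. indicator N z = (0::ennreal)"
    by (subst (asm) nn_integral_0_iff_AE) (auto intro: borel_measurable_PM)
  then show ?thesis
    using AE_space by eventually_elim (use N(1) in \<open>auto simp: space_pair_measure indicator_def split: if_splits\<close>)
qed

lemma Lp_fun_PM_iff_lebesgue_on:
  assumes F: "F \<in> borel_measurable borel"
  shows "Lp_fun PM p F \<longleftrightarrow> Lp_fun (lebesgue_on S) p F"
proof -
  have "(\<lambda>z. norm (F z) powr p) \<in> borel_measurable borel"
    using borel_measurable_norm_of_measurable[OF F] by measurable
  then show ?thesis
    using F nn_integral_PM[of "\<lambda>z. ennreal (norm (F z) powr p)"]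
    by (auto simp: Lp_fun_def integrable_iff_bounded borel_measurable_PM borel_measurable_lebesgue_onI)
qed

lemma Lp_fun_lebesgue_on_representative:
  fixes v :: "(real^'n) \<times> (real^'m) \<Rightarrow> real^'k"
  assumes v: "Lp_fun (lebesgue_on S) p v"
  obtains w where "w \<in> borel_measurable borel" "Lp_fun PM p w" "AE z in lebesgue_on S. v z = w z"
proof -
  obtain w where w: "w \<in> borel_measurable borel" "AE z in lebesgue_on S. v z = w z"
    using ex_borel_representative[OF Lp_fun_measurable[OF v] S_lebesgue] .
  have "Lp_fun (lebesgue_on S) p w"
    using Lp_fun_cong_AE[OF borel_measurable_lebesgue_onI[OF w(1)] w(2) v] .
  then show thesis using w that Lp_fun_PM_iff_lebesgue_on by blast
qed

lemma AE_PM_slice: "AE z in PM. P z \<Longrightarrow> AE x in MO. AE y in cell_measure. P (x, y)"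
  by (rule slow_fast.AE_pair)

lemma AE_lebesgue_on_slice:
  "AE z in lebesgue_on S. P z \<Longrightarrow> AE x in MO. AE y in lebesgue_on unit_cell. P (x, y)"
  unfolding AE_lebesgue_on_unit_cell_iff by (intro AE_PM_slice AE_lebesgue_on_imp_PM)

lemma Lp_fun_PM_slice:
  fixes w :: "(real^'n) \<times> (real^'m) \<Rightarrow> 'b::real_normed_vector"
  assumes "Lp_fun PM p w"
  shows "AE x in MO. Lp_fun cell_measure p (\<lambda>y. w (x, y))"
  using slow_fast.AE_integrable_fst'[OF Lp_fun_integrable_powr[OF assms]] AE_space
  by eventually_elim (use measurable_Pair2[OF Lp_fun_measurable[OF assms]] in \<open>auto simp: Lp_fun_def\<close>)

lemma Lp_fun_fourier_moment:
  fixes w :: "(real^'n) \<times> (real^'m) \<Rightarrow> real"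
  assumes w: "Lp_fun PM p w" and p: "p > 1"
  shows "Lp_fun MO p (\<lambda>x. fourier_moment k a (\<lambda>y. w (x, y)))"
  unfolding Lp_fun_def
proof (intro conjI Bochner_Integration.integrable_bound[OF
    slow_fast.integrable_fst'[OF Lp_fun_integrable_powr[OF w]]])
  have "integrable PM (\<lambda>z. w z * harmonic k a (snd z))"
    using abs_wave_le_1 p Lp_fun_imp_integrable[OF finite_measure_PM w]
    by (intro integrable_mult_bounded[where B = 1] measurable_compose[OF measurable_snd_PM]
      borel_measurable_wave) auto
  from slow_fast.integrable_fst'[OF this]
  show meas: "(\<lambda>x. fourier_moment k a (\<lambda>y. w (x, y))) \<in> borel_measurable MO"
    by (simp add: fourier_moment_def mult.commute borel_measurable_integrable)
  then show "(\<lambda>x. norm (fourier_moment k a (\<lambda>y. w (x, y))) powr p) \<in> borel_measurable MO" by measurable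
  show "AE x in MO. norm (norm (fourier_moment k a (\<lambda>y. w (x, y))) powr p)
      \<le> norm (LINT y|cell_measure. norm (w (x, y)) powr p)"
    using Lp_fun_PM_slice[OF w]
  proof eventually_elim
    case (elim x)
    have le: "\<bar>harmonic k a y * w (x, y)\<bar> \<le> \<bar>w (x, y)\<bar>" for y
      using mult_right_mono[OF abs_wave_le_1 abs_ge_zero] by (simp add: abs_mult)
    have Lp: "Lp_fun cell_measure p (\<lambda>y. harmonic k a y * w (x, y))"
      using elim le p
      by (intro Lp_fun_mono[OF elim] borel_measurable_times Lp_fun_measurable cell_measurableI
        borel_measurable_wave) auto
    have "\<bar>fourier_moment k a (\<lambda>y. w (x, y))\<bar> powr p \<le> (LINT y|cell_measure. \<bar>harmonic k a y * w (x, y)\<bar> powr p)"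
      unfolding fourier_moment_def by (rule cell_Jensen[OF Lp p])
    also have "\<dots> \<le> (LINT y|cell_measure. \<bar>w (x, y)\<bar> powr p)"
      using Lp_fun_integrable_powr[OF Lp] Lp_fun_integrable_powr[OF elim] le p
      by (intro integral_mono powr_mono2) auto
    finally show ?case by simp
  qed
qed

end

subsection \<open>Two-scale pairings\<close>

locale oscillation_Lp = oscillation \<Omega> R eps
  for \<Omega> :: "(real^'n) set" and R :: "real^'n^'m" and eps :: "nat \<Rightarrow> real" +
  fixes p :: real
  assumes p: "p > 1"
begin

abbreviation (input) q :: real where "q \<equiv> p / (p - 1)"

lemma p_bounds: "p \<ge> 0" "p > 0" "p \<ge> 1" and q_bounds: "q \<ge> 0" "q > 0"
  using p by auto

lemma two_scale_test_measurable:
  fixes \<phi> :: "real^'n \<Rightarrow> (real^'m) \<Rightarrow>\<^sub>C (real^'n)"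
  assumes \<phi>: "two_scale_test \<Omega> q \<phi>" and X: "X \<in> M \<rightarrow>\<^sub>M MO" and Y: "Y \<in> borel_measurable M"
  shows "(\<lambda>z. apply_bcontfun (\<phi> (X z)) (Y z)) \<in> borel_measurable M"
proof (rule Caratheodory_measurable[where F = "\<lambda>z. apply_bcontfun (\<phi> (X z))" and g = Y, OF _ _ Y])
  have "\<phi> \<in> borel_measurable MO" using \<phi> by (simp add: two_scale_test_def Lp_fun_def)
  from measurable_compose[OF measurable_compose[OF X this]
      borel_measurable_continuous_onI[OF continuous_on_apply_bcontfun_fun]]
  show "(\<lambda>z. apply_bcontfun (\<phi> (X z)) y) \<in> borel_measurable M" for y .
  show "continuous_on UNIV (apply_bcontfun (\<phi> (X z)))" for z
    using apply_bcontfun[of "\<phi> (X z)"] by (simp add: bcontfun_def)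
qed

definition fast_pairing :: "nat \<Rightarrow> (real^'n \<Rightarrow> (real^'m) \<Rightarrow>\<^sub>C (real^'n)) \<Rightarrow> (real^'n \<Rightarrow> real^'n) \<Rightarrow> real" where
  "fast_pairing j \<phi> g = (LINT x|MO. g x \<bullet> apply_bcontfun (\<phi> x) (fast j x))"

definition limit_pairing :: "(real^'n \<Rightarrow> (real^'m) \<Rightarrow>\<^sub>C (real^'n)) \<Rightarrow> ((real^'n) \<times> (real^'m) \<Rightarrow> real^'n) \<Rightarrow> real" where
  "limit_pairing \<phi> w = (LINT z|PM. w z \<bullet> apply_bcontfun (\<phi> (fst z)) (snd z))"

definition two_scale_limit :: "(nat \<Rightarrow> real^'n \<Rightarrow> real^'n) \<Rightarrow> ((real^'n) \<times> (real^'m) \<Rightarrow> real^'n) \<Rightarrow> bool" where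
  "two_scale_limit g w \<longleftrightarrow>
     (\<forall>\<phi>. two_scale_test \<Omega> q \<phi> \<longrightarrow> (\<lambda>j. fast_pairing j \<phi> (g j)) \<longlonglongrightarrow> limit_pairing \<phi> w)"

context
  fixes \<phi> :: "real^'n \<Rightarrow> (real^'m) \<Rightarrow>\<^sub>C (real^'n)"
  assumes \<phi>: "two_scale_test \<Omega> q \<phi>"
begin

lemma two_scale_test_Lp: "Lp_fun MO q \<phi>" and two_scale_test_periodic: "periodic_cell (apply_bcontfun (\<phi> x))"
  using \<phi> by (auto simp: two_scale_test_def)

lemma
  shows two_scale_test_fast_Lp: "Lp_fun MO q (\<lambda>x. apply_bcontfun (\<phi> x) (fast j x))"
    and two_scale_test_fast_le: "Lp_norm_pow MO q (\<lambda>x. apply_bcontfun (\<phi> x) (fast j x)) \<le> Lp_norm_pow MO q \<phi>"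
  using Lp_fun_mono[OF two_scale_test_Lp, of "\<lambda>x. apply_bcontfun (\<phi> x) (fast j x)"]
    Lp_norm_pow_mono[OF two_scale_test_Lp, of "\<lambda>x. apply_bcontfun (\<phi> x) (fast j x)"]
    two_scale_test_measurable[OF \<phi> measurable_ident fast_measurable] norm_bounded q_bounds by auto

lemma
  shows two_scale_test_PM_Lp: "Lp_fun PM q (\<lambda>z. apply_bcontfun (\<phi> (fst z)) (snd z))"
    and two_scale_test_PM_le: "Lp_norm_pow PM q (\<lambda>z. apply_bcontfun (\<phi> (fst z)) (snd z)) \<le> Lp_norm_pow MO q \<phi>"
  using Lp_fun_mono[OF Lp_fun_PM_fst[OF two_scale_test_Lp], of "\<lambda>z. apply_bcontfun (\<phi> (fst z)) (snd z)"]
    Lp_norm_pow_mono[OF Lp_fun_PM_fst[OF two_scale_test_Lp], of "\<lambda>z. apply_bcontfun (\<phi> (fst z)) (snd z)"]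
    two_scale_test_measurable[OF \<phi> measurable_fst measurable_snd_PM] norm_bounded q_bounds
  by (auto simp: Lp_norm_pow_PM_fst[OF two_scale_test_Lp])

lemmas fast_pairing_integrable = Lp_fun_inner_integrable[OF _ two_scale_test_fast_Lp p conjugate_exponent[OF p]]

lemmas limit_pairing_integrable = Lp_fun_inner_integrable[OF _ two_scale_test_PM_Lp p conjugate_exponent[OF p]]

lemma fast_pairing_le:
  assumes "Lp_fun MO p g"
  shows "\<bar>fast_pairing j \<phi> g\<bar> \<le> Lp_norm_pow MO p g powr (1 / p) * Lp_norm_pow MO q \<phi> powr (1 / q)"
proof -
  have "Lp_norm_pow MO q (\<lambda>x. apply_bcontfun (\<phi> x) (fast j x)) powr (1 / q) \<le> Lp_norm_pow MO q \<phi> powr (1 / q)"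
    using p q_bounds by (intro powr_mono2 two_scale_test_fast_le Lp_norm_pow_nonneg) auto
  from mult_left_mono[OF this powr_ge_zero[of "Lp_norm_pow MO p g" "1 / p"]]
  show ?thesis
    using Holder_integral_inner_le[OF assms two_scale_test_fast_Lp[of j] p conjugate_exponent[OF p]]
    unfolding fast_pairing_def by linarith
qed

lemma limit_pairing_le:
  assumes "Lp_fun PM p w"
  shows "\<bar>limit_pairing \<phi> w\<bar> \<le> Lp_norm_pow PM p w powr (1 / p) * Lp_norm_pow MO q \<phi> powr (1 / q)"
proof -
  have "Lp_norm_pow PM q (\<lambda>z. apply_bcontfun (\<phi> (fst z)) (snd z)) powr (1 / q) \<le> Lp_norm_pow MO q \<phi> powr (1 / q)"
    using p q_bounds by (intro powr_mono2 two_scale_test_PM_le Lp_norm_pow_nonneg) auto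
  from mult_left_mono[OF this powr_ge_zero[of "Lp_norm_pow PM p w" "1 / p"]]
  show ?thesis
    using Holder_integral_inner_le[OF assms two_scale_test_PM_Lp p conjugate_exponent[OF p]]
    unfolding limit_pairing_def by linarith
qed

lemma
  assumes "Lp_fun MO p f" "Lp_fun MO p g"
  shows fast_pairing_add: "fast_pairing j \<phi> (\<lambda>x. f x + g x) = fast_pairing j \<phi> f + fast_pairing j \<phi> g"
    and fast_pairing_diff: "fast_pairing j \<phi> (\<lambda>x. f x - g x) = fast_pairing j \<phi> f - fast_pairing j \<phi> g"
  using fast_pairing_integrable[OF assms(1)] fast_pairing_integrable[OF assms(2)]
  by (simp_all add: fast_pairing_def inner_add_left inner_diff_left)

lemma
  assumes "Lp_fun PM p v" "Lp_fun PM p w"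
  shows limit_pairing_add: "limit_pairing \<phi> (\<lambda>z. v z + w z) = limit_pairing \<phi> v + limit_pairing \<phi> w"
    and limit_pairing_diff: "limit_pairing \<phi> (\<lambda>z. v z - w z) = limit_pairing \<phi> v - limit_pairing \<phi> w"
  using limit_pairing_integrable[OF assms(1)] limit_pairing_integrable[OF assms(2)]
  by (simp_all add: limit_pairing_def inner_add_left inner_diff_left)

lemma mean_value_pairing:
  assumes W: "\<And>y. (\<lambda>x. W (x, y)) \<in> borel_measurable MO" "\<And>x. x \<in> \<Omega> \<Longrightarrow> continuous_on UNIV (\<lambda>y. W (x, y))"
      "\<And>x. x \<in> \<Omega> \<Longrightarrow> periodic_cell (\<lambda>y. W (x, y))" "\<And>x y. x \<in> \<Omega> \<Longrightarrow> norm (W (x, y)) \<le> norm (h x)"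
    and h: "Lp_fun MO p h"
  shows "(\<lambda>j. fast_pairing j \<phi> (\<lambda>x. W (x, fast j x))) \<longlonglongrightarrow> limit_pairing \<phi> W"
proof -
  have "caratheodory (\<lambda>z. W z \<bullet> apply_bcontfun (\<phi> (fst z)) (snd z)) (\<lambda>x. norm (h x) * norm (\<phi> x))"
    unfolding caratheodory_def
  proof (intro conjI allI ballI)
    fix x y assume x: "x \<in> \<Omega>"
    have cont: "continuous_on UNIV (apply_bcontfun (\<phi> x))"
      using apply_bcontfun[of "\<phi> x"] by (simp add: bcontfun_def)
    then show "continuous_on UNIV (\<lambda>y. W (x, y) \<bullet> apply_bcontfun (\<phi> (fst (x, y))) (snd (x, y)))"
      using W(2)[OF x] by (simp add: continuous_on_inner)
    show "periodic_cell (\<lambda>y. W (x, y) \<bullet> apply_bcontfun (\<phi> (fst (x, y))) (snd (x, y)))"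
      using W(3)[OF x] two_scale_test_periodic[of x] by (simp add: periodic_cell_def)
    have "\<bar>W (x, y) \<bullet> apply_bcontfun (\<phi> x) y\<bar> \<le> norm (W (x, y)) * norm (apply_bcontfun (\<phi> x) y)"
      by (rule Cauchy_Schwarz_ineq2)
    also have "\<dots> \<le> norm (h x) * norm (\<phi> x)" using x by (intro mult_mono W(4) norm_bounded) auto
    finally show "\<bar>W (x, y) \<bullet> apply_bcontfun (\<phi> (fst (x, y))) (snd (x, y))\<bar> \<le> norm (h x) * norm (\<phi> x)" by simp
  next
    show "(\<lambda>x. W (x, y) \<bullet> apply_bcontfun (\<phi> (fst (x, y))) (snd (x, y))) \<in> borel_measurable MO" for y
      using two_scale_test_measurable[OF \<phi> measurable_ident borel_measurable_const[of y]] W(1) by simp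
    show "integrable MO (\<lambda>x. norm (h x) * norm (\<phi> x))"
      by (rule Lp_fun_mult_integrable[OF h two_scale_test_Lp p conjugate_exponent[OF p]])
  qed
  from mean_value_tendsto[OF this] show ?thesis by (simp add: fast_pairing_def limit_pairing_def)
qed

end

lemma two_scale_limit_add:
  assumes "two_scale_limit f v" "two_scale_limit g w" "Lp_fun PM p v" "Lp_fun PM p w"
    and "\<And>j. Lp_fun MO p (f j)" "\<And>j. Lp_fun MO p (g j)"
  shows "two_scale_limit (\<lambda>j x. f j x + g j x) (\<lambda>z. v z + w z)"
  using assms unfolding two_scale_limit_def by (simp add: fast_pairing_add limit_pairing_add tendsto_add)

lemma two_scale_limit_const:
  assumes "Lp_fun MO p g"
  shows "two_scale_limit (\<lambda>j. g) (\<lambda>z. g (fst z))"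
  unfolding two_scale_limit_def
  using mean_value_pairing[of _ "\<lambda>z. g (fst z)" g] assms
  by (simp add: Lp_fun_measurable periodic_cell_def)

lemma R_two_scale_conv_iff_two_scale_limit:
  assumes w: "Lp_fun PM p w" and v: "AE x in MO. AE y in lebesgue_on unit_cell. v x y = w (x, y)"
  shows "R_two_scale_conv \<Omega> p R eps g v \<longleftrightarrow> two_scale_limit g w"
proof -
  have "(LINT x|MO. LINT y|lebesgue_on unit_cell. v x y \<bullet> apply_bcontfun (\<phi> x) y) = limit_pairing \<phi> w"
    if \<phi>: "two_scale_test \<Omega> q \<phi>" for \<phi>
  proof -
    have "AE x in MO. (LINT y|lebesgue_on unit_cell. v x y \<bullet> apply_bcontfun (\<phi> x) y)
        = (LINT y|cell_measure. w (x, y) \<bullet> apply_bcontfun (\<phi> x) y)"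
      using v AE_space
    proof eventually_elim
      case (elim x)
      have "(\<lambda>y. w (x, y) \<bullet> apply_bcontfun (\<phi> x) y) \<in> borel_measurable cell_measure"
        using measurable_Pair2[OF borel_measurable_integrable[OF limit_pairing_integrable[OF \<phi> w]], of x] elim(2)
        by simp
      note integral_lebesgue_on_cell[OF this, symmetric]
      moreover have "(LINT y|lebesgue_on unit_cell. v x y \<bullet> apply_bcontfun (\<phi> x) y)
          = (LINT y|lebesgue_on unit_cell. w (x, y) \<bullet> apply_bcontfun (\<phi> x) y)"
        using elim(1) by (intro integral_lebesgue_on_cong_AE) (auto elim!: eventually_mono)
      ultimately show ?case by simp
    qed
    then have "(LINT x|MO. LINT y|lebesgue_on unit_cell. v x y \<bullet> apply_bcontfun (\<phi> x) y)
        = (LINT x|MO. LINT y|cell_measure. w (x, y) \<bullet> apply_bcontfun (\<phi> x) y)"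
      by (rule integral_lebesgue_on_cong_AE[OF \<Omega>_lebesgue])
    also have "\<dots> = limit_pairing \<phi> w"
      using slow_fast.integral_fst'[OF limit_pairing_integrable[OF \<phi> w]] by (simp add: limit_pairing_def)
    finally show ?thesis .
  qed
  then show ?thesis
    unfolding R_two_scale_conv_def two_scale_limit_def fast_pairing_def fast_def by simp
qed

end

subsection \<open>Sobolev functions\<close>

lemma integrable_imp_locally_integrable_on:
  fixes f :: "real^'n \<Rightarrow> 'b::{banach, second_countable_topology}"
  assumes "integrable (lebesgue_on U) f" "U \<in> sets lebesgue"
  shows "locally_integrable_on U f"
  unfolding locally_integrable_on_def
proof (intro allI impI)
  fix K assume K: "compact K \<and> K \<subseteq> U"
  then have K_sets: "K \<in> sets lebesgue" by (auto intro: lmeasurable_compact fmeasurableD)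
  have "set_integrable lebesgue U f"
    using assms by (simp add: set_integrable_def integrable_restrict_space)
  then have "set_integrable lebesgue K f" by (rule set_integrable_subset) (use K K_sets in auto)
  then show "integrable (lebesgue_on K) f"
    using K_sets by (simp add: set_integrable_def integrable_restrict_space)
qed

lemma W1p_norm_pow_eq: "W1p_norm_pow U p u g = Lp_norm_pow (lebesgue_on U) p u + Lp_norm_pow (lebesgue_on U) p g"
  by (simp add: W1p_norm_pow_def Lp_norm_pow_def)

lemma W1pI:
  assumes U: "open U" "bounded U" and p: "p \<ge> 1" and u: "Lp_fun (lebesgue_on U) p u"
    and g: "Lp_fun (lebesgue_on U) p g"
    and parts: "\<And>i \<phi>. test_fun U \<phi> \<Longrightarrow>
      (LINT x|lebesgue_on U. u x * partial_deriv i \<phi> x) = - (LINT x|lebesgue_on U. g x $ i * \<phi> x)"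
  shows "W1p U p u g"
  unfolding W1p_def weak_gradient_def
proof (intro conjI allI impI)
  show "locally_integrable_on U u" "locally_integrable_on U g"
    using U p u g by (intro integrable_imp_locally_integrable_on Lp_fun_imp_integrable
      finite_measure_lebesgue_on_open; auto)+
qed (use u g parts in auto)

lemma W1p_integral_by_parts:
  "W1p U p u g \<Longrightarrow> test_fun U \<phi> \<Longrightarrow>
    (LINT x|lebesgue_on U. u x * partial_deriv i \<phi> x) = - (LINT x|lebesgue_on U. g x $ i * \<phi> x)"
  by (auto simp: W1p_def weak_gradient_def)

lemma integrable_mult_test_fun:
  assumes f: "integrable (lebesgue_on U) f" and \<phi>: "test_fun V \<phi>"
  shows "integrable (lebesgue_on U) (\<lambda>x. f x * \<phi> x)"
proof -
  obtain B where "B > 0" "\<And>x. \<bar>\<phi> x\<bar> \<le> B" using test_fun_bounded[OF \<phi>] by blast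
  then show ?thesis
    by (intro integrable_mult_bounded[where B = B] f borel_measurable_lebesgue_onI
      test_fun_borel_measurable[OF \<phi>]) auto
qed

lemma W1p_add:
  assumes U: "open U" "bounded U" and p: "p \<ge> 1" and W: "W1p U p u g" "W1p U p v h"
  shows "W1p U p (\<lambda>x. u x + v x) (\<lambda>x. g x + h x)"
proof (rule W1pI[OF U p])
  have Lp: "Lp_fun (lebesgue_on U) p u" "Lp_fun (lebesgue_on U) p v"
    "Lp_fun (lebesgue_on U) p g" "Lp_fun (lebesgue_on U) p h"
    using W by (auto simp: W1p_def)
  show "Lp_fun (lebesgue_on U) p (\<lambda>x. u x + v x)" "Lp_fun (lebesgue_on U) p (\<lambda>x. g x + h x)"
    using p by (intro Lp_fun_add Lp; simp)+
  fix i \<phi> assume \<phi>: "test_fun U \<phi>"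
  have int: "integrable (lebesgue_on U) (\<lambda>x. f x * \<psi> x)"
    if "Lp_fun (lebesgue_on U) p f" "test_fun U \<psi>" for f :: "real^'a \<Rightarrow> real" and \<psi>
    by (rule integrable_mult_test_fun[OF
      Lp_fun_imp_integrable[OF finite_measure_lebesgue_on_open[OF U] that(1) p] that(2)])
  have "Lp_fun (lebesgue_on U) p (\<lambda>x. g x $ i)" "Lp_fun (lebesgue_on U) p (\<lambda>x. h x $ i)"
    using p by (intro Lp_fun_vec_nth Lp; simp)+
  then show "(LINT x|lebesgue_on U. (u x + v x) * partial_deriv i \<phi> x) =
      - (LINT x|lebesgue_on U. (g x + h x) $ i * \<phi> x)"
    using int Lp(1,2) \<phi> test_fun_partial_deriv[OF \<phi>, of i]
    by (simp add: distrib_right W1p_integral_by_parts[OF W(1) \<phi>] W1p_integral_by_parts[OF W(2) \<phi>])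
qed

lemma integral_mult_wave_test_fun_le:
  assumes f: "integrable (lebesgue_on U) f" and \<psi>: "test_fun V \<psi>" and B: "\<And>x. \<bar>\<psi> x\<bar> \<le> B"
  shows "\<bar>LINT x|lebesgue_on U. f x * (wave r a x * \<psi> x)\<bar> \<le> B * (LINT x|lebesgue_on U. \<bar>f x\<bar>)"
proof (rule integral_mult_bounded_le[OF f])
  show "\<bar>wave r a x * \<psi> x\<bar> \<le> B" for x
    using mult_mono[OF abs_wave_le_1[of r a x] B[of x]] by (simp add: abs_mult)
  show "B \<ge> 0" using order.trans[OF abs_ge_zero B] .
qed (intro borel_measurable_times borel_measurable_lebesgue_onI borel_measurable_wave
    test_fun_borel_measurable[OF \<psi>])

lemma W1p_integral_by_parts_wave:
  assumes W: "W1p U p u g" and u: "integrable (lebesgue_on U) u" and \<psi>: "test_fun U \<psi>"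
  shows "(LINT x|lebesgue_on U. g x $ i * (wave r a x * \<psi> x)) =
    - (LINT x|lebesgue_on U. u x * (wave r a x * partial_deriv i \<psi> x))
    - r $ i * (LINT x|lebesgue_on U. u x * (wave r (a + pi / 2) x * \<psi> x))"
proof -
  have "partial_deriv i (\<lambda>x. wave r a x * \<psi> x) x =
      wave r a x * partial_deriv i \<psi> x + r $ i * (wave r (a + pi / 2) x * \<psi> x)" for x
    using smooth_fun_differentiable[OF smooth_fun_wave] test_fun_differentiable[OF \<psi>]
    by (subst partial_deriv_mult) (auto simp: partial_deriv_wave)
  then have "(LINT x|lebesgue_on U. g x $ i * (wave r a x * \<psi> x)) =
      - (LINT x|lebesgue_on U. u x * (wave r a x * partial_deriv i \<psi> x) +
          r $ i * (u x * (wave r (a + pi / 2) x * \<psi> x)))"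
    using W1p_integral_by_parts[OF W test_fun_smooth_mult[OF smooth_fun_wave \<psi>], of i r a]
    by (simp add: algebra_simps)
  then show ?thesis
    using integrable_mult_test_fun[OF u test_fun_smooth_mult[OF smooth_fun_wave \<psi>]]
      integrable_mult_test_fun[OF u test_fun_smooth_mult[OF smooth_fun_wave test_fun_partial_deriv[OF \<psi>]]] by simp
qed

subsection \<open>Fourier coefficients on the cell\<close>

lemma Lp_fun_inner_const:
  fixes f :: "'a \<Rightarrow> 'b::euclidean_space"
  assumes f: "Lp_fun M p f" and p: "p \<ge> 0"
  shows "Lp_fun M p (\<lambda>x. f x \<bullet> \<xi>)"
proof (rule Lp_fun_mono[OF Lp_fun_scaleR[OF f, of "norm \<xi>"] _ _ p])
  show "(\<lambda>x. f x \<bullet> \<xi>) \<in> borel_measurable M" using Lp_fun_measurable[OF f] by measurable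
  show "AE x in M. norm (f x \<bullet> \<xi>) \<le> norm (norm \<xi> *\<^sub>R f x)"
    using Cauchy_Schwarz_ineq2[of _ \<xi>] by (intro AE_I2) (simp add: mult.commute[of "norm \<xi>"])
qed

lemma fourier_moment_diff:
  assumes "integrable cell_measure f" "integrable cell_measure g"
  shows "fourier_moment k a (\<lambda>y. f y - g y) = fourier_moment k a f - fourier_moment k a g"
  using integrable_wave_mult[OF assms(1)] integrable_wave_mult[OF assms(2)]
  by (simp add: fourier_moment_def right_diff_distrib)

lemma fourier_moment_cmult: "fourier_moment k a (\<lambda>y. c * f y) = c * fourier_moment k a f"
  by (simp add: fourier_moment_def mult.left_commute)

lemma fourier_moment_inner:
  fixes w :: "real^'m \<Rightarrow> real^'n"
  assumes "\<And>i. integrable cell_measure (\<lambda>y. w y $ i)"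
  shows "fourier_moment k a (\<lambda>y. w y \<bullet> \<xi>) = (\<Sum>i\<in>UNIV. fourier_moment k a (\<lambda>y. w y $ i) * \<xi> $ i)"
  using integrable_wave_mult[OF assms]
  by (simp add: fourier_moment_def inner_vec_def sum_distrib_left mult.assoc[symmetric])

lemma fourier_moment_const:
  "int_vec k \<Longrightarrow> fourier_moment k a (\<lambda>y. c) = (if k = 0 then c * cos a else 0)"
  by (simp add: fourier_moment_def cell_integral_harmonic)

lemma fourier_coeff_eq_moments:
  fixes w :: "real^'m \<Rightarrow> real^'n"
  assumes w: "\<And>i. integrable cell_measure (\<lambda>y. w y $ i)"
  shows "fourier_coeff w k $ i =
      Complex (fourier_moment k 0 (\<lambda>y. w y $ i)) (- fourier_moment k (- (pi / 2)) (\<lambda>y. w y $ i))"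
proof -
  let ?f = "\<lambda>y. complex_of_real (w y $ i) * exp (- (2 * pi * \<i>) * complex_of_real (k \<bullet> y))"
  let ?re = "\<lambda>y. harmonic k 0 y * w y $ i" and ?im = "\<lambda>y. harmonic k (- (pi / 2)) y * w y $ i"
  have f_eq: "?f y = complex_of_real (?re y) - \<i> * complex_of_real (?im y)" for y
  proof -
    have "exp (- (2 * pi * \<i>) * complex_of_real (k \<bullet> y)) = cis (- (2 * pi * (k \<bullet> y)))"
      unfolding cis_conv_exp by (simp add: mult_ac)
    moreover have "cos (2 * pi * (k \<bullet> y) - pi / 2) = sin (2 * pi * (k \<bullet> y))" by (simp add: cos_diff)
    ultimately show ?thesis by (simp add: wave_def complex_eq_iff)
  qed
  note int = integrable_wave_mult[OF w, of "(2 * pi) *\<^sub>R k" _ i]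
  have "?f \<in> borel_measurable cell_measure"
    unfolding f_eq using borel_measurable_integrable[OF int[of 0]]
      borel_measurable_integrable[OF int[of "- (pi / 2)"]]
    by measurable
  then have "fourier_coeff w k $ i = (LINT y|cell_measure. ?f y)"
    unfolding fourier_coeff_def vec_lambda_beta by (rule integral_lebesgue_on_cell)
  also have "\<dots> = (LINT y|cell_measure. complex_of_real (?re y)) -
      (LINT y|cell_measure. \<i> * complex_of_real (?im y))"
    unfolding f_eq by (intro Bochner_Integration.integral_diff integrable_mult_right integrable_of_real int)
  also have "\<dots> = complex_of_real (fourier_moment k 0 (\<lambda>y. w y $ i)) -
      \<i> * complex_of_real (fourier_moment k (- (pi / 2)) (\<lambda>y. w y $ i))"
    unfolding fourier_moment_def by (simp only: integral_mult_right_zero integral_complex_of_real)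
  finally show ?thesis by (simp add: complex_eq_iff)
qed

lemma Lp_fun_lebesgue_on_cell_iff:
  fixes f :: "real^'m \<Rightarrow> 'b::{banach, second_countable_topology}"
  assumes f: "f \<in> borel_measurable cell_measure"
  shows "Lp_fun (lebesgue_on unit_cell) p f \<longleftrightarrow> Lp_fun cell_measure p f"
proof -
  have "(\<lambda>y. norm (f y) powr p) \<in> borel_measurable cell_measure"
    using borel_measurable_norm_of_measurable[OF f] by measurable
  from integrable_lebesgue_on_cell[OF this] measurable_lebesgue_on_cell[OF f] f show ?thesis
    by (simp add: Lp_fun_def)
qed

definition gradient_moments :: "real^'n^'m \<Rightarrow> (real^'m \<Rightarrow> real^'n) \<Rightarrow> bool" where
  "gradient_moments R w \<longleftrightarrow> (\<forall>k. int_vec k \<longrightarrow> (\<forall>a\<in>{0, - (pi / 2)}.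
     \<exists>c. \<forall>i. fourier_moment k a (\<lambda>y. w y $ i) = c * (transpose R *v k) $ i))"

lemma gradient_moments_iff_fourier_coeff:
  fixes w :: "real^'m \<Rightarrow> real^'n"
  assumes w: "\<And>i. integrable cell_measure (\<lambda>y. w y $ i)"
  shows "gradient_moments R w \<longleftrightarrow> (\<exists>lam::real^'m \<Rightarrow> complex. lam 0 = 0 \<and>
    (\<forall>k. int_vec k \<longrightarrow> fourier_coeff w k = (\<chi> i. lam k * complex_of_real ((transpose R *v k) $ i))))"
proof
  assume "gradient_moments R w"
  then obtain c where c: "\<And>k a i. int_vec k \<Longrightarrow> a \<in> {0, - (pi / 2)} \<Longrightarrow>
      fourier_moment k a (\<lambda>y. w y $ i) = c k a * (transpose R *v k) $ i"
    unfolding gradient_moments_def by metis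
  define lam where "lam k = (if k = 0 then 0 else Complex (c k 0) (- c k (- (pi / 2))))" for k
  have "fourier_coeff w k = (\<chi> i. lam k * complex_of_real ((transpose R *v k) $ i))" if "int_vec k" for k
  proof (cases "k = 0")
    case True
    show ?thesis
      using c[OF that] unfolding True by (simp add: vec_eq_iff fourier_coeff_eq_moments[OF w] complex_eq_iff)
  next
    case False
    then show ?thesis
      using c[OF that] by (simp add: vec_eq_iff[of "fourier_coeff w k"] fourier_coeff_eq_moments[OF w] lam_def
        complex_eq_iff)
  qed
  then show "\<exists>lam::real^'m \<Rightarrow> complex. lam 0 = 0 \<and>
      (\<forall>k. int_vec k \<longrightarrow> fourier_coeff w k = (\<chi> i. lam k * complex_of_real ((transpose R *v k) $ i)))"
    by (intro exI[of _ lam]) (simp add: lam_def)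
next
  assume "\<exists>lam::real^'m \<Rightarrow> complex. lam 0 = 0 \<and>
      (\<forall>k. int_vec k \<longrightarrow> fourier_coeff w k = (\<chi> i. lam k * complex_of_real ((transpose R *v k) $ i)))"
  then obtain lam :: "real^'m \<Rightarrow> complex" where
    "\<And>k. int_vec k \<Longrightarrow> fourier_coeff w k = (\<chi> i. lam k * complex_of_real ((transpose R *v k) $ i))"
    by blast
  then have lam: "fourier_coeff w k $ i = lam k * complex_of_real ((transpose R *v k) $ i)" if "int_vec k" for k i
    using that by simp
  have "fourier_moment k 0 (\<lambda>y. w y $ i) = Re (lam k) * (transpose R *v k) $ i"
    "fourier_moment k (- (pi / 2)) (\<lambda>y. w y $ i) = - Im (lam k) * (transpose R *v k) $ i" if "int_vec k" for k i
    using lam[OF that, of i] by (simp_all add: fourier_coeff_eq_moments[OF w] complex_eq_iff)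
  then show "gradient_moments R w" unfolding gradient_moments_def by blast
qed

lemma gradient_moments_diff_mean:
  fixes w :: "real^'m \<Rightarrow> real^'n"
  assumes w: "\<And>i. integrable cell_measure (\<lambda>y. w y $ i)"
    and parallel: "\<And>k a. int_vec k \<Longrightarrow> k \<noteq> 0 \<Longrightarrow> a \<in> {0, - (pi / 2)} \<Longrightarrow>
      \<exists>c. \<forall>i. fourier_moment k a (\<lambda>y. w y $ i) = c * (transpose R *v k) $ i"
    and v: "\<And>y. y \<in> unit_cell \<Longrightarrow> v y = w y - (\<chi> i. fourier_moment 0 0 (\<lambda>y. w y $ i))"
  shows "gradient_moments R v"
proof -
  have v_moment: "fourier_moment k a (\<lambda>y. v y $ i) =
      fourier_moment k a (\<lambda>y. w y $ i) - (if k = 0 then fourier_moment 0 0 (\<lambda>y. w y $ i) * cos a else 0)"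
    if "int_vec k" for k a i
  proof -
    have "fourier_moment k a (\<lambda>y. v y $ i) = fourier_moment k a (\<lambda>y. w y $ i - fourier_moment 0 0 (\<lambda>y. w y $ i))"
      unfolding fourier_moment_def
      by (intro Bochner_Integration.integral_cong) (simp_all add: v fourier_moment_def)
    then show ?thesis using w that by (simp add: fourier_moment_diff fourier_moment_const)
  qed
  have moment_0: "fourier_moment 0 (- (pi / 2)) f = 0" for f :: "real^'m \<Rightarrow> real"
    by (simp add: fourier_moment_def wave_def)
  show ?thesis
    unfolding gradient_moments_def
  proof (intro allI impI ballI)
    fix k :: "real^'m" and a :: real assume k: "int_vec k" and a: "a \<in> {0, - (pi / 2)}"
    show "\<exists>c. \<forall>i. fourier_moment k a (\<lambda>y. v y $ i) = c * (transpose R *v k) $ i"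
    proof (cases "k = 0")
      case True
      then have "fourier_moment k a (\<lambda>y. v y $ i) = 0" for i
        using v_moment[OF k, of a i] moment_0 a by auto
      then show ?thesis by (intro exI[of _ 0]) simp
    next
      case False
      then show ?thesis using v_moment[OF k] parallel[OF k False a] by simp
    qed
  qed
qed

definition frac_vec :: "real^'m \<Rightarrow> real^'m" where
  "frac_vec y = (\<chi> i. frac (y $ i))"

lemma frac_vec_unit_cell: "y \<in> unit_cell \<Longrightarrow> frac_vec y = y"
  by (auto simp: frac_vec_def unit_cell_def vec_eq_iff frac_eq)

lemma frac_vec_measurable: "frac_vec \<in> borel_measurable borel"
  by (rule borel_measurable_vecI)
     (use borel_measurable_vec_nth[of "\<lambda>y. y" borel] in \<open>simp add: frac_vec_def frac_def\<close>)

lemma frac_vec_periodic: "int_vec k \<Longrightarrow> frac_vec (y + k) = frac_vec y"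
  unfolding frac_vec_def int_vec_def frac_def by (auto simp: vec_eq_iff elim!: Ints_cases allE)

subsection \<open>Two-scale limits of gradients\<close>

context oscillation_Lp
begin

lemma
  fixes w :: "(real^'n) \<times> (real^'m) \<Rightarrow> real^'k"
  assumes w: "Lp_fun PM p w"
  shows slice_component_Lp: "AE x in MO. \<forall>i. Lp_fun cell_measure p (\<lambda>y. w (x, y) $ i)"
    and slice_component_integrable: "AE x in MO. \<forall>i. integrable cell_measure (\<lambda>y. w (x, y) $ i)"
proof -
  show Lp: "AE x in MO. \<forall>i. Lp_fun cell_measure p (\<lambda>y. w (x, y) $ i)"
    using Lp_fun_PM_slice[OF w] by eventually_elim (simp add: Lp_fun_vec_nth p_bounds)
  show "AE x in MO. \<forall>i. integrable cell_measure (\<lambda>y. w (x, y) $ i)"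
    using Lp by eventually_elim (blast intro: Lp_fun_imp_integrable[OF cell.finite_measure_axioms _ p_bounds(3)])
qed

lemma ex_product_test:
  fixes f :: "real^'m \<Rightarrow> real" and \<xi> :: "real^'n"
  assumes \<psi>: "test_fun \<Omega> \<psi>" and f: "continuous_on UNIV f" "\<And>y. \<bar>f y\<bar> \<le> 1" "periodic_cell f"
  obtains \<phi> where "two_scale_test \<Omega> q \<phi>" "\<And>x y. apply_bcontfun (\<phi> x) y = (\<psi> x * f y) *\<^sub>R \<xi>"
proof -
  define h where "h = Bcontfun (\<lambda>y. f y *\<^sub>R \<xi>)"
  have "(\<lambda>y. f y *\<^sub>R \<xi>) \<in> bcontfun"
    using f by (intro bcontfun_normI[where b = "norm \<xi>"] continuous_intros) (auto simp: mult_left_le_one_le)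
  then have h: "apply_bcontfun h y = f y *\<^sub>R \<xi>" for y by (simp add: h_def Bcontfun_inverse)
  define \<phi> where "\<phi> x = \<psi> x *\<^sub>R h" for x
  obtain B where B: "B > 0" "\<And>x. \<bar>\<psi> x\<bar> \<le> B" using test_fun_bounded[OF \<psi>] by blast
  have "\<phi> \<in> borel_measurable MO"
    unfolding \<phi>_def
    by (rule measurable_compose[OF borel_measurable_lebesgue_onI[OF test_fun_borel_measurable[OF \<psi>]]])
       (intro borel_measurable_continuous_onI continuous_intros)
  moreover have "norm (\<phi> x) \<le> B * norm h" for x using B(2)[of x] by (simp add: \<phi>_def mult_right_mono)
  ultimately have "Lp_fun MO q \<phi>" by (intro Lp_fun_bounded[OF slow.finite_measure_axioms] q_bounds)
  moreover have "periodic_cell (apply_bcontfun (\<phi> x))" for x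
    using f(3) by (simp add: periodic_cell_def \<phi>_def h)
  ultimately show thesis using that[of \<phi>] by (simp add: two_scale_test_def \<phi>_def h)
qed

context
  fixes u :: "nat \<Rightarrow> real^'n \<Rightarrow> real" and g C w
  assumes W: "\<And>j. W1p \<Omega> p (u j) (g j)"
    and bound: "\<And>j. W1p_norm_pow \<Omega> p (u j) (g j) \<le> C"
    and w_borel: "w \<in> borel_measurable borel" and w_Lp: "Lp_fun PM p w"
    and limit: "two_scale_limit g w"
begin

lemma potential_Lp: "Lp_fun MO p (u j)" and gradient_Lp: "Lp_fun MO p (g j)"
  using W[of j] by (auto simp: W1p_def)

lemma potential_bound: "Lp_norm_pow MO p (u j) \<le> C" and gradient_bound: "Lp_norm_pow MO p (g j) \<le> C"
  using bound[of j] Lp_norm_pow_nonneg[of MO p "u j"] Lp_norm_pow_nonneg[of MO p "g j"]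
  unfolding W1p_norm_pow_eq by linarith+

lemma potential_integrable: "integrable MO (u j)"
  by (rule Lp_fun_imp_integrable[OF slow.finite_measure_axioms potential_Lp p_bounds(3)])

lemma gradient_integrable: "integrable MO (\<lambda>x. g j x $ i)"
  by (rule Lp_fun_imp_integrable[OF slow.finite_measure_axioms Lp_fun_vec_nth[OF gradient_Lp p_bounds(1)]
    p_bounds(3)])

lemma potential_L1_bound: "(LINT x|MO. \<bar>u j x\<bar>) \<le> measure MO (space MO) + C"
  using integral_norm_le_Lp_norm_pow[OF slow.finite_measure_axioms potential_Lp p_bounds(3), of j]
    potential_bound[of j] by simp

lemma gradient_L1_bound: "(LINT x|MO. \<bar>g j x $ i\<bar>) \<le> measure MO (space MO) + C"
  using integral_norm_le_Lp_norm_pow[OF slow.finite_measure_axioms Lp_fun_vec_nth[OF gradient_Lp p_bounds(1)]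
    p_bounds(3), of j i]
    Lp_norm_pow_vec_nth_le[OF gradient_Lp p_bounds(1), of j i] gradient_bound[of j] by simp

text \<open>In a direction in which the phase is not stationary, integration by parts gains a factor
  \<open>eps j\<close> at the price of a derivative of \<open>u j\<close> or of the test function.\<close>

lemma oscillating_potential_tendsto_0:
  assumes \<psi>: "test_fun \<Omega> \<psi>" and k: "int_vec k" "k \<noteq> 0"
  shows "(\<lambda>j. LINT x|MO. u j x * (wave (freq j k) a x * \<psi> x)) \<longlonglongrightarrow> 0"
proof -
  obtain i where i: "(transpose R *v k) $ i \<noteq> 0" using nonresonant[OF k] by (metis vec_eq_iff zero_index)
  define b where "b = a - pi / 2"
  define \<kappa> where "\<kappa> = 2 * pi * \<bar>(transpose R *v k) $ i\<bar>"
  have \<kappa>: "\<kappa> > 0" "\<bar>freq j k $ i\<bar> = \<kappa> / eps j" for j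
    using i eps_pos[of j] by (simp_all add: \<kappa>_def freq_def abs_mult)
  obtain B where B: "B > 0" "\<And>x. \<bar>\<psi> x\<bar> \<le> B" using test_fun_bounded[OF \<psi>] by blast
  obtain B' where B': "B' > 0" "\<And>x. \<bar>partial_deriv i \<psi> x\<bar> \<le> B'"
    using test_fun_bounded[OF test_fun_partial_deriv[OF \<psi>]] by blast
  define L where "L = measure MO (space MO) + C"
  define D where "D = B * L + B' * L"
  have "\<bar>LINT x|MO. u j x * (wave (freq j k) a x * \<psi> x)\<bar> \<le> D / \<kappa> * eps j" for j
  proof -
    let ?I = "LINT x|MO. u j x * (wave (freq j k) a x * \<psi> x)"
    have "freq j k $ i * ?I = - (LINT x|MO. u j x * (wave (freq j k) b x * partial_deriv i \<psi> x))
        - (LINT x|MO. g j x $ i * (wave (freq j k) b x * \<psi> x))"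
      using W1p_integral_by_parts_wave[OF W potential_integrable \<psi>, of j i "freq j k" b] by (simp add: b_def)
    moreover have "\<bar>LINT x|MO. u j x * (wave (freq j k) b x * partial_deriv i \<psi> x)\<bar> \<le> B' * L"
      unfolding L_def by (rule order.trans[OF integral_mult_wave_test_fun_le[OF potential_integrable
          test_fun_partial_deriv[OF \<psi>] B'(2)] mult_left_mono[OF potential_L1_bound less_imp_le[OF B'(1)]]])
    moreover have "\<bar>LINT x|MO. g j x $ i * (wave (freq j k) b x * \<psi> x)\<bar> \<le> B * L"
      unfolding L_def by (rule order.trans[OF integral_mult_wave_test_fun_le[OF gradient_integrable \<psi> B(2)]
          mult_left_mono[OF gradient_L1_bound less_imp_le[OF B(1)]]])
    ultimately have "\<bar>freq j k $ i * ?I\<bar> \<le> D" unfolding D_def by linarith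
    then have "\<kappa> / eps j * \<bar>?I\<bar> \<le> D" by (simp add: abs_mult \<kappa>(2))
    then have "\<kappa> * \<bar>?I\<bar> \<le> D * eps j" using eps_pos[of j] by (simp add: pos_divide_le_eq)
    then show ?thesis using \<kappa>(1) by (simp add: pos_le_divide_eq mult.commute)
  qed
  then have "\<forall>j. norm (LINT x|MO. u j x * (wave (freq j k) a x * \<psi> x)) \<le> D / \<kappa> * eps j" by simp
  then show ?thesis
    by (rule Lim_null_comparison[OF always_eventually tendsto_mult_right_zero[OF eps_tendsto_0]])
qed

lemma gradient_moment_tendsto:
  assumes \<psi>: "test_fun \<Omega> \<psi>" and k: "int_vec k"
  shows "(\<lambda>j. LINT x|MO. (g j x \<bullet> \<xi>) * (wave (freq j k) a x * \<psi> x)) \<longlonglongrightarrow>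
    (LINT x|MO. fourier_moment k a (\<lambda>y. w (x, y) \<bullet> \<xi>) * \<psi> x)"
proof -
  obtain \<phi> where \<phi>: "two_scale_test \<Omega> q \<phi>" "\<And>x y. apply_bcontfun (\<phi> x) y = (\<psi> x * harmonic k a y) *\<^sub>R \<xi>"
    using ex_product_test[OF \<psi> continuous_on_wave abs_wave_le_1 periodic_cell_harmonic[OF k], of a \<xi>] by blast
  have "fast_pairing j \<phi> (g j) = (LINT x|MO. (g j x \<bullet> \<xi>) * (wave (freq j k) a x * \<psi> x))" for j
    unfolding fast_pairing_def \<phi>(2) harmonic_fast by (simp add: mult_ac)
  moreover have "limit_pairing \<phi> w = (LINT x|MO. fourier_moment k a (\<lambda>y. w (x, y) \<bullet> \<xi>) * \<psi> x)"
  proof -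
    have "limit_pairing \<phi> w = (LINT x|MO. LINT y|cell_measure. w (x, y) \<bullet> apply_bcontfun (\<phi> x) y)"
      using slow_fast.integral_fst'[OF limit_pairing_integrable[OF \<phi>(1) w_Lp]] by (simp add: limit_pairing_def)
    also have "\<dots> = (LINT x|MO. LINT y|cell_measure. (harmonic k a y * (w (x, y) \<bullet> \<xi>)) * \<psi> x)"
      by (simp add: \<phi>(2) mult_ac)
    finally show ?thesis by (simp add: fourier_moment_def)
  qed
  moreover have "(\<lambda>j. fast_pairing j \<phi> (g j)) \<longlonglongrightarrow> limit_pairing \<phi> w"
    using limit \<phi>(1) unfolding two_scale_limit_def by blast
  ultimately show ?thesis by simp
qed

lemma moment_orthogonal_AE:
  assumes k: "int_vec k" "k \<noteq> 0" and \<xi>: "\<xi> \<bullet> (transpose R *v k) = 0"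
  shows "AE x in MO. fourier_moment k a (\<lambda>y. w (x, y) \<bullet> \<xi>) = 0"
proof (rule fundamental_lemma_Lp[OF open_\<Omega> bounded_\<Omega> p
    Lp_fun_fourier_moment[OF Lp_fun_inner_const[OF w_Lp p_bounds(1)] p]])
  fix \<psi> assume \<psi>: "test_fun \<Omega> \<psi>"
  have \<xi>_freq: "(\<Sum>i\<in>UNIV. \<xi> $ i * freq j k $ i) = 0" for j
  proof -
    have "(\<Sum>i\<in>UNIV. \<xi> $ i * freq j k $ i) = \<xi> \<bullet> freq j k" by (simp add: inner_vec_def)
    then show ?thesis using \<xi> by (simp add: freq_def)
  qed
  have "(LINT x|MO. (g j x \<bullet> \<xi>) * (wave (freq j k) a x * \<psi> x)) =
      - (\<Sum>i\<in>UNIV. \<xi> $ i * (LINT x|MO. u j x * (wave (freq j k) a x * partial_deriv i \<psi> x)))" for j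
  proof -
    have int: "integrable MO (\<lambda>x. g j x $ i * (wave (freq j k) a x * \<psi> x))" for i
      by (rule integrable_mult_test_fun[OF gradient_integrable test_fun_smooth_mult[OF smooth_fun_wave \<psi>]])
    have "(LINT x|MO. (g j x \<bullet> \<xi>) * (wave (freq j k) a x * \<psi> x)) =
        (LINT x|MO. (\<Sum>i\<in>UNIV. \<xi> $ i * (g j x $ i * (wave (freq j k) a x * \<psi> x))))"
      unfolding inner_vec_def sum_distrib_right
      by (intro Bochner_Integration.integral_cong sum.cong) (simp_all add: mult_ac)
    also have "\<dots> = (\<Sum>i\<in>UNIV. \<xi> $ i * (LINT x|MO. g j x $ i * (wave (freq j k) a x * \<psi> x)))"
      using int by simp
    also have "\<dots> = - (\<Sum>i\<in>UNIV. \<xi> $ i * (LINT x|MO. u j x * (wave (freq j k) a x * partial_deriv i \<psi> x)))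
        - (\<Sum>i\<in>UNIV. \<xi> $ i * freq j k $ i) * (LINT x|MO. u j x * (wave (freq j k) (a + pi / 2) x * \<psi> x))"
      by (simp add: W1p_integral_by_parts_wave[OF W potential_integrable \<psi>] right_diff_distrib sum_subtractf
          sum_negf sum_distrib_right mult.assoc)
    finally show ?thesis by (simp add: \<xi>_freq)
  qed
  moreover have "(\<lambda>j. - (\<Sum>i\<in>UNIV. \<xi> $ i * (LINT x|MO. u j x * (wave (freq j k) a x * partial_deriv i \<psi> x))))
      \<longlonglongrightarrow> - (\<Sum>i\<in>UNIV. \<xi> $ i * 0)"
    by (intro tendsto_intros oscillating_potential_tendsto_0 test_fun_partial_deriv \<psi> k)
  ultimately show "(LINT x|MO. fourier_moment k a (\<lambda>y. w (x, y) \<bullet> \<xi>) * \<psi> x) = 0"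
    using LIMSEQ_unique[OF gradient_moment_tendsto[OF \<psi> k(1), of \<xi> a]] by simp
qed

lemma moments_parallel_AE:
  "AE x in MO. \<forall>k\<in>{k. int_vec k \<and> k \<noteq> 0}. \<forall>a\<in>{0, - (pi / 2)}.
     \<exists>c. \<forall>i. fourier_moment k a (\<lambda>y. w (x, y) $ i) = c * (transpose R *v k) $ i"
proof -
  have "AE x in MO. \<exists>c. \<forall>i. fourier_moment k a (\<lambda>y. w (x, y) $ i) = c * (transpose R *v k) $ i"
    if k: "int_vec k" "k \<noteq> 0" for k a
  proof -
    define \<rho> where "\<rho> = transpose R *v k"
    have \<rho>: "\<rho> \<bullet> \<rho> \<noteq> 0" using nonresonant[OF k] by (simp add: \<rho>_def)
    define \<xi> where "\<xi> i = (\<rho> \<bullet> \<rho>) *\<^sub>R axis i 1 - \<rho> $ i *\<^sub>R \<rho>" for i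
    have "\<xi> i \<bullet> \<rho> = 0" for i by (simp add: \<xi>_def inner_diff_left inner_axis' mult.commute)
    then have "AE x in MO. \<forall>i. fourier_moment k a (\<lambda>y. w (x, y) \<bullet> \<xi> i) = 0"
      using moment_orthogonal_AE[OF k] by (subst AE_all_countable) (simp add: \<rho>_def)
    then show ?thesis
      using slice_component_integrable[OF w_Lp]
    proof eventually_elim
      case (elim x)
      have "(\<lambda>y. w (x, y) \<bullet> \<rho>) = (\<lambda>y. \<Sum>l\<in>UNIV. \<rho> $ l * w (x, y) $ l)" by (simp add: inner_vec_def mult.commute)
      then have int: "integrable cell_measure (\<lambda>y. w (x, y) \<bullet> \<rho>)" using elim(2) by simp
      have "(\<rho> \<bullet> \<rho>) * fourier_moment k a (\<lambda>y. w (x, y) $ i) = \<rho> $ i * fourier_moment k a (\<lambda>y. w (x, y) \<bullet> \<rho>)" for i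
      proof -
        have \<xi>_eq: "(\<lambda>y. w (x, y) \<bullet> \<xi> i) = (\<lambda>y. (\<rho> \<bullet> \<rho>) * w (x, y) $ i - \<rho> $ i * (w (x, y) \<bullet> \<rho>))"
          by (simp add: \<xi>_def inner_diff_right inner_axis)
        have "fourier_moment k a (\<lambda>y. (\<rho> \<bullet> \<rho>) * w (x, y) $ i - \<rho> $ i * (w (x, y) \<bullet> \<rho>)) = 0"
          using elim(1) unfolding \<xi>_eq[symmetric] by blast
        then show ?thesis using elim(2) int by (simp add: fourier_moment_diff fourier_moment_cmult)
      qed
      then have "\<forall>i. fourier_moment k a (\<lambda>y. w (x, y) $ i) =
          fourier_moment k a (\<lambda>y. w (x, y) \<bullet> \<rho>) / (\<rho> \<bullet> \<rho>) * \<rho> $ i"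
        using \<rho> by (simp add: field_simps)
      then show ?case unfolding \<rho>_def by blast
    qed
  qed
  moreover have "countable {k::real^'m. int_vec k \<and> k \<noteq> 0}"
    by (rule countable_subset[OF _ countable_int_vec]) auto
  ultimately show ?thesis by (subst AE_ball_countable) (auto simp: AE_conj_iff)
qed

definition cell_mean :: "real^'n \<Rightarrow> real^'n" where
  "cell_mean x = (\<chi> i. fourier_moment 0 0 (\<lambda>y. w (x, y) $ i))"

lemma cell_mean_borel: "cell_mean \<in> borel_measurable borel"
proof (rule borel_measurable_vecI)
  fix i
  have [measurable]: "(\<lambda>z. w z $ i) \<in> borel_measurable (borel \<Otimes>\<^sub>M borel)"
    unfolding borel_prod by (rule borel_measurable_vec_nth[OF w_borel])
  have "(\<lambda>x. LINT y|lborel. indicator unit_cell y *\<^sub>R w (x, y) $ i) \<in> borel_measurable borel"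
    by (rule lborel.borel_measurable_lebesgue_integral) measurable
  then show "(\<lambda>x. cell_mean x $ i) \<in> borel_measurable borel"
    by (simp add: cell_mean_def fourier_moment_def wave_def integral_restrict_space)
qed

lemma cell_mean_Lp: "Lp_fun MO p cell_mean"
  using Lp_fun_fourier_moment[OF Lp_fun_vec_nth[OF w_Lp] p] p_bounds
  by (intro Lp_fun_vecI) (auto simp: cell_mean_def)

lemma ex_limit_potential: "\<exists>v0. W1p \<Omega> p v0 cell_mean"
proof -
  interpret bounded_Lp_seq MO u p C
    by unfold_locales (use p potential_Lp potential_bound in auto)
  obtain v where v: "Lp_fun MO p v"
    "\<And>b B L. b \<in> borel_measurable MO \<Longrightarrow> (\<And>x. x \<in> space MO \<Longrightarrow> \<bar>b x\<bar> \<le> B) \<Longrightarrow> B \<ge> 0 \<Longrightarrow>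
       (\<lambda>j. LINT x|MO. u j x * b x) \<longlonglongrightarrow> L \<Longrightarrow> (LINT x|MO. v x * b x) = L"
    using ex_weak_limit by blast
  have "W1p \<Omega> p v cell_mean"
  proof (rule W1pI[OF open_\<Omega> bounded_\<Omega> p_bounds(3) v(1) cell_mean_Lp])
    fix i \<phi> assume \<phi>: "test_fun \<Omega> \<phi>"
    obtain B where B: "B > 0" "\<And>x. \<bar>partial_deriv i \<phi> x\<bar> \<le> B"
      using test_fun_bounded[OF test_fun_partial_deriv[OF \<phi>]] by blast
    have "(\<lambda>j. - (LINT x|MO. g j x $ i * \<phi> x)) \<longlonglongrightarrow> - (LINT x|MO. cell_mean x $ i * \<phi> x)"
      using tendsto_minus[OF gradient_moment_tendsto[OF \<phi> int_vec_0, of "axis i 1" 0]]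
      by (simp add: cell_mean_def inner_axis freq_def wave_def)
    then have "(\<lambda>j. LINT x|MO. u j x * partial_deriv i \<phi> x) \<longlonglongrightarrow> - (LINT x|MO. cell_mean x $ i * \<phi> x)"
      by (simp add: W1p_integral_by_parts[OF W \<phi>])
    then show "(LINT x|MO. v x * partial_deriv i \<phi> x) = - (LINT x|MO. cell_mean x $ i * \<phi> x)"
      using B test_fun_borel_measurable[OF test_fun_partial_deriv[OF \<phi>]]
      by (intro v(2)[where B = B] borel_measurable_lebesgue_onI) auto
  qed
  then show ?thesis by blast
qed

definition osc_part :: "real^'n \<Rightarrow> real^'m \<Rightarrow> real^'n" where
  "osc_part x y = w (x, frac_vec y) - cell_mean x"

lemma osc_part_unit_cell: "y \<in> unit_cell \<Longrightarrow> osc_part x y = w (x, y) - cell_mean x"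
  by (simp add: osc_part_def frac_vec_unit_cell)

lemma osc_part_borel: "(\<lambda>z. osc_part (fst z) (snd z)) \<in> borel_measurable borel"
proof -
  have fst: "(fst :: (real^'n) \<times> (real^'m) \<Rightarrow> _) \<in> borel_measurable borel"
    and snd: "(snd :: (real^'n) \<times> (real^'m) \<Rightarrow> _) \<in> borel_measurable borel"
    by (intro borel_measurable_continuous_onI continuous_intros)+
  show ?thesis
    unfolding osc_part_def
    by (intro borel_measurable_diff measurable_compose[OF fst cell_mean_borel]
        measurable_compose[OF
        borel_measurable_Pair[OF fst measurable_compose[OF snd frac_vec_measurable]] w_borel])
qed

lemma osc_part_Lp: "Lp_fun (lebesgue_on S) p (\<lambda>z. osc_part (fst z) (snd z))"
proof -
  have "Lp_fun PM p (\<lambda>z. w z - cell_mean (fst z))"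
    by (intro Lp_fun_diff w_Lp Lp_fun_PM_fst cell_mean_Lp p_bounds)
  then have "Lp_fun PM p (\<lambda>z. osc_part (fst z) (snd z))"
    by (rule Lp_fun_cong_AE[rotated 2])
       (auto simp: osc_part_unit_cell space_pair_measure intro!: AE_I2 borel_measurable_PM osc_part_borel)
  then show ?thesis by (simp add: Lp_fun_PM_iff_lebesgue_on osc_part_borel)
qed

lemma osc_part_slice_borel: "osc_part x \<in> borel_measurable borel"
  using measurable_compose[OF borel_measurable_Pair[OF borel_measurable_const[of x] measurable_ident]
    osc_part_borel]
  by simp

lemma osc_part_in_G_R: "AE x in MO. osc_part x \<in> G_R p R"
  using Lp_fun_PM_slice[OF w_Lp] moments_parallel_AE slice_component_integrable[OF w_Lp]
proof eventually_elim
  case (elim x)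
  have "Lp_fun cell_measure p (\<lambda>y. w (x, y) - cell_mean x)"
    using p_bounds by (intro Lp_fun_diff elim Lp_fun_bounded[OF cell.finite_measure_axioms]) auto
  then have Lp: "Lp_fun cell_measure p (osc_part x)"
    by (rule Lp_fun_cong_AE[rotated 2])
       (auto simp: osc_part_unit_cell intro!: AE_I2 cell_measurableI osc_part_slice_borel)
  have "gradient_moments R (osc_part x)"
  proof (rule gradient_moments_diff_mean)
    show "integrable cell_measure (\<lambda>y. w (x, y) $ i)" for i using elim(3) by blast
    show "\<exists>c. \<forall>i. fourier_moment k a (\<lambda>y. w (x, y) $ i) = c * (transpose R *v k) $ i"
      if "int_vec k" "k \<noteq> 0" "a \<in> {0, - (pi / 2)}" for k a
      using elim(2) that by blast
  qed (simp add: osc_part_unit_cell cell_mean_def)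
  moreover have "integrable cell_measure (\<lambda>y. osc_part x y $ i)" for i
    by (rule Lp_fun_imp_integrable[OF cell.finite_measure_axioms Lp_fun_vec_nth[OF Lp p_bounds(1)] p_bounds(3)])
  ultimately have "\<exists>lam::real^'m \<Rightarrow> complex. lam 0 = 0 \<and> (\<forall>k. int_vec k \<longrightarrow>
      fourier_coeff (osc_part x) k = (\<chi> i. lam k * complex_of_real ((transpose R *v k) $ i)))"
    using gradient_moments_iff_fourier_coeff by blast
  moreover have "Lp_fun (lebesgue_on unit_cell) p (osc_part x)"
    using Lp by (simp add: Lp_fun_lebesgue_on_cell_iff cell_measurableI osc_part_slice_borel)
  moreover have "periodic_cell (osc_part x)" by (simp add: periodic_cell_def osc_part_def frac_vec_periodic)
  moreover have "osc_part x \<in> borel_measurable lebesgue"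
    using osc_part_slice_borel by (intro measurable_completion) simp
  ultimately show ?case unfolding G_R_def by blast
qed

theorem gradient_limit_decomposition:
  "\<exists>v0 g0 v1. W1p \<Omega> p v0 g0 \<and> Lp_fun (lebesgue_on S) p (\<lambda>z. v1 (fst z) (snd z))
     \<and> (AE x in MO. v1 x \<in> G_R p R) \<and> (\<forall>z\<in>S. w z = g0 (fst z) + v1 (fst z) (snd z))"
proof -
  obtain v0 where "W1p \<Omega> p v0 cell_mean" using ex_limit_potential by blast
  moreover have "\<forall>z\<in>S. w z = cell_mean (fst z) + osc_part (fst z) (snd z)"
    by (auto simp: osc_part_unit_cell)
  ultimately show ?thesis using osc_part_in_G_R osc_part_Lp by blast
qed

end

end

subsection \<open>Correctors\<close>

definition grad :: "(real^'n \<Rightarrow> real) \<Rightarrow> real^'n \<Rightarrow> real^'n" where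
  "grad u x = (\<chi> i. partial_deriv i u x)"

lemma grad_add:
  "f differentiable (at x) \<Longrightarrow> g differentiable (at x) \<Longrightarrow> grad (\<lambda>x. f x + g x) x = grad f x + grad g x"
  by (simp add: grad_def vec_eq_iff partial_deriv_add)

lemma grad_0: "grad (\<lambda>x. 0) x = 0"
  by (simp add: grad_def vec_eq_iff partial_deriv_const)

lemma grad_wave_mult:
  assumes "f differentiable (at x)"
  shows "grad (\<lambda>x. c * (wave r a x * f x)) x =
      (c * wave r a x) *\<^sub>R grad f x + (f x * wave r (a + pi / 2) x) *\<^sub>R (c *\<^sub>R r)"
  using assms smooth_fun_differentiable[OF smooth_fun_wave[of r a]]
  by (simp add: grad_def vec_eq_iff partial_deriv_cmult partial_deriv_mult partial_deriv_wave differentiable_mult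
    distrib_left)

lemma test_fun_grad_bounded:
  assumes "test_fun U \<phi>"
  obtains B where "B > 0" "\<And>x. norm (grad \<phi> x) \<le> B"
proof -
  have "\<exists>B. \<forall>x. \<bar>partial_deriv i \<phi> x\<bar> \<le> B" for i
    using test_fun_bounded[OF test_fun_partial_deriv[OF assms]] by metis
  then obtain b where b: "\<And>i x. \<bar>partial_deriv i \<phi> x\<bar> \<le> b i" by metis
  have "norm (grad \<phi> x) \<le> max 1 (\<Sum>i\<in>UNIV. b i)" for x
    using norm_le_l1_cart[of "grad \<phi> x"] sum_mono[of UNIV "\<lambda>i. \<bar>grad \<phi> x $ i\<bar>" b] b by (force simp: grad_def)
  then show thesis using that[of "max 1 (\<Sum>i\<in>UNIV. b i)"] by simp
qed

lemma test_fun_grad_Lp: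
  assumes U: "open U" "bounded U" and p: "p \<ge> 0" and \<phi>: "test_fun U \<phi>"
  shows "Lp_fun (lebesgue_on U) p (grad \<phi>)"
  using test_fun_Lp_fun[OF test_fun_partial_deriv[OF \<phi>] U p] p by (intro Lp_fun_vecI) (simp_all add: grad_def)

lemma test_fun_W1p:
  assumes U: "open U" "bounded U" and p: "p \<ge> 1" and \<phi>: "test_fun U \<phi>"
  shows "W1p U p \<phi> (grad \<phi>)"
proof (rule W1pI[OF U p])
  show "Lp_fun (lebesgue_on U) p \<phi>" "Lp_fun (lebesgue_on U) p (grad \<phi>)"
    using p test_fun_Lp_fun[OF \<phi> U] test_fun_grad_Lp[OF U _ \<phi>] by auto
  fix i \<psi> assume \<psi>: "test_fun U \<psi>"
  have "(LINT x|lebesgue_on U. \<phi> x * partial_deriv i \<psi> x) = (LINT x|lborel. \<phi> x * partial_deriv i \<psi> x)"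
    by (intro integral_lebesgue_on_test_fun test_fun_smooth_mult test_fun_smooth[OF \<phi>] test_fun_partial_deriv \<psi> U)
  also have "\<dots> = - (LINT x|lborel. partial_deriv i \<phi> x * \<psi> x)"
    by (rule integral_by_parts_test_fun[OF test_fun_smooth[OF \<phi>] \<psi>])
  also have "(LINT x|lborel. partial_deriv i \<phi> x * \<psi> x) = (LINT x|lebesgue_on U. partial_deriv i \<phi> x * \<psi> x)"
    by (intro integral_lebesgue_on_test_fun[symmetric] test_fun_smooth_mult
      test_fun_smooth[OF test_fun_partial_deriv[OF \<phi>]] \<psi> U)
  finally show "(LINT x|lebesgue_on U. \<phi> x * partial_deriv i \<psi> x) = - (LINT x|lebesgue_on U. grad \<phi> x $ i * \<psi> x)"
    by (simp add: grad_def)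
qed

context oscillation_Lp
begin

definition corrector :: "((real^'n) \<times> (real^'m) \<Rightarrow> real^'n) \<Rightarrow> (nat \<Rightarrow> real^'n \<Rightarrow> real) \<Rightarrow> real \<Rightarrow> bool" where
  "corrector w U B \<longleftrightarrow> (\<forall>j. test_fun \<Omega> (U j)) \<and> (\<forall>j x. \<bar>U j x\<bar> \<le> B * eps j) \<and>
     (\<forall>j x. norm (grad (U j) x - w (x, fast j x)) \<le> B * eps j) \<and>
     (\<forall>y. (\<lambda>x. w (x, y)) \<in> borel_measurable borel) \<and>
     (\<forall>x. continuous_on UNIV (\<lambda>y. w (x, y)) \<and> periodic_cell (\<lambda>y. w (x, y))) \<and> (\<forall>z. norm (w z) \<le> B)"

lemma
  assumes "corrector w U B"
  shows corrector_test_fun: "test_fun \<Omega> (U j)"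
    and corrector_potential_le: "\<bar>U j x\<bar> \<le> B * eps j"
    and corrector_grad_error_le: "norm (grad (U j) x - w (x, fast j x)) \<le> B * eps j"
    and corrector_measurable: "(\<lambda>x. w (x, y)) \<in> borel_measurable borel"
    and corrector_continuous: "continuous_on UNIV (\<lambda>y. w (x, y))"
    and corrector_periodic: "periodic_cell (\<lambda>y. w (x, y))"
    and corrector_bound: "norm (w z) \<le> B"
  using assms unfolding corrector_def by blast+

lemma corrector_bound_nonneg: "corrector w U B \<Longrightarrow> 0 \<le> B"
  using corrector_bound[of w U B undefined] by (meson norm_ge_zero order.trans)

lemma corrector_zero: "corrector (\<lambda>z. 0) (\<lambda>j x. 0) 0"
  by (auto simp: corrector_def test_fun_0 grad_0 periodic_cell_def)

lemma corrector_add: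
  assumes v: "corrector v U A" and w: "corrector w V B"
  shows "corrector (\<lambda>z. v z + w z) (\<lambda>j x. U j x + V j x) (A + B)"
  unfolding corrector_def
proof (intro conjI allI)
  fix j x y z
  show "test_fun \<Omega> (\<lambda>x. U j x + V j x)"
    by (intro test_fun_add corrector_test_fun[OF v] corrector_test_fun[OF w])
  show "\<bar>U j x + V j x\<bar> \<le> (A + B) * eps j"
    using corrector_potential_le[OF v, of j x] corrector_potential_le[OF w, of j x] unfolding distrib_right
    by linarith
  have "grad (\<lambda>x. U j x + V j x) x - (v (x, fast j x) + w (x, fast j x)) =
      (grad (U j) x - v (x, fast j x)) + (grad (V j) x - w (x, fast j x))"
    using test_fun_differentiable[OF corrector_test_fun[OF v]] test_fun_differentiable[OF corrector_test_fun[OF w]]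
    by (simp add: grad_add)
  then show "norm (grad (\<lambda>x. U j x + V j x) x - (v (x, fast j x) + w (x, fast j x))) \<le> (A + B) * eps j"
    unfolding distrib_right
    using norm_triangle_mono[OF corrector_grad_error_le[OF v] corrector_grad_error_le[OF w]]
    by metis
  show "(\<lambda>x. v (x, y) + w (x, y)) \<in> borel_measurable borel"
    by (intro borel_measurable_add corrector_measurable[OF v] corrector_measurable[OF w])
  show "continuous_on UNIV (\<lambda>y. v (x, y) + w (x, y))"
    by (intro continuous_on_add corrector_continuous[OF v] corrector_continuous[OF w])
  show "periodic_cell (\<lambda>y. v (x, y) + w (x, y))"
    using corrector_periodic[OF v, of x] corrector_periodic[OF w, of x] by (simp add: periodic_cell_def)
  show "norm (v z + w z) \<le> A + B"
    by (intro norm_triangle_mono corrector_bound[OF v] corrector_bound[OF w])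
qed

lemma scaled_wave_mult_le:
  assumes "0 \<le> s" "s \<le> B"
  shows "\<bar>eps j / (2 * pi) * wave r a x\<bar> * s \<le> B * eps j"
proof -
  have "0 \<le> eps j / (2 * pi)" "eps j / (2 * pi) \<le> eps j"
    using eps_pos[of j] pi_gt3 by (simp_all add: field_simps)
  then have "\<bar>eps j / (2 * pi) * wave r a x\<bar> \<le> eps j * 1"
    unfolding abs_mult using abs_wave_le_1[of r a x] eps_pos[of j] by (intro mult_mono) auto
  then have "\<bar>eps j / (2 * pi) * wave r a x\<bar> * s \<le> eps j * B"
    using assms eps_pos[of j] by (intro mult_mono) auto
  then show ?thesis by (simp add: mult.commute)
qed

text \<open>The quarter phase shift turns the wave in the potential into the harmonic of the field.\<close>

lemma ex_corrector_harmonic: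
  assumes \<psi>: "test_fun \<Omega> \<psi>" and k: "int_vec k"
  shows "\<exists>U B. corrector (\<lambda>z. (\<psi> (fst z) * harmonic k a (snd z)) *\<^sub>R (transpose R *v k)) U B"
proof -
  define \<rho> where "\<rho> = transpose R *v k"
  define c where "c j = eps j / (2 * pi)" for j
  have c: "c j *\<^sub>R freq j k = \<rho>" for j
    using eps_pos[of j] by (simp add: c_def freq_def \<rho>_def)
  define U where "U j x = c j * (wave (freq j k) (a - pi / 2) x * \<psi> x)" for j x
  obtain B0 where B0: "B0 > 0" "\<And>x. \<bar>\<psi> x\<bar> \<le> B0" using test_fun_bounded[OF \<psi>] by blast
  obtain B1 where B1: "B1 > 0" "\<And>x. norm (grad \<psi> x) \<le> B1" using test_fun_grad_bounded[OF \<psi>] by blast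
  define B where "B = B0 + B1 + B0 * norm \<rho>"
  have "0 \<le> B0 * norm \<rho>" using B0(1) by simp
  then have B: "B0 \<le> B" "B1 \<le> B" "B0 * norm \<rho> \<le> B" using B0(1) B1(1) by (simp_all add: B_def)
  have "corrector (\<lambda>z. (\<psi> (fst z) * harmonic k a (snd z)) *\<^sub>R \<rho>) U B"
    unfolding corrector_def fst_conv snd_conv
  proof (intro conjI allI)
    fix j x y and z :: "(real^'n) \<times> (real^'m)"
    show "test_fun \<Omega> (U j)" unfolding U_def by (intro test_fun_cmult test_fun_smooth_mult smooth_fun_wave \<psi>)
    show "\<bar>U j x\<bar> \<le> B * eps j"
      using scaled_wave_mult_le[of "\<bar>\<psi> x\<bar>" B j "freq j k" "a - pi / 2" x] B0(2)[of x] B(1)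
      by (simp add: U_def c_def abs_mult mult.assoc)
    have "grad (U j) x = (c j * wave (freq j k) (a - pi / 2) x) *\<^sub>R grad \<psi> x + (\<psi> x * wave (freq j k) a x) *\<^sub>R \<rho>"
      unfolding U_def using grad_wave_mult[OF test_fun_differentiable[OF \<psi>], of "c j" "freq j k" "a - pi / 2" x]
      by (simp add: c)
    then have "norm (grad (U j) x - (\<psi> x * harmonic k a (fast j x)) *\<^sub>R \<rho>) =
        \<bar>c j * wave (freq j k) (a - pi / 2) x\<bar> * norm (grad \<psi> x)"
      unfolding harmonic_fast by simp
    then show "norm (grad (U j) x - (\<psi> x * harmonic k a (fast j x)) *\<^sub>R \<rho>) \<le> B * eps j"
      using scaled_wave_mult_le[of "norm (grad \<psi> x)" B] B1(2)[of x] B(2) unfolding c_def by simp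
    show "(\<lambda>x. (\<psi> x * harmonic k a y) *\<^sub>R \<rho>) \<in> borel_measurable borel"
      using test_fun_borel_measurable[OF \<psi>] by measurable
    show "continuous_on UNIV (\<lambda>y. (\<psi> x * harmonic k a y) *\<^sub>R \<rho>)"
      by (intro continuous_intros continuous_on_wave)
    show "periodic_cell (\<lambda>y. (\<psi> x * harmonic k a y) *\<^sub>R \<rho>)"
      using periodic_cell_harmonic[OF k, of a] by (simp add: periodic_cell_def)
    have "\<bar>\<psi> (fst z) * harmonic k a (snd z)\<bar> \<le> B0 * 1"
      unfolding abs_mult using B0 abs_wave_le_1 by (intro mult_mono) auto
    then have "\<bar>\<psi> (fst z) * harmonic k a (snd z)\<bar> * norm \<rho> \<le> B0 * norm \<rho>" by (intro mult_right_mono) auto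
    then show "norm ((\<psi> (fst z) * harmonic k a (snd z)) *\<^sub>R \<rho>) \<le> B" using B(3) by simp
  qed
  then show ?thesis unfolding \<rho>_def by blast
qed

definition corrector_fields :: "((real^'n) \<times> (real^'m) \<Rightarrow> real^'n) set" where
  "corrector_fields = {w. \<exists>U B. corrector w U B}"

lemma corrector_fields_add: "v \<in> corrector_fields \<Longrightarrow> w \<in> corrector_fields \<Longrightarrow> (\<lambda>z. v z + w z) \<in> corrector_fields"
  using corrector_add by (fastforce simp: corrector_fields_def)

lemma corrector_Lp:
  assumes w: "corrector w U B"
  shows "Lp_fun PM p w"
proof (rule Lp_fun_bounded[OF finite_measure_PM _ corrector_bound[OF w] p_bounds(1)])
  have "(\<lambda>z. w (fst z, y)) \<in> borel_measurable PM" for y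
    by (rule measurable_compose[OF measurable_fst borel_measurable_lebesgue_onI[OF corrector_measurable[OF w]]])
  then have "(\<lambda>z. w (fst z, snd z)) \<in> borel_measurable PM"
    by (rule Caratheodory_measurable[where F = "\<lambda>z y. w (fst z, y)", OF _ corrector_continuous[OF w]
      measurable_snd_PM])
  then show "w \<in> borel_measurable PM" by simp
qed

lemma harmonic_mode_in_closure:
  assumes c: "Lp_fun MO p c" and k: "int_vec k"
  shows "(\<lambda>z. (c (fst z) * harmonic k a (snd z)) *\<^sub>R (transpose R *v k)) \<in> Lp_closure PM p corrector_fields"
proof -
  define \<rho> where "\<rho> = transpose R *v k"
  define T where "T f z = (f (fst z) * harmonic k a (snd z)) *\<^sub>R \<rho>" for f :: "real^'n \<Rightarrow> real"
      and z :: "(real^'n) \<times> (real^'m)"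
  have T: "Lp_fun PM p (T f)" "Lp_norm_pow PM p (T f) \<le> norm \<rho> powr p * Lp_norm_pow MO p f"
      if f: "Lp_fun MO p f" for f
  proof -
    have meas: "T f \<in> borel_measurable PM"
      unfolding T_def
      by (intro borel_measurable_scaleR borel_measurable_times borel_measurable_const
        Lp_fun_measurable[OF Lp_fun_PM_fst[OF f]]
          measurable_compose[OF measurable_snd_PM borel_measurable_wave])
    have "norm (T f z) \<le> norm (norm \<rho> *\<^sub>R f (fst z))" for z
    proof -
      have "\<bar>f (fst z) * harmonic k a (snd z)\<bar> \<le> \<bar>f (fst z)\<bar> * 1"
        unfolding abs_mult using abs_wave_le_1 by (intro mult_left_mono) auto
      from mult_right_mono[OF this norm_ge_zero[of \<rho>]] show ?thesis by (simp add: T_def mult.commute[of "norm \<rho>"])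
    qed
    then have le: "AE z in PM. norm (T f z) \<le> norm (norm \<rho> *\<^sub>R f (fst z))" by simp
    note g = Lp_fun_scaleR[OF Lp_fun_PM_fst[OF f], of "norm \<rho>"]
    show "Lp_fun PM p (T f)" by (rule Lp_fun_mono[OF g meas le p_bounds(1)])
    have "Lp_norm_pow PM p (T f) \<le> Lp_norm_pow PM p (\<lambda>z. norm \<rho> *\<^sub>R f (fst z))"
      by (rule Lp_norm_pow_mono[OF g meas le p_bounds(1)])
    also have "\<dots> = norm \<rho> powr p * Lp_norm_pow MO p f"
      unfolding Lp_norm_pow_scaleR Lp_norm_pow_PM_fst[OF f] by simp
    finally show "Lp_norm_pow PM p (T f) \<le> norm \<rho> powr p * Lp_norm_pow MO p f" .
  qed
  have "T c \<in> Lp_closure PM p corrector_fields"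
  proof (rule Lp_closure_bounded_map[OF test_fun_dense_Lp[OF open_\<Omega> bounded_\<Omega> p_bounds(2) c] p_bounds(1)
      powr_ge_zero T])
    show "T (\<lambda>x. f x - g x) = (\<lambda>z. T f z - T g z)" for f g
      by (simp add: T_def fun_eq_iff left_diff_distrib scaleR_left_diff_distrib)
    show "T \<psi> \<in> corrector_fields" if "\<psi> \<in> Collect (test_fun \<Omega>)" for \<psi>
      using ex_corrector_harmonic[OF _ k, of \<psi> a] that by (simp add: corrector_fields_def T_def[abs_def] \<rho>_def)
  qed
  then show ?thesis by (simp add: T_def[abs_def] \<rho>_def)
qed

context
  fixes w :: "(real^'n) \<times> (real^'m) \<Rightarrow> real^'n"
  assumes w_Lp: "Lp_fun PM p w" and moments: "AE x in MO. gradient_moments R (\<lambda>y. w (x, y))"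
begin

definition mode_coeff :: "real^'m \<Rightarrow> real \<Rightarrow> real^'n \<Rightarrow> real" where
  "mode_coeff k a x = fourier_moment k a (\<lambda>y. w (x, y) \<bullet> (transpose R *v k)) /
      ((transpose R *v k) \<bullet> (transpose R *v k))"

lemma mode_coeff_Lp: "Lp_fun MO p (mode_coeff k a)"
  unfolding mode_coeff_def[abs_def] divide_inverse mult.commute[of _ "inverse _"]
  by (intro Lp_fun_cmult Lp_fun_fourier_moment Lp_fun_inner_const w_Lp p p_bounds)

lemma moments_eq_mode_coeff:
  "AE x in MO. \<forall>k. int_vec k \<longrightarrow> (\<forall>a\<in>{0, - (pi / 2)}. \<forall>i.
     fourier_moment k a (\<lambda>y. w (x, y) $ i) = mode_coeff k a x * (transpose R *v k) $ i)"
  using moments slice_component_integrable[OF w_Lp]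
proof eventually_elim
  case (elim x)
  have "fourier_moment k a (\<lambda>y. w (x, y) $ i) = mode_coeff k a x * (transpose R *v k) $ i"
    if k: "int_vec k" and a: "a \<in> {0, - (pi / 2)}" for k a i
  proof -
    define \<rho> where "\<rho> = transpose R *v k"
    obtain c where c: "\<And>i. fourier_moment k a (\<lambda>y. w (x, y) $ i) = c * \<rho> $ i"
      using elim(1) k a unfolding gradient_moments_def \<rho>_def by blast
    have "fourier_moment k a (\<lambda>y. w (x, y) \<bullet> \<rho>) = (\<Sum>i\<in>UNIV. c * \<rho> $ i * \<rho> $ i)"
      using elim(2) by (simp add: fourier_moment_inner c)
    also have "\<dots> = c * (\<rho> \<bullet> \<rho>)" by (simp add: inner_vec_def sum_distrib_left mult.assoc)
    finally have "mode_coeff k a x = c * (\<rho> \<bullet> \<rho>) / (\<rho> \<bullet> \<rho>)" by (simp add: mode_coeff_def \<rho>_def)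
    then show ?thesis unfolding c \<rho>_def[symmetric] by (cases "\<rho> = 0") simp_all
  qed
  then show ?case by blast
qed

definition smoothed :: "(real^'m \<Rightarrow> real) \<Rightarrow> (real^'n) \<times> (real^'m) \<Rightarrow> real^'n" where
  "smoothed K z = (\<chi> i. cell_conv K (\<lambda>y. w (fst z, y) $ i) (snd z))"

lemma smoothed_measurable:
  assumes K: "trig_poly K"
  shows "smoothed K \<in> borel_measurable PM"
proof (rule borel_measurable_vecI)
  fix i
  note snd_fst = measurable_compose[OF measurable_fst measurable_snd_PM, of cell_measure]
  have snd: "snd \<in> borel_measurable (PM \<Otimes>\<^sub>M cell_measure)"
    by (rule measurable_compose[OF measurable_snd]) (auto intro: cell_measurableI)
  have pair: "(\<lambda>t. (fst (fst t), snd t)) \<in> PM \<Otimes>\<^sub>M cell_measure \<rightarrow>\<^sub>M PM" by measurable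
  have "(\<lambda>t. K (snd (fst t) - snd t) * w (fst (fst t), snd t) $ i) \<in> borel_measurable (PM \<Otimes>\<^sub>M cell_measure)"
    by (intro borel_measurable_times
      measurable_compose[OF borel_measurable_diff[OF snd_fst snd] trig_poly_borel_measurable[OF K]]
        measurable_compose[OF pair borel_measurable_vec_nth[OF Lp_fun_measurable[OF w_Lp]]])
  then have "(\<lambda>z. LINT y|cell_measure. K (snd z - y) * w (fst z, y) $ i) \<in> borel_measurable PM"
    by (intro cell.borel_measurable_lebesgue_integral) (simp add: case_prod_beta)
  then show "(\<lambda>z. smoothed K z $ i) \<in> borel_measurable PM" by (simp add: smoothed_def cell_conv_def)
qed

lemma smoothed_in_closure:
  assumes "trig_poly K"
  shows "smoothed K \<in> Lp_closure PM p corrector_fields"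
  using assms
proof (induction rule: trig_poly.induct)
  case (harmonic k c a)
  let ?mode = "\<lambda>b b' z. ((c * mode_coeff k b (fst z)) * harmonic k b' (snd z)) *\<^sub>R (transpose R *v k)"
  have "?mode b b' \<in> Lp_closure PM p corrector_fields" for b b'
    by (intro harmonic_mode_in_closure Lp_fun_cmult mode_coeff_Lp harmonic)
  then have "(\<lambda>z. ?mode 0 a z + ?mode (- (pi / 2)) (a - pi / 2) z) \<in> Lp_closure PM p corrector_fields"
    by (intro Lp_closure_add corrector_fields_add p_bounds)
  moreover have "AE z in PM. ?mode 0 a z + ?mode (- (pi / 2)) (a - pi / 2) z = smoothed (\<lambda>u. c * harmonic k a u) z"
    using AE_PM_fst[OF slice_component_integrable[OF w_Lp]] AE_PM_fst[OF moments_eq_mode_coeff]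
  proof eventually_elim
    case (elim z)
    have "integrable cell_measure (\<lambda>y. w (fst z, y) $ i)"
      "fourier_moment k 0 (\<lambda>y. w (fst z, y) $ i) = mode_coeff k 0 (fst z) * (transpose R *v k) $ i"
      "fourier_moment k (- (pi / 2)) (\<lambda>y. w (fst z, y) $ i) =
          mode_coeff k (- (pi / 2)) (fst z) * (transpose R *v k) $ i" for i
      using elim harmonic by blast+
    then show ?case
      unfolding vec_eq_iff smoothed_def vec_lambda_beta by (simp add: cell_conv_harmonic distrib_left)
  qed
  ultimately show ?case
    by (intro Lp_closure_cong_AE[OF _ smoothed_measurable _ p_bounds(1)] trig_poly.harmonic harmonic)
next
  case (add f g)
  have "AE z in PM. smoothed f z + smoothed g z = smoothed (\<lambda>u. f u + g u) z"
    using AE_PM_fst[OF slice_component_integrable[OF w_Lp]]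
    by eventually_elim (simp add: vec_eq_iff smoothed_def cell_conv_add_left[OF add.hyps])
  then show ?case
    by (intro Lp_closure_cong_AE[OF Lp_closure_add[OF add.IH p_bounds(1) corrector_fields_add] smoothed_measurable
      _ p_bounds(1)]
        trig_poly.add add.hyps) auto
qed

lemma smoothed_Lp: "Lp_fun PM p (smoothed (peak_kernel N))"
  by (rule Lp_closure_Lp_fun[OF smoothed_in_closure[OF trig_poly_peak_kernel]])

lemma cell_conv_peak_kernel_diff_le:
  assumes f: "Lp_fun cell_measure p f"
  shows "Lp_norm_pow cell_measure p (\<lambda>y. cell_conv (peak_kernel N) f y - f y) \<le>
      2 powr p * (2 * Lp_norm_pow cell_measure p f)"
proof -
  have "Lp_norm_pow cell_measure p (\<lambda>y. cell_conv (peak_kernel N) f y + - f y) \<le>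
      2 powr p * (Lp_norm_pow cell_measure p (cell_conv (peak_kernel N) f) +
          Lp_norm_pow cell_measure p (\<lambda>y. - f y))"
    using Lp_fun_scaleR[OF f, of "-1"] by (intro Lp_norm_pow_add_le Lp_fun_cell_conv p f p_bounds) simp
  also have "\<dots> \<le> 2 powr p * (2 * Lp_norm_pow cell_measure p f)"
    using Lp_norm_pow_cell_conv_le[OF p f, of N] by (intro mult_left_mono) (simp_all add: Lp_norm_pow_def)
  finally show ?thesis by simp
qed

lemma smoothed_component_tendsto:
  "(\<lambda>N. Lp_norm_pow PM p (\<lambda>z. smoothed (peak_kernel N) z $ i - w z $ i)) \<longlonglongrightarrow> 0"
proof -
  define h where "h N x =
      Lp_norm_pow cell_measure p (\<lambda>y. cell_conv (peak_kernel N) (\<lambda>y. w (x, y) $ i) y - w (x, y) $ i)" for N x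
  note w_i = Lp_fun_integrable_powr[OF Lp_fun_vec_nth[OF w_Lp p_bounds(1)], of i]
  have int: "integrable PM (\<lambda>z. norm (smoothed (peak_kernel N) z $ i - w z $ i) powr p)" for N
    by (intro Lp_fun_integrable_powr Lp_fun_diff Lp_fun_vec_nth smoothed_Lp w_Lp p_bounds)
  have h_int: "integrable MO (h N)"
      and h_eq: "Lp_norm_pow PM p (\<lambda>z. smoothed (peak_kernel N) z $ i - w z $ i) = (LINT x|MO. h N x)" for N
    using slow_fast.integrable_fst'[OF int[of N]] slow_fast.integral_fst'[OF int[of N]]
    by (simp_all add: h_def[abs_def] Lp_norm_pow_def smoothed_def)
  have "(\<lambda>N. LINT x|MO. h N x) \<longlonglongrightarrow> (LINT x|MO. 0)"
  proof (rule integral_dominated_convergence[where w =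
      "\<lambda>x. 2 powr p * (2 * (LINT y|cell_measure. norm (w (x, y) $ i) powr p))"])
    show "integrable MO (\<lambda>x. 2 powr p * (2 * (LINT y|cell_measure. norm (w (x, y) $ i) powr p)))"
      by (intro integrable_mult_right slow_fast.integrable_fst'[OF w_i])
    show "AE x in MO. (\<lambda>N. h N x) \<longlonglongrightarrow> 0"
      unfolding h_def using slice_component_Lp[OF w_Lp]
      by eventually_elim (blast intro: cell_conv_Lp_tendsto[OF p])
    show "AE x in MO. norm (h N x) \<le> 2 powr p * (2 * (LINT y|cell_measure. norm (w (x, y) $ i) powr p))" for N
      using slice_component_Lp[OF w_Lp]
    proof eventually_elim
      case (elim x)
      then show ?case
        using cell_conv_peak_kernel_diff_le[of "\<lambda>y. w (x, y) $ i" N] Lp_norm_pow_nonneg[of cell_measure p]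
        by (simp add: h_def Lp_norm_pow_def)
    qed
  qed (use h_int in auto)
  then show ?thesis by (simp add: h_eq)
qed

theorem gradient_moments_imp_in_closure: "w \<in> Lp_closure PM p corrector_fields"
proof (rule Lp_closure_LIMSEQ[OF w_Lp p_bounds(1) smoothed_in_closure[OF trig_poly_peak_kernel]])
  have diff_Lp: "Lp_fun PM p (\<lambda>z. smoothed (peak_kernel N) z - w z)" for N
    by (intro Lp_fun_diff smoothed_Lp w_Lp p_bounds)
  show "(\<lambda>N. Lp_norm_pow PM p (\<lambda>z. smoothed (peak_kernel N) z - w z)) \<longlonglongrightarrow> 0"
  proof (rule tendsto_sandwich[OF _ _ tendsto_const])
    show "\<forall>\<^sub>F N in sequentially. Lp_norm_pow PM p (\<lambda>z. smoothed (peak_kernel N) z - w z) \<le>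
        real CARD('n) powr p * (\<Sum>i\<in>UNIV. Lp_norm_pow PM p (\<lambda>z. smoothed (peak_kernel N) z $ i - w z $ i))"
      using Lp_norm_pow_le_sum_components[OF diff_Lp p_bounds(1)] by (intro always_eventually) simp
    have "(\<lambda>N. real CARD('n) powr p * (\<Sum>i\<in>UNIV. Lp_norm_pow PM p (\<lambda>z. smoothed (peak_kernel N) z $ i - w z $ i)))
        \<longlonglongrightarrow> real CARD('n) powr p * (\<Sum>i\<in>(UNIV::'n set). 0)"
      by (intro tendsto_intros smoothed_component_tendsto)
    then show "(\<lambda>N. real CARD('n) powr p *
        (\<Sum>i\<in>UNIV. Lp_norm_pow PM p (\<lambda>z. smoothed (peak_kernel N) z $ i - w z $ i)))
        \<longlonglongrightarrow> 0"
      by simp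
  qed (simp add: Lp_norm_pow_nonneg)
qed

end

end

subsection \<open>Recovery sequences\<close>

lemma ex_diagonal_index:
  assumes ev: "\<And>N::nat. \<forall>\<^sub>F j in sequentially. Q N j" and Q_0: "\<And>j. Q 0 j"
  obtains n where "\<And>j. Q (n j) j" "\<And>M. \<forall>\<^sub>F j in sequentially. M \<le> n j"
proof
  let ?n = "\<lambda>j. Max {N. N \<le> j \<and> Q N j}"
  have fin: "finite {N. N \<le> j \<and> Q N j}" for j by simp
  show "Q (?n j) j" for j using Max_in[OF fin, of j] Q_0[of j] by blast
  show "\<forall>\<^sub>F j in sequentially. M \<le> ?n j" for M
    using ev[of M] eventually_ge_at_top[of M] by eventually_elim (auto intro: Max_ge[OF fin])
qed

context oscillation_Lp
begin

lemma two_scale_limit_approxI: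
  assumes g: "\<And>j. Lp_fun MO p (g j)" and w: "Lp_fun PM p w"
    and approx: "\<And>e. e > 0 \<Longrightarrow> \<exists>f v. two_scale_limit f v \<and> (\<forall>j. Lp_fun MO p (f j)) \<and> Lp_fun PM p v \<and>
      (\<forall>\<^sub>F j in sequentially. Lp_norm_pow MO p (\<lambda>x. g j x - f j x) \<le> e) \<and> Lp_norm_pow PM p (\<lambda>z. w z - v z) \<le> e"
  shows "two_scale_limit g w"
  unfolding two_scale_limit_def
proof (intro allI impI tendsto_approxI)
  fix \<phi> :: "real^'n \<Rightarrow> (real^'m) \<Rightarrow>\<^sub>C (real^'n)" and e :: real
  assume \<phi>: "two_scale_test \<Omega> q \<phi>" and e: "e > 0"
  define K where "K = Lp_norm_pow MO q \<phi> powr (1 / q)"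
  have K: "K \<ge> 0" by (simp add: K_def)
  define d where "d = (e / (K + 1)) powr p"
  have d_root: "d powr (1 / p) = e / (K + 1)" and d: "d > 0" using e K p by (simp_all add: d_def powr_powr)
  have small: "t powr (1 / p) * K \<le> e" if "0 \<le> t" "t \<le> d" for t
  proof -
    have "t powr (1 / p) * K \<le> e / (K + 1) * (K + 1)"
      using that p K e by (intro mult_mono) (auto simp: d_root[symmetric] intro!: powr_mono2)
    then show ?thesis using K by simp
  qed
  obtain f v where f: "two_scale_limit f v" "\<And>j. Lp_fun MO p (f j)" and v: "Lp_fun PM p v"
    and f_close: "\<forall>\<^sub>F j in sequentially. Lp_norm_pow MO p (\<lambda>x. g j x - f j x) \<le> d"
    and v_close: "Lp_norm_pow PM p (\<lambda>z. w z - v z) \<le> d"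
    using approx[OF d] by blast
  have "\<forall>\<^sub>F j in sequentially. dist (fast_pairing j \<phi> (g j)) (fast_pairing j \<phi> (f j)) \<le> e"
    using f_close
  proof eventually_elim
    case (elim j)
    have "\<bar>fast_pairing j \<phi> (\<lambda>x. g j x - f j x)\<bar> \<le> e"
      using fast_pairing_le[OF \<phi> Lp_fun_diff[OF g f(2) p_bounds(1)], of j j j]
        small[OF Lp_norm_pow_nonneg elim] unfolding K_def by (rule order.trans)
    then show ?case by (simp add: dist_real_def fast_pairing_diff[OF \<phi> g f(2)])
  qed
  moreover have "\<bar>limit_pairing \<phi> (\<lambda>z. w z - v z)\<bar> \<le> e"
    using limit_pairing_le[OF \<phi> Lp_fun_diff[OF w v p_bounds(1)]]
      small[OF Lp_norm_pow_nonneg v_close] unfolding K_def by (rule order.trans)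
  then have "dist (limit_pairing \<phi> v) (limit_pairing \<phi> w) \<le> e"
    by (simp add: dist_real_def abs_minus_commute limit_pairing_diff[OF \<phi> w v])
  ultimately show "\<exists>h m. (h \<longlongrightarrow> m) sequentially \<and>
      (\<forall>\<^sub>F j in sequentially. dist (fast_pairing j \<phi> (g j)) (h j) \<le> e) \<and> dist m (limit_pairing \<phi> w) \<le> e"
    using f(1) \<phi> unfolding two_scale_limit_def by blast
qed

context
  fixes w U B assumes corr: "corrector w U B"
begin

lemma corrector_fast_Lp: "Lp_fun MO p (\<lambda>x. w (x, fast j x))"
proof (rule Lp_fun_bounded[OF slow.finite_measure_axioms _ corrector_bound[OF corr] p_bounds(1)])
  show "(\<lambda>x. w (x, fast j x)) \<in> borel_measurable MO"
    by (rule Caratheodory_measurable[where F = "\<lambda>x y. w (x, y)", OF _ corrector_continuous[OF corr]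
      fast_measurable])
       (rule borel_measurable_lebesgue_onI[OF corrector_measurable[OF corr]])
qed

lemma corrector_potential_Lp: "Lp_fun MO p (U j)"
  by (rule test_fun_Lp_fun[OF corrector_test_fun[OF corr] open_\<Omega> bounded_\<Omega> p_bounds(1)])

lemma corrector_gradient_Lp: "Lp_fun MO p (grad (U j))"
  by (rule test_fun_grad_Lp[OF open_\<Omega> bounded_\<Omega> p_bounds(1) corrector_test_fun[OF corr]])

lemma eps_powr_tendsto_0: "(\<lambda>j. (B * eps j) powr p * c) \<longlonglongrightarrow> 0"
proof -
  have "(\<lambda>j. (B * eps j) powr p * c) \<longlonglongrightarrow> 0 powr p * c"
    using corrector_bound_nonneg[OF corr] eps_pos p_bounds tendsto_mult_right_zero[OF eps_tendsto_0, of B]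
    by (intro tendsto_mult tendsto_powr' tendsto_const) (auto simp: less_imp_le)
  then show ?thesis using p_bounds by simp
qed

lemma corrector_potential_tendsto_0: "(\<lambda>j. Lp_norm_pow MO p (U j)) \<longlonglongrightarrow> 0"
proof (rule tendsto_sandwich[OF _ _ tendsto_const eps_powr_tendsto_0])
  show "\<forall>\<^sub>F j in sequentially. Lp_norm_pow MO p (U j) \<le> (B * eps j) powr p * measure MO (space MO)"
    using corrector_potential_le[OF corr] p_bounds
    by (intro always_eventually allI Lp_norm_pow_bounded slow.finite_measure_axioms
      Lp_fun_measurable[OF corrector_potential_Lp]) auto
qed (simp add: Lp_norm_pow_nonneg)

lemma corrector_grad_error_tendsto_0: "(\<lambda>j. Lp_norm_pow MO p (\<lambda>x. grad (U j) x - w (x, fast j x))) \<longlonglongrightarrow> 0"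
proof (rule tendsto_sandwich[OF _ _ tendsto_const eps_powr_tendsto_0])
  show "\<forall>\<^sub>F j in sequentially. Lp_norm_pow MO p (\<lambda>x. grad (U j) x - w (x, fast j x)) \<le>
      (B * eps j) powr p * measure MO (space MO)"
    using corrector_grad_error_le[OF corr] p_bounds
    by (intro always_eventually allI Lp_norm_pow_bounded slow.finite_measure_axioms
        Lp_fun_measurable[OF Lp_fun_diff[OF corrector_gradient_Lp corrector_fast_Lp]]) auto
qed (simp add: Lp_norm_pow_nonneg)

lemma corrector_two_scale_limit: "two_scale_limit (\<lambda>j. grad (U j)) w"
proof (rule two_scale_limit_approxI[OF corrector_gradient_Lp corrector_Lp[OF corr]])
  fix e :: real assume "e > 0"
  have "two_scale_limit (\<lambda>j x. w (x, fast j x)) w"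
    unfolding two_scale_limit_def
  proof (intro allI impI mean_value_pairing[where h = "\<lambda>x. B"])
    show "Lp_fun MO p (\<lambda>x. B)"
      using p_bounds by (intro Lp_fun_bounded[OF slow.finite_measure_axioms, where B = "\<bar>B\<bar>"]) auto
    show "norm (w (x, y)) \<le> norm B" for x y using corrector_bound[OF corr, of "(x, y)"] by simp
  qed (use corrector_measurable[OF corr] corrector_continuous[OF corr] corrector_periodic[OF corr]
       in \<open>auto intro: borel_measurable_lebesgue_onI\<close>)
  moreover have "\<forall>\<^sub>F j in sequentially. Lp_norm_pow MO p (\<lambda>x. grad (U j) x - w (x, fast j x)) \<le> e"
    using order_tendstoD(2)[OF corrector_grad_error_tendsto_0 \<open>e > 0\<close>] by eventually_elim simp
  moreover have "Lp_norm_pow PM p (\<lambda>z. w z - w z) \<le> e" using \<open>e > 0\<close> by (simp add: Lp_norm_pow_def)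
  ultimately show "\<exists>f v. two_scale_limit f v \<and> (\<forall>j. Lp_fun MO p (f j)) \<and> Lp_fun PM p v \<and>
      (\<forall>\<^sub>F j in sequentially. Lp_norm_pow MO p (\<lambda>x. grad (U j) x - f j x) \<le> e) \<and>
      Lp_norm_pow PM p (\<lambda>z. w z - v z) \<le> e"
    using corrector_fast_Lp corrector_Lp[OF corr] by blast
qed

lemma corrector_fast_norm_tendsto:
  "(\<lambda>j. Lp_norm_pow MO p (\<lambda>x. w (x, fast j x))) \<longlonglongrightarrow> Lp_norm_pow PM p w"
proof -
  have "caratheodory (\<lambda>z. norm (w z) powr p) (\<lambda>x. B powr p)"
    unfolding caratheodory_def
  proof (intro conjI allI ballI)
    fix x y
    show "(\<lambda>x. norm (w (x, y)) powr p) \<in> borel_measurable MO"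
      using borel_measurable_norm_of_measurable[OF
        borel_measurable_lebesgue_onI[OF corrector_measurable[OF corr, of y]]]
      by measurable
    show "continuous_on UNIV (\<lambda>y. norm (w (x, y)) powr p)"
      using p_bounds corrector_continuous[OF corr] by (intro continuous_on_powr' continuous_intros) auto
    show "periodic_cell (\<lambda>y. norm (w (x, y)) powr p)"
      using corrector_periodic[OF corr, of x] by (simp add: periodic_cell_def)
    show "\<bar>norm (w (x, y)) powr p\<bar> \<le> B powr p"
      using corrector_bound[OF corr] p_bounds by (simp add: powr_mono2)
  qed simp
  from mean_value_tendsto[OF this] show ?thesis by (simp add: Lp_norm_pow_def)
qed

lemma corrector_gradient_eventually_le:
  assumes "\<delta> > 0"
  shows "\<forall>\<^sub>F j in sequentially. Lp_norm_pow MO p (grad (U j)) \<le> 2 powr p * (Lp_norm_pow PM p w + \<delta>)"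
proof -
  have "\<forall>\<^sub>F j in sequentially. Lp_norm_pow MO p (\<lambda>x. w (x, fast j x)) < Lp_norm_pow PM p w + \<delta> / 2"
    using assms by (intro order_tendstoD(2)[OF corrector_fast_norm_tendsto]) simp
  moreover have "\<forall>\<^sub>F j in sequentially. Lp_norm_pow MO p (\<lambda>x. grad (U j) x - w (x, fast j x)) < \<delta> / 2"
    using assms by (intro order_tendstoD(2)[OF corrector_grad_error_tendsto_0]) simp
  ultimately show ?thesis
  proof eventually_elim
    case (elim j)
    have "Lp_norm_pow MO p (\<lambda>x. (grad (U j) x - w (x, fast j x)) + w (x, fast j x)) \<le>
        2 powr p * (Lp_norm_pow MO p (\<lambda>x. grad (U j) x - w (x, fast j x)) +
            Lp_norm_pow MO p (\<lambda>x. w (x, fast j x)))"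
      by (intro Lp_norm_pow_add_le Lp_fun_diff corrector_gradient_Lp corrector_fast_Lp p_bounds)
    also have "\<dots> \<le> 2 powr p * (Lp_norm_pow PM p w + \<delta>)" using elim by (intro mult_left_mono) auto
    finally show ?case by simp
  qed
qed

end

lemma corrector_diff:
  assumes v: "corrector v U A" and w: "corrector w V B"
  shows "corrector (\<lambda>z. v z - w z) (\<lambda>j x. U j x - V j x) (A + B)"
proof -
  have "grad (\<lambda>x. - V j x) x = - grad (V j) x" for j x
    using partial_deriv_cmult[OF test_fun_differentiable[OF corrector_test_fun[OF w]], of _ "-1"]
    by (simp add: grad_def vec_eq_iff)
  then have "corrector (\<lambda>z. - w z) (\<lambda>j x. - V j x) B"
    using w test_fun_cmult[of \<Omega> _ "-1"] unfolding corrector_def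
    by (auto simp: periodic_cell_def norm_minus_commute intro!: continuous_on_minus)
  from corrector_add[OF v this] show ?thesis by simp
qed

lemma corrector_gradient_diff_eventually_le:
  assumes v: "corrector v U A" and w: "corrector w V B" and "\<delta> > 0"
  shows "\<forall>\<^sub>F j in sequentially. Lp_norm_pow MO p (\<lambda>x. grad (U j) x - grad (V j) x) \<le>
    2 powr p * (Lp_norm_pow PM p (\<lambda>z. v z - w z) + \<delta>)"
proof -
  have "grad (\<lambda>x. U j x - V j x) = (\<lambda>x. grad (U j) x - grad (V j) x)" for j
    using test_fun_differentiable[OF corrector_test_fun[OF v]] test_fun_differentiable[OF corrector_test_fun[OF w]]
      partial_deriv_add[of "U j" _ "\<lambda>x. (-1) * V j x"] partial_deriv_cmult[of "V j" _ _ "-1"]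
    by (simp add: grad_def fun_eq_iff vec_eq_iff)
  then show ?thesis
    using corrector_gradient_eventually_le[OF corrector_diff[OF v w] \<open>\<delta> > 0\<close>] by simp
qed

lemma ex_corrector_sequence:
  assumes "w \<in> Lp_closure PM p corrector_fields"
  obtains W U B where "\<And>N::nat. corrector (W N) (U N) (B N)" "U 0 = (\<lambda>j x. 0)"
    "(\<lambda>N. Lp_norm_pow PM p (\<lambda>z. w z - W N z)) \<longlonglongrightarrow> 0"
proof -
  obtain V where V: "\<And>N. V N \<in> corrector_fields" "(\<lambda>N. Lp_norm_pow PM p (\<lambda>z. w z - V N z)) \<longlonglongrightarrow> 0"
    by (rule Lp_closureE_LIMSEQ[OF assms]) blast
  have "\<exists>U B. corrector (V N) U B" for N using V(1)[of N] by (simp add: corrector_fields_def)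
  then obtain U B where U: "\<And>N. corrector (V N) (U N) (B N)" by metis
  define W where "W N = (if N = 0 then \<lambda>z. 0 else V N)" for N
  show thesis
  proof (rule that[of W "\<lambda>N. if N = 0 then \<lambda>j x. 0 else U N" "\<lambda>N. if N = 0 then 0 else B N"])
    show "corrector (W N) (if N = 0 then \<lambda>j x. 0 else U N) (if N = 0 then 0 else B N)" for N
      using U[of N] corrector_zero by (simp add: W_def)
    show "(\<lambda>N. Lp_norm_pow PM p (\<lambda>z. w z - W N z)) \<longlonglongrightarrow> 0"
      by (rule Lim_transform_eventually[OF V(2)], rule eventually_mono[OF eventually_gt_at_top[of 0]])
         (simp add: W_def)
  qed simp
qed

text \<open>The index of the corrector grows with \<open>j\<close> so slowly that its gradient stays close to those of
  all previous correctors.\<close>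

lemma ex_diagonal_corrector:
  assumes w: "Lp_fun PM p w" and corr: "\<And>N::nat. corrector (W N) (U N) (B N)" and U_0: "U 0 = (\<lambda>j x. 0)"
    and lim: "(\<lambda>N. Lp_norm_pow PM p (\<lambda>z. w z - W N z)) \<longlonglongrightarrow> 0"
  obtains n err where "\<And>j M. M \<le> n j \<Longrightarrow> Lp_norm_pow MO p (\<lambda>x. grad (U (n j) j) x - grad (U M j) x) \<le>
      err (n j) + err M"
    "\<And>j. Lp_norm_pow MO p (U (n j) j) \<le> 1" "\<And>M::nat. \<forall>\<^sub>F j in sequentially. M \<le> n j" "err \<longlonglongrightarrow> 0"
proof -
  define d where "d N = Lp_norm_pow PM p (\<lambda>z. w z - W N z)" for N
  define err where "err N = 2 powr p * (2 powr p * d N + 1 / real (Suc N))" for N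
  have "err \<longlonglongrightarrow> 2 powr p * (2 powr p * 0 + 0)"
    unfolding err_def d_def by (intro tendsto_intros lim LIMSEQ_Suc lim_1_over_n)
  then have err: "err \<longlonglongrightarrow> 0" by simp
  define Q where "Q N j \<longleftrightarrow> (\<forall>M\<in>{..N}. Lp_norm_pow MO p (\<lambda>x. grad (U N j) x - grad (U M j) x) \<le> err N + err M) \<and>
    Lp_norm_pow MO p (U N j) \<le> 1" for N j
  have "\<forall>\<^sub>F j in sequentially. Lp_norm_pow MO p (\<lambda>x. grad (U N j) x - grad (U M j) x) \<le> err N + err M" for N M
  proof -
    have "Lp_norm_pow PM p (\<lambda>z. W N z - W M z) \<le> 2 powr p * (d N + d M)"
      using Lp_norm_pow_triangle[OF corrector_Lp[OF corr] w corrector_Lp[OF corr] p_bounds(1)]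
      unfolding d_def by (subst (asm) Lp_norm_pow_minus_commute[of _ _ _ w])
    then have "2 powr p * (Lp_norm_pow PM p (\<lambda>z. W N z - W M z) + 1 / real (Suc N)) \<le>
        2 powr p * (2 powr p * (d N + d M) + (1 / real (Suc N) + 1 / real (Suc M)))"
      by (intro mult_left_mono add_mono) auto
    also have "\<dots> = err N + err M" by (simp add: err_def algebra_simps)
    finally have le: "2 powr p * (Lp_norm_pow PM p (\<lambda>z. W N z - W M z) + 1 / real (Suc N)) \<le> err N + err M" .
    have "1 / real (Suc N) > 0" by simp
    from corrector_gradient_diff_eventually_le[OF corr corr this, of N M] show ?thesis
      by eventually_elim (rule order.trans[OF _ le])
  qed
  moreover have "\<forall>\<^sub>F j in sequentially. Lp_norm_pow MO p (U N j) \<le> 1" for N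
    by (rule eventually_mono[OF order_tendstoD(2)[OF corrector_potential_tendsto_0[OF corr] zero_less_one]
      less_imp_le])
  ultimately have "\<forall>\<^sub>F j in sequentially. Q N j" for N
    unfolding Q_def by (intro eventually_conj eventually_ball_finite ballI) auto
  moreover have "Q 0 j" for j
    by (simp add: Q_def U_0 Lp_norm_pow_def err_def d_def integral_nonneg_AE)
  ultimately obtain n where "\<And>j. Q (n j) j" "\<And>M. \<forall>\<^sub>F j in sequentially. M \<le> n j"
    using ex_diagonal_index[of Q] by blast
  then show thesis using that[of n err] err unfolding Q_def by blast
qed

theorem ex_recovery_sequence:
  assumes w: "w \<in> Lp_closure PM p corrector_fields"
  shows "\<exists>u. (\<forall>j. test_fun \<Omega> (u j)) \<and> (\<exists>C. \<forall>j. Lp_norm_pow MO p (u j) \<le> 1 \<and> Lp_norm_pow MO p (grad (u j)) \<le> C) \<and>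
    two_scale_limit (\<lambda>j. grad (u j)) w"
proof -
  note w_Lp = Lp_closure_Lp_fun[OF w]
  obtain W U B where corr: "\<And>N::nat. corrector (W N) (U N) (B N)" and U_0: "U 0 = (\<lambda>j x. 0)"
    and lim: "(\<lambda>N. Lp_norm_pow PM p (\<lambda>z. w z - W N z)) \<longlonglongrightarrow> 0"
    using ex_corrector_sequence[OF w] by blast
  obtain n err where close: "\<And>j M. M \<le> n j \<Longrightarrow> Lp_norm_pow MO p (\<lambda>x. grad (U (n j) j) x - grad (U M j) x) \<le>
      err (n j) + err M"
    and potential: "\<And>j. Lp_norm_pow MO p (U (n j) j) \<le> 1"
    and n: "\<And>M::nat. \<forall>\<^sub>F j in sequentially. M \<le> n j" and err: "err \<longlonglongrightarrow> 0"
    using ex_diagonal_corrector[OF w_Lp corr U_0 lim] by blast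
  obtain E where E: "\<And>N. \<bar>err N\<bar> \<le> E" using convergentI[OF err] convergent_imp_Bseq BseqE by (metis real_norm_def)
  have "Lp_norm_pow MO p (grad (U (n j) j)) \<le> 2 * E" for j
    using close[of 0 j] E[of "n j"] E[of 0] by (simp add: U_0 grad_0)
  moreover have "two_scale_limit (\<lambda>j. grad (U (n j) j)) w"
  proof (rule two_scale_limit_approxI[OF corrector_gradient_Lp[OF corr] w_Lp])
    fix e :: real assume e: "e > 0"
    have "\<forall>\<^sub>F N in sequentially. err N < e / 2 \<and> Lp_norm_pow PM p (\<lambda>z. w z - W N z) < e"
      using e by (intro eventually_conj order_tendstoD(2)[OF err] order_tendstoD(2)[OF lim]) auto
    then obtain M where M: "\<And>N. N \<ge> M \<Longrightarrow> err N < e / 2 \<and> Lp_norm_pow PM p (\<lambda>z. w z - W N z) < e"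
      by (auto simp: eventually_sequentially)
    have "\<forall>\<^sub>F j in sequentially. Lp_norm_pow MO p (\<lambda>x. grad (U (n j) j) x - grad (U M j) x) \<le> e"
      using n[of M]
    proof eventually_elim
      case (elim j)
      then show ?case using close[OF elim] M[OF elim] M[of M] by linarith
    qed
    then show "\<exists>f v. two_scale_limit f v \<and> (\<forall>j. Lp_fun MO p (f j)) \<and> Lp_fun PM p v \<and>
        (\<forall>\<^sub>F j in sequentially. Lp_norm_pow MO p (\<lambda>x. grad (U (n j) j) x - f j x) \<le> e) \<and>
        Lp_norm_pow PM p (\<lambda>z. w z - v z) \<le> e"
      using corrector_two_scale_limit[OF corr] corrector_gradient_Lp[OF corr] corrector_Lp[OF corr] M[of M]
      by (intro exI[of _ "\<lambda>j. grad (U M j)"] exI[of _ "W M"]) auto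
  qed
  ultimately show ?thesis
    using corrector_test_fun[OF corr] potential by (intro exI[of _ "\<lambda>j. U (n j) j"]) blast
qed

lemma ex_gradient_sequence:
  assumes w: "w \<in> Lp_closure PM p corrector_fields" and v: "W1p \<Omega> p v h"
  obtains u g where "\<And>j. W1p \<Omega> p (u j) (g j)" "\<exists>C. \<forall>j. W1p_norm_pow \<Omega> p (u j) (g j) \<le> C"
    "two_scale_limit g (\<lambda>z. h (fst z) + w z)"
proof -
  obtain U C where U: "\<And>j. test_fun \<Omega> (U j)" "\<And>j. Lp_norm_pow MO p (U j) \<le> 1"
      "\<And>j. Lp_norm_pow MO p (grad (U j)) \<le> C"
    and limit: "two_scale_limit (\<lambda>j. grad (U j)) w"
    using ex_recovery_sequence[OF w] by blast
  have v_Lp: "Lp_fun MO p v" "Lp_fun MO p h" using v by (auto simp: W1p_def)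
  have U_Lp: "Lp_fun MO p (U j)" "Lp_fun MO p (grad (U j))" for j
    using test_fun_Lp_fun[OF U(1) open_\<Omega> bounded_\<Omega> p_bounds(1)]
      test_fun_grad_Lp[OF open_\<Omega> bounded_\<Omega> p_bounds(1) U(1)] .
  show thesis
  proof (rule that)
    show "W1p \<Omega> p (\<lambda>x. v x + U j x) (\<lambda>x. h x + grad (U j) x)" for j
      by (intro W1p_add test_fun_W1p open_\<Omega> bounded_\<Omega> p_bounds v U)
    have "W1p_norm_pow \<Omega> p (\<lambda>x. v x + U j x) (\<lambda>x. h x + grad (U j) x) \<le>
        2 powr p * (Lp_norm_pow MO p v + 1) + 2 powr p * (Lp_norm_pow MO p h + C)" for j
      unfolding W1p_norm_pow_eq distrib_left
      using Lp_norm_pow_add_le[OF v_Lp(1) U_Lp(1)[of j] p_bounds(1)]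
        Lp_norm_pow_add_le[OF v_Lp(2) U_Lp(2)[of j] p_bounds(1)]
        mult_left_mono[OF U(2)[of j] powr_ge_zero[of 2 p]] mult_left_mono[OF U(3)[of j] powr_ge_zero[of 2 p]]
      unfolding distrib_left by linarith
    then show "\<exists>C. \<forall>j. W1p_norm_pow \<Omega> p (\<lambda>x. v x + U j x) (\<lambda>x. h x + grad (U j) x) \<le> C" by blast
    show "two_scale_limit (\<lambda>j x. h x + grad (U j) x) (\<lambda>z. h (fst z) + w z)"
      by (intro two_scale_limit_add two_scale_limit_const limit v_Lp U_Lp Lp_fun_PM_fst Lp_closure_Lp_fun[OF w])
  qed
qed

subsection \<open>Characterisation of the limits\<close>

lemma fourier_coeff_cong_AE:
  assumes "AE y in lebesgue_on unit_cell. v y = w y"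
  shows "fourier_coeff v k = fourier_coeff w k"
  unfolding fourier_coeff_def vec_eq_iff vec_lambda_beta
  using assms by (intro allI integral_lebesgue_on_cong_AE) (auto elim!: eventually_mono)

lemma G_R_imp_gradient_moments:
  assumes w: "Lp_fun PM p w" and G: "AE x in MO. v x \<in> G_R p R"
    and eq: "AE x in MO. AE y in lebesgue_on unit_cell. v x y = w (x, y)"
  shows "AE x in MO. gradient_moments R (\<lambda>y. w (x, y))"
  using slice_component_integrable[OF w] G eq
proof eventually_elim
  case (elim x)
  then have "integrable cell_measure (\<lambda>y. w (x, y) $ i)" for i by blast
  from gradient_moments_iff_fourier_coeff[OF this] show ?case
    using elim(2) unfolding fourier_coeff_cong_AE[OF elim(3), symmetric] G_R_def by blast
qed

theorem two_scale_limit_imp_decomposition: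
  assumes v: "Lp_fun (lebesgue_on S) p (\<lambda>z. v (fst z) (snd z))"
    and u: "\<And>j. W1p \<Omega> p (u j) (g j)" "\<And>j. W1p_norm_pow \<Omega> p (u j) (g j) \<le> C"
    and conv: "R_two_scale_conv \<Omega> p R eps g v"
  shows "\<exists>v0 g0 v1. W1p \<Omega> p v0 g0 \<and> Lp_fun (lebesgue_on S) p (\<lambda>z. v1 (fst z) (snd z)) \<and>
    (AE x in MO. v1 x \<in> G_R p R) \<and> (AE z in lebesgue_on S. v (fst z) (snd z) = g0 (fst z) + v1 (fst z) (snd z))"
proof -
  obtain w where w: "w \<in> borel_measurable borel" "Lp_fun PM p w"
    and eq: "AE z in lebesgue_on S. v (fst z) (snd z) = w z"
    using Lp_fun_lebesgue_on_representative[OF v] .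
  have "two_scale_limit g w"
    using conv AE_lebesgue_on_slice[OF eq] R_two_scale_conv_iff_two_scale_limit[OF w(2)] by simp
  from gradient_limit_decomposition[OF u w this] obtain v0 g0 v1
    where "W1p \<Omega> p v0 g0" "Lp_fun (lebesgue_on S) p (\<lambda>z. v1 (fst z) (snd z))" "AE x in MO. v1 x \<in> G_R p R"
      and w_eq: "\<forall>z\<in>S. w z = g0 (fst z) + v1 (fst z) (snd z)"
    by blast
  moreover have "AE z in lebesgue_on S. v (fst z) (snd z) = g0 (fst z) + v1 (fst z) (snd z)"
    using eq AE_space
  proof eventually_elim
    case (elim z)
    then have "z \<in> S" by simp
    then show ?case using elim(1) w_eq by metis
  qed
  ultimately show ?thesis by blast
qed

theorem decomposition_imp_two_scale_limit:
  assumes W: "W1p \<Omega> p v0 g0" and v1: "Lp_fun (lebesgue_on S) p (\<lambda>z. v1 (fst z) (snd z))"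
    and G: "AE x in MO. v1 x \<in> G_R p R"
    and v: "AE z in lebesgue_on S. v (fst z) (snd z) = g0 (fst z) + v1 (fst z) (snd z)"
  shows "\<exists>u g. (\<forall>j. W1p \<Omega> p (u j) (g j)) \<and> (\<exists>C. \<forall>j. W1p_norm_pow \<Omega> p (u j) (g j) \<le> C) \<and>
    R_two_scale_conv \<Omega> p R eps g v"
proof -
  obtain w where w: "Lp_fun PM p w" and v1_eq: "AE z in lebesgue_on S. v1 (fst z) (snd z) = w z"
    using Lp_fun_lebesgue_on_representative[OF v1] .
  have slices: "AE x in MO. AE y in lebesgue_on unit_cell. v1 x y = w (x, y)"
    using AE_lebesgue_on_slice[OF v1_eq] by simp
  obtain u g where u: "\<And>j. W1p \<Omega> p (u j) (g j)" "\<exists>C. \<forall>j. W1p_norm_pow \<Omega> p (u j) (g j) \<le> C"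
    and limit: "two_scale_limit g (\<lambda>z. g0 (fst z) + w z)"
    using ex_gradient_sequence[OF gradient_moments_imp_in_closure[OF w G_R_imp_gradient_moments[OF w G slices]] W]
    by blast
  have "AE z in lebesgue_on S. v (fst z) (snd z) = g0 (fst z) + w z"
    using v v1_eq by eventually_elim simp
  then have "AE x in MO. AE y in lebesgue_on unit_cell. v x y = g0 (fst (x, y)) + w (x, y)"
    using AE_lebesgue_on_slice by fastforce
  moreover have "Lp_fun PM p (\<lambda>z. g0 (fst z) + w z)"
    using W w by (intro Lp_fun_add Lp_fun_PM_fst p_bounds) (auto simp: W1p_def)
  ultimately have "R_two_scale_conv \<Omega> p R eps g v"
    using R_two_scale_conv_iff_two_scale_limit limit by blast
  then show ?thesis using u by blast
qed

end

theorem theorem1p4: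
  fixes \<Omega> :: "(real^'n) set" and p :: real and R :: "real^'n^'m"
    and eps :: "nat \<Rightarrow> real" and v :: "real^'n \<Rightarrow> real^'m \<Rightarrow> real^'n"
  assumes "open \<Omega>" and "bounded \<Omega>"
    and "CARD('n) < CARD('m)"
    and "1 < p"
    and "\<forall>k::real^'m. int_vec k \<and> k \<noteq> 0 \<longrightarrow> transpose R *v k \<noteq> 0"
    and "\<forall>j. 0 < eps j" and "eps \<longlonglongrightarrow> 0"
    and "Lp_fun (lebesgue_on (\<Omega> \<times> unit_cell)) p (\<lambda>z. v (fst z) (snd z))"
  shows "(\<exists>u g. (\<forall>j. W1p \<Omega> p (u j) (g j)) \<and> (\<exists>C. \<forall>j. W1p_norm_pow \<Omega> p (u j) (g j) \<le> C)
              \<and> R_two_scale_conv \<Omega> p R eps g v)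
    \<longleftrightarrow>
    (\<exists>v0 g0 v1. W1p \<Omega> p v0 g0
       \<and> Lp_fun (lebesgue_on (\<Omega> \<times> unit_cell)) p (\<lambda>z. v1 (fst z) (snd z))
       \<and> (AE x in lebesgue_on \<Omega>. v1 x \<in> G_R p R)
       \<and> (AE z in lebesgue_on (\<Omega> \<times> unit_cell). v (fst z) (snd z) = g0 (fst z) + v1 (fst z) (snd z)))"
proof -
  interpret oscillation_Lp \<Omega> R eps p
    by unfold_locales (use assms in auto)
  show ?thesis
    using two_scale_limit_imp_decomposition[OF assms(8)] decomposition_imp_two_scale_limit
    by (intro iffI; elim exE conjE) blast+
qed

end
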